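(* Let $F(\lambda)\in\mathbb C[\lambda]^{p\times p}$ be a matrix polynomial of nonzero degree whose highest column degree coefficient matrix $F_{\mathrm{hcdc}}$ is nonsingular and upper triangular, and whose sequence of Markov parameters $\mathscr S=(\mathbf s_k)_{k=0}^{l}$ is Hermitian, i.e. $\mathbf s_k=\mathbf s_k^*$ for $k=0,\ldots,l$. Let $\mathbf H_0^{\mathscr S}$ and $\mathbf H_1^{\mathscr S}$ be the associated rectangular block Hankel matrices, and let $G(\lambda)$ be a greatest common right divisor of the matrix polynomials $D(\lambda)$ and $S(\lambda)$ associated with $F(\lambda)$ (all defined in the context). Then \begin{align*} \gamma'_-(F)&=\pi(\mathbf H_0^{\mathscr S})+\pi(\mathbf H_1^{\mathscr S})+\gamma'_-(G),\\ \gamma'_+(F)&=\nu(\mathbf H_0^{\mathscr S})+\nu(\mathbf H_1^{\mathscr S})+\gamma'_+(G),\\ \gamma'_0(F)&=\delta(\mathbf H_0^{\mathscr S})+\delta(\mathbf H_1^{\mathscr S})-\gamma'_+(G)-\gamma'_-(G). \end{align*}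
   Context: **Inertia.** For a square complex matrix $A$, $\pi(A),\nu(A),\delta(A)$ are the numbers of eigenvalues of $A$ (with algebraic multiplicity) with positive, negative and zero real part respectively (all $0$ for an empty matrix). For a regular matrix polynomial $F(\lambda)$ ($\det F\not\equiv0$), a finite eigenvalue is a zero of $\det F(\lambda)$, with algebraic multiplicity its multiplicity as a zero of $\det F$; $\gamma'_+(F),\gamma'_-(F),\gamma'_0(F)$ are the numbers of finite eigenvalues (with multiplicity) in the open right half-plane, in the open left half-plane, and on the imaginary axis. **Column degrees.** For a regular $F=[f_1\ \cdots\ f_p]\in\mathbb C[\lambda]^{p\times p}$, $\mathrm{cdeg}_kF$ is the highest degree of the entries of the column $f_k$, and $\deg F=\max_k\mathrm{cdeg}_kF$. Write $F(\lambda)=A\,\mathrm{diag}(\lambda^{\mathrm{cdeg}_1F},\ldots,\lambda^{\mathrm{cdeg}_pF})+L(\lambda)$ with the $k$-th column of $L$ of degree $<\mathrm{cdeg}_kF$; then $F_{\mathrm{hcdc}}:=A$. $F$ is column reduced if $F_{\mathrm{hcdc}}$ is nonsingular. **Dominant and subordinated parts.** Let $F$ be column reduced with $\deg F\in\{2m,2m+1\}$, $\deg F\ge1$. Write each column uniquely as $f_k(\lambda)=f_{k,e}(\lambda^2)+\lambda f_{k,o}(\lambda^2)$ with vector polynomials $f_{k,e},f_{k,o}$. If $\mathrm{cdeg}_kF$ is even put $d_k(\lambda)=f_{k,e}(\lambda)$, $s_k(\lambda)=\lambda f_{k,o}(\lambda)$; if $\mathrm{cdeg}_kF$ is odd put $d_k(\lambda)=f_{k,o}(\lambda)$,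 $s_k(\lambda)=f_{k,e}(\lambda)$. Set $F_d=[d_1\ \cdots\ d_p]$, $F_s=[s_1\ \cdots\ s_p]$. Then $\deg F_d=m$ and $(F_d)_{\mathrm{hcdc}}=F_{\mathrm{hcdc}}$. Let $\alpha(\lambda)=\mathrm{diag}(a_1(\lambda),\ldots,a_p(\lambda))$ with $a_k(\lambda)=1$ if $\mathrm{cdeg}_kF$ is even and $a_k(\lambda)=\lambda$ if it is odd. Define the matrix polynomials $$D(\lambda)=F_d(\lambda^2)\alpha(\lambda),\qquad S(\lambda)=\lambda^{-1}F_s(\lambda^2)\alpha(\lambda),$$ so that $F=D+S$. **Markov parameters.** The rational matrix $R_F(\lambda)=F_s(\lambda)F_d(\lambda)^{-1}$ has a finite limit at $\infty$ and expands as $R_F(\lambda)=\sum_{k\ge0}(-1)^k\lambda^{-k}\mathbf s_k$ as $\lambda\to\infty$. Put $l=2m-1$ if all column degrees of $F$ are even and $l=2m$ otherwise. The sequence of Markov parameters of $F$ is $\mathscr S=(\mathbf s_k)_{k=0}^{l}$. **Block Hankel matrices.** For a matrix $A$ and index sets $\mathcal I,\mathcal J$, $A_{\mathcal I}^{\mathcal J}$ is the submatrix formed by the rows with indices in $\mathcal I$ and the columns with indices in $\mathcal J$ (in increasing order). For $i=-1,0,\ldots,m$ let $\mathcal I_i=\{k: \mathrm{cdeg}_kF_d>i\}$, $\mathcal I_i^e=\{k\in\mathcal I_i:\mathrm{cdeg}_kF\text{ even}\}$, $\mathcal I_i^o=\{k\in\mathcal I_i:\mathrm{cdeg}_kF\text{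 odd}\}$, and for $i=0,\ldots,m$ let $\widetilde{\mathcal I}_i=\mathcal I_i^e\cup\mathcal I_{i-1}^o$. Set $\widetilde{\mathbf h}_{i,j}=(\mathbf s_{i+j})_{\widetilde{\mathcal I}_i}^{\widetilde{\mathcal I}_j}$ and $\mathbf h_{i,j}=(\mathbf s_{i+j+1})_{\mathcal I_i}^{\mathcal I_j}$. Then $\mathbf H_1^{\mathscr S}=(\mathbf h_{i,j})_{i,j=0}^{m-1}$ (empty if $m=0$), while $\mathbf H_0^{\mathscr S}=(\widetilde{\mathbf h}_{i,j})_{i,j=0}^{m-1}$ if all column degrees of $F$ are even and $\mathbf H_0^{\mathscr S}=(\widetilde{\mathbf h}_{i,j})_{i,j=0}^{m}$ if at least one column degree of $F$ is odd. Blocks with an empty index set are empty. **GCRD.** $L$ is a right divisor of $F$ if $F=ML$ for some matrix polynomial $M$; a greatest common right divisor of two $p\times p$ matrix polynomials is a common right divisor $L\in\mathbb C[\lambda]^{p\times p}$ such that every common right divisor is a right divisor of $L$. *)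

theory Defs
  imports
    Complex_Main
    "HOL-Computational_Algebra.Polynomial"
    "Jordan_Normal_Form.Gauss_Jordan_Elimination"
    "Jordan_Normal_Form.Char_Poly"
    "Jordan_Normal_Form.Schur_Decomposition"
    "Jordan_Normal_Form.DL_Submatrix"
begin

text \<open>
  A \<open>p \<times> p\<close> matrix polynomial over the complex numbers is an element of
  \<^term>\<open>carrier_mat p p :: complex poly mat set\<close>. Rows and columns are numbered from \<open>0\<close>.
\<close>

section \<open>Inertia\<close>

text \<open>
  \<^const>\<open>proots\<close> lists the zeros of a polynomial with multiplicity. The empty matrix has
  characteristic polynomial \<open>1\<close>, so all its inertia indices are \<open>0\<close>.
\<close>

definition inertia_pos :: "complex mat \<Rightarrow> nat" where
  "inertia_pos A = size (filter_mset (\<lambda>z. Re z > 0) (proots (char_poly A)))"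

definition inertia_neg :: "complex mat \<Rightarrow> nat" where
  "inertia_neg A = size (filter_mset (\<lambda>z. Re z < 0) (proots (char_poly A)))"

definition inertia_zero :: "complex mat \<Rightarrow> nat" where
  "inertia_zero A = size (filter_mset (\<lambda>z. Re z = 0) (proots (char_poly A)))"

definition gamma_pos :: "complex poly mat \<Rightarrow> nat" where
  "gamma_pos F = size (filter_mset (\<lambda>z. Re z > 0) (proots (det F)))"

definition gamma_neg :: "complex poly mat \<Rightarrow> nat" where
  "gamma_neg F = size (filter_mset (\<lambda>z. Re z < 0) (proots (det F)))"

definition gamma_zero :: "complex poly mat \<Rightarrow> nat" where
  "gamma_zero F = size (filter_mset (\<lambda>z. Re z = 0) (proots (det F)))"

section \<open>Column degrees\<close>

definition cdeg :: "complex poly mat \<Rightarrow> nat \<Rightarrow> nat" where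
  "cdeg F k = Max ((\<lambda>i. degree (F $$ (i, k))) ` {..<dim_row F})"

definition mat_deg :: "complex poly mat \<Rightarrow> nat" where
  "mat_deg F = Max (cdeg F ` {..<dim_col F})"

definition hcdc :: "complex poly mat \<Rightarrow> complex mat" where
  "hcdc F = mat (dim_row F) (dim_col F) (\<lambda>(i, k). coeff (F $$ (i, k)) (cdeg F k))"

definition column_reduced :: "complex poly mat \<Rightarrow> bool" where
  "column_reduced F \<longleftrightarrow> det (hcdc F) \<noteq> 0"

section \<open>Dominant and subordinated parts\<close>

definition even_part :: "complex poly \<Rightarrow> complex poly" where
  "even_part f = (\<Sum>j\<le>degree f. monom (coeff f (2 * j)) j)"

definition odd_part :: "complex poly \<Rightarrow> complex poly" where
  "odd_part f = (\<Sum>j\<le>degree f. monom (coeff f (2 * j + 1)) j)"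

lemma coeff_even_part: "coeff (even_part f) n = coeff f (2 * n)"
  by (auto simp: even_part_def coeff_sum coeff_eq_0)

lemma coeff_odd_part: "coeff (odd_part f) n = coeff f (2 * n + 1)"
  by (auto simp: odd_part_def coeff_sum coeff_eq_0)

definition dominant_part :: "complex poly mat \<Rightarrow> complex poly mat" where
  "dominant_part F = mat (dim_row F) (dim_col F) (\<lambda>(i, k).
     if even (cdeg F k) then even_part (F $$ (i, k)) else odd_part (F $$ (i, k)))"

definition subordinated_part :: "complex poly mat \<Rightarrow> complex poly mat" where
  "subordinated_part F = mat (dim_row F) (dim_col F) (\<lambda>(i, k).
     if even (cdeg F k) then [:0, 1:] * odd_part (F $$ (i, k)) else even_part (F $$ (i, k)))"

definition subst_square :: "complex poly mat \<Rightarrow> complex poly mat" where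
  "subst_square A = map_mat (\<lambda>f. pcompose f ([:0, 1:] ^ 2)) A"

definition alpha_mat :: "complex poly mat \<Rightarrow> complex poly mat" where
  "alpha_mat F = mat_diag (dim_col F) (\<lambda>k. if even (cdeg F k) then 1 else [:0, 1:])"

definition D_part :: "complex poly mat \<Rightarrow> complex poly mat" where
  "D_part F = subst_square (dominant_part F) * alpha_mat F"

text \<open>The division is exact, see \<open>S_part_exact\<close> below.\<close>

definition S_part :: "complex poly mat \<Rightarrow> complex poly mat" where
  "S_part F = map_mat (\<lambda>f. f div [:0, 1:]) (subst_square (subordinated_part F) * alpha_mat F)"

section \<open>Markov parameters\<close>

definition eval_mat :: "complex poly mat \<Rightarrow> complex \<Rightarrow> complex mat" where
  "eval_mat A z = map_mat (\<lambda>f. poly f z) A"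

text \<open>
  The value of \<open>F\<^sub>s F\<^sub>d\<^sup>-\<^sup>1\<close> at a point \<open>z\<close>. It is meaningful where \<open>F\<^sub>d(z)\<close> is nonsingular,
  that is, for column reduced \<open>F\<close>, for all but finitely many \<open>z\<close>.
\<close>

definition R_value :: "complex poly mat \<Rightarrow> complex \<Rightarrow> complex mat" where
  "R_value F z =
     eval_mat (subordinated_part F) z * the (mat_inverse (eval_mat (dominant_part F) z))"

definition markov_expansion :: "complex poly mat \<Rightarrow> (nat \<Rightarrow> complex mat) \<Rightarrow> bool" where
  "markov_expansion F s \<longleftrightarrow>
     (\<forall>k. s k \<in> carrier_mat (dim_row F) (dim_col F)) \<and>
     (\<forall>i<dim_row F. \<forall>j<dim_col F. \<forall>\<^sub>F z in at_infinity.
        (\<lambda>k. (-1) ^ k * (1 / z ^ k) * s k $$ (i, j)) sums (R_value F z $$ (i, j)))"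

abbreviation half_deg :: "complex poly mat \<Rightarrow> nat" where
  "half_deg F \<equiv> mat_deg F div 2"

definition markov_last :: "complex poly mat \<Rightarrow> nat" where
  "markov_last F =
     (if \<forall>k<dim_col F. even (cdeg F k) then 2 * half_deg F - 1 else 2 * half_deg F)"

section \<open>Block Hankel matrices\<close>

definition append_cols :: "'a :: zero mat \<Rightarrow> 'a mat \<Rightarrow> 'a mat" where
  "append_cols A B = four_block_mat A B (0\<^sub>m 0 (dim_col A)) (0\<^sub>m 0 (dim_col B))"

text \<open>The block matrix whose block in position \<open>(i, j)\<close>, for \<open>i, j < n\<close>, is \<open>B i j\<close>.\<close>

definition block_mat :: "nat \<Rightarrow> (nat \<Rightarrow> nat \<Rightarrow> 'a :: zero mat) \<Rightarrow> 'a mat" where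
  "block_mat n B =
     foldr append_rows
       (map (\<lambda>i. foldr append_cols (map (B i) [0..<n]) (0\<^sub>m (dim_row (B i 0)) 0)) [0..<n])
       (0\<^sub>m 0 0)"

text \<open>The index is an integer because \<open>I\<^sub>-\<^sub>1\<close> is needed.\<close>

definition idx :: "complex poly mat \<Rightarrow> int \<Rightarrow> nat set" where
  "idx F i = {k. k < dim_col F \<and> int (cdeg (dominant_part F) k) > i}"

definition idx_even :: "complex poly mat \<Rightarrow> int \<Rightarrow> nat set" where
  "idx_even F i = {k \<in> idx F i. even (cdeg F k)}"

definition idx_odd :: "complex poly mat \<Rightarrow> int \<Rightarrow> nat set" where
  "idx_odd F i = {k \<in> idx F i. odd (cdeg F k)}"

definition idx_tilde :: "complex poly mat \<Rightarrow> nat \<Rightarrow> nat set" where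
  "idx_tilde F i = idx_even F (int i) \<union> idx_odd F (int i - 1)"

definition hankel0 :: "complex poly mat \<Rightarrow> (nat \<Rightarrow> complex mat) \<Rightarrow> complex mat" where
  "hankel0 F s =
     block_mat (if \<forall>k<dim_col F. even (cdeg F k) then half_deg F else half_deg F + 1)
       (\<lambda>i j. submatrix (s (i + j)) (idx_tilde F i) (idx_tilde F j))"

definition hankel1 :: "complex poly mat \<Rightarrow> (nat \<Rightarrow> complex mat) \<Rightarrow> complex mat" where
  "hankel1 F s =
     block_mat (half_deg F)
       (\<lambda>i j. submatrix (s (i + j + 1)) (idx F (int i)) (idx F (int j)))"

section \<open>Greatest common right divisors\<close>

definition right_divisor :: "nat \<Rightarrow> complex poly mat \<Rightarrow> complex poly mat \<Rightarrow> bool" where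
  "right_divisor p L F \<longleftrightarrow>
     L \<in> carrier_mat p p \<and> (\<exists>M \<in> carrier_mat p p. F = M * L)"

definition is_gcrd :: "nat \<Rightarrow> complex poly mat \<Rightarrow> complex poly mat \<Rightarrow> complex poly mat \<Rightarrow> bool" where
  "is_gcrd p G A B \<longleftrightarrow>
     right_divisor p G A \<and> right_divisor p G B \<and>
     (\<forall>L. right_divisor p L A \<and> right_divisor p L B \<longrightarrow> right_divisor p L G)"

section \<open>Consistency of the definitions\<close>

lemma coeff_pcompose_square:
  "coeff (pcompose f ([:0, 1:] ^ 2)) n = (if even n then coeff f (n div 2) else 0)"
  for f :: "complex poly"
proof (induction f arbitrary: n)
  case 0
  then show ?case by simp
next
  case (pCons a f)
  have "pcompose (pCons a f) ([:0, 1:] ^ 2) =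
      [:a:] + pCons 0 (pCons 0 (pcompose f ([:0, 1:] ^ 2)))"
    by (simp add: pcompose_pCons power2_eq_square)
  then show ?case using pCons.IH
    by (auto simp: coeff_pCons split: nat.splits)
qed

lemma even_odd_decomposition:
  "f = pcompose (even_part f) ([:0, 1:] ^ 2) + [:0, 1:] * pcompose (odd_part f) ([:0, 1:] ^ 2)"
  by (rule poly_eqI)
     (auto simp: coeff_pcompose_square coeff_even_part coeff_odd_part coeff_pCons
       elim!: evenE oddE split: nat.splits)

lemma hcdc_decomposition:
  assumes "i < dim_row F" "k < dim_col F"
  shows "degree (F $$ (i, k)) \<le> cdeg F k"
    and "n \<ge> cdeg F k \<Longrightarrow>
      coeff (F $$ (i, k) - monom (hcdc F $$ (i, k)) (cdeg F k)) n = 0"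
proof -
  show deg: "degree (F $$ (i, k)) \<le> cdeg F k"
    unfolding cdeg_def using assms by (intro Max_ge) auto
  show "coeff (F $$ (i, k) - monom (hcdc F $$ (i, k)) (cdeg F k)) n = 0" if "n \<ge> cdeg F k"
    using that deg assms by (cases "n = cdeg F k") (auto simp: hcdc_def coeff_eq_0)
qed

lemma S_part_index:
  assumes "i < dim_row F" "k < dim_col F"
  shows "(subst_square (subordinated_part F) * alpha_mat F) $$ (i, k) =
    [:0, 1:] * (if even (cdeg F k)
      then [:0, 1:] * pcompose (odd_part (F $$ (i, k))) ([:0, 1:] ^ 2)
      else pcompose (even_part (F $$ (i, k))) ([:0, 1:] ^ 2))"
proof -
  have "subst_square (subordinated_part F) \<in> carrier_mat (dim_row F) (dim_col F)"
    by (simp add: subst_square_def subordinated_part_def)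
  then show ?thesis unfolding alpha_mat_def
    by (subst mat_diag_mult_right[where nr = "dim_row F"])
       (use assms in \<open>auto simp: subst_square_def subordinated_part_def pcompose_pCons
          pcompose_mult power2_eq_square\<close>)
qed

lemma S_part_exact: "[:0, 1:] \<cdot>\<^sub>m S_part F = subst_square (subordinated_part F) * alpha_mat F"
proof (rule eq_matI)
  fix i k
  assume "i < dim_row (subst_square (subordinated_part F) * alpha_mat F)"
    and "k < dim_col (subst_square (subordinated_part F) * alpha_mat F)"
  then have "i < dim_row F" "k < dim_col F"
    by (auto simp: subst_square_def subordinated_part_def alpha_mat_def mat_diag_def)
  note idx = S_part_index[OF this]
  have "(subst_square (subordinated_part F) * alpha_mat F) $$ (i, k) div [:0, 1:] * [:0, 1:] =
      (subst_square (subordinated_part F) * alpha_mat F) $$ (i, k)"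
    unfolding idx by (intro dvd_div_mult_self dvd_triv_left)
  then show "([:0, 1:] \<cdot>\<^sub>m S_part F) $$ (i, k) =
      (subst_square (subordinated_part F) * alpha_mat F) $$ (i, k)"
    using \<open>i < dim_row (subst_square (subordinated_part F) * alpha_mat F)\<close>
      \<open>k < dim_col (subst_square (subordinated_part F) * alpha_mat F)\<close>
    unfolding S_part_def by (simp add: mult.commute)
qed (auto simp: S_part_def)

lemma D_plus_S: "F = D_part F + S_part F"
proof (rule eq_matI)
  fix i k
  assume "i < dim_row (D_part F + S_part F)" "k < dim_col (D_part F + S_part F)"
  then have ik: "i < dim_row F" "k < dim_col F"
    by (auto simp: S_part_def subst_square_def subordinated_part_def alpha_mat_def mat_diag_def)
  have S: "S_part F $$ (i, k) = (if even (cdeg F k)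
      then [:0, 1:] * pcompose (odd_part (F $$ (i, k))) ([:0, 1:] ^ 2)
      else pcompose (even_part (F $$ (i, k))) ([:0, 1:] ^ 2))"
  proof -
    have "i < dim_row (subst_square (subordinated_part F) * alpha_mat F)"
      "k < dim_col (subst_square (subordinated_part F) * alpha_mat F)"
      using ik by (auto simp: subst_square_def subordinated_part_def alpha_mat_def mat_diag_def)
    then show ?thesis unfolding S_part_def
      by (subst index_map_mat(1)) (simp_all only: S_part_index[OF ik], 
          rule nonzero_mult_div_cancel_left, simp)
  qed
  have "subst_square (dominant_part F) \<in> carrier_mat (dim_row F) (dim_col F)"
    by (simp add: subst_square_def dominant_part_def)
  then have D: "D_part F $$ (i, k) = (if even (cdeg F k)
      then pcompose (even_part (F $$ (i, k))) ([:0, 1:] ^ 2)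
      else [:0, 1:] * pcompose (odd_part (F $$ (i, k))) ([:0, 1:] ^ 2))"
    unfolding D_part_def alpha_mat_def
    by (subst mat_diag_mult_right[where nr = "dim_row F"])
       (use ik in \<open>auto simp: subst_square_def dominant_part_def\<close>)
  have "F $$ (i, k) = D_part F $$ (i, k) + S_part F $$ (i, k)"
    unfolding S D using even_odd_decomposition[of "F $$ (i, k)"] by (auto simp: add.commute)
  then show "F $$ (i, k) = (D_part F + S_part F) $$ (i, k)"
    using ik \<open>i < dim_row (D_part F + S_part F)\<close> \<open>k < dim_col (D_part F + S_part F)\<close> by simp
qed (auto simp: S_part_def subst_square_def subordinated_part_def alpha_mat_def mat_diag_def)

end

theory Submission
  imports Defs "HOL-Computational_Algebra.Fundamental_Theorem_Algebra"
begin

text \<open>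
  Write \<open>W = S D\<^sup>-\<^sup>1 = \<lambda>\<^sup>-\<^sup>1 R(\<lambda>\<^sup>2)\<close>. Since the highest column degree coefficient matrix is upper
  triangular and nonsingular, the monomials \<open>\<lambda>\<^sup>j e\<^sub>k\<close> with \<open>j < cdeg\<^sub>k F\<close> form a basis of
  \<open>\<complex>[\<lambda>]\<^sup>p / D \<complex>[\<lambda>]\<^sup>p\<close>. Multiplication by \<open>\<lambda>\<close> on this space, the classes of the constants and the
  residue of \<open>W x\<close> at infinity are matrices \<open>T\<close>, \<open>B\<close>, \<open>C\<close>, and \<open>W = C (\<lambda> - T)\<^sup>-\<^sup>1 B\<close>. The form
  \<open>(x, y) \<mapsto>\<close> residue of \<open>y(-\<lambda>)\<^sup>* W(\<lambda>) x(\<lambda>)\<close> has, in the signed monomial basis, the Gram matrix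
  \<open>H = H\<^sub>0 \<oplus> H\<^sub>1\<close> (even and odd powers are orthogonal), and the Hermitian Markov parameters give
  \<open>H T = - T\<^sup>* H\<close> and \<open>C = B\<^sup>* H\<close>. Hence \<open>A = T - B C\<close> has characteristic polynomial \<open>det F\<close> up to a
  factor and satisfies the Lyapunov equation \<open>H A + A\<^sup>* H = - 2 C\<^sup>* C\<close>. Modulo the kernel of \<open>H\<close> the pair
  \<open>(C, A)\<close> is observable, so there the numbers of eigenvalues of \<open>A\<close> in the left and right half-plane
  are \<open>\<pi>(H)\<close> and \<open>\<nu>(H)\<close>. On the kernel \<open>A\<close> agrees with \<open>T\<close>, whose characteristic polynomial
  there is \<open>det G\<close> up to a factor, by a Bezout identity \<open>G = X S + Y D\<close>.
\<close>

section \<open>Adjoints and block matrices\<close>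

text \<open>The argument \<open>-\<lambda>\<close> on one side of the form makes multiplication by
  \<open>\<lambda>\<close> skew-adjoint, so \<open>T\<close> drops out of the Lyapunov equation and
  only the feedback \<open>B C\<close> contributes. The right-hand side is merely semidefinite: the
  form takes a definite sign at an eigenvector \<open>v\<close> only if \<open>C v\<close> is
  nonzero. This is why observability matters, and why the kernel of \<open>H\<close>, where it
  fails, must be split off and charged to \<open>G\<close>. \<open>D\<close> carries all leading
  column coefficients of \<open>F\<close>, so \<open>det D\<close> and \<open>det F\<close> have the
  same degree, the number of basis monomials. This reduces comparisons of determinants with
  characteristic polynomials to degree counts. The inertia of \<open>H\<close> counts eigenvalues,
  whereas the Lyapunov argument yields signs of a congruent diagonal form; Sylvester's law and a
  second Lyapunov equation connect the two. The third identity combines two facts: \<open>F\<close>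
  and \<open>G\<close> have equally many zeros on the imaginary axis, and \<open>H\<close> has as
  many zero eigenvalues as the degree of \<open>det G\<close>.\<close>

lemma mat_adjoint_dim [simp]:
  "dim_row (mat_adjoint A) = dim_col A" "dim_col (mat_adjoint A) = dim_row A"
  by (simp_all add: mat_adjoint_def)

lemma mat_adjoint_carrier [simp, intro]:
  "A \<in> carrier_mat n m \<Longrightarrow> mat_adjoint A \<in> carrier_mat m n"
  by (intro carrier_matI) auto

lemma mat_adjoint_index [simp]:
  fixes A :: "complex mat"
  assumes "i < dim_col A" "j < dim_row A"
  shows "mat_adjoint A $$ (i, j) = cnj (A $$ (j, i))"
  using assms by (simp add: mat_adjoint_def mat_of_rows_index)

lemma mat_adjoint_adjoint [simp]: "mat_adjoint (mat_adjoint A) = (A :: complex mat)"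
  by (rule eq_matI) auto

lemma mat_adjoint_one [simp]: "mat_adjoint (1\<^sub>m n) = (1\<^sub>m n :: complex mat)"
  by (rule eq_matI) auto

lemma mat_adjoint_zero [simp]: "mat_adjoint (0\<^sub>m n m) = (0\<^sub>m m n :: complex mat)"
  by (rule eq_matI) auto

lemma mat_adjoint_mult:
  fixes A B :: "complex mat"
  assumes "A \<in> carrier_mat n m" "B \<in> carrier_mat m k"
  shows "mat_adjoint (A * B) = mat_adjoint B * mat_adjoint A"
  using assms by (intro eq_matI) (auto simp: scalar_prod_def mult.commute intro!: sum.cong)

lemma mat_adjoint_minus:
  fixes A B :: "complex mat"
  assumes "A \<in> carrier_mat n m" "B \<in> carrier_mat n m"
  shows "mat_adjoint (A - B) = mat_adjoint A - mat_adjoint B"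
  using assms by (intro eq_matI) auto

lemma mat_adjoint_uminus: "mat_adjoint (- A) = - mat_adjoint (A :: complex mat)"
  by (intro eq_matI) auto

lemma mat_adjoint_smult: "mat_adjoint (c \<cdot>\<^sub>m A) = cnj c \<cdot>\<^sub>m mat_adjoint (A :: complex mat)"
  by (intro eq_matI) auto

lemma mat_adjoint_four_block:
  fixes A B C D :: "complex mat"
  assumes "A \<in> carrier_mat n1 m1" "B \<in> carrier_mat n1 m2"
    "C \<in> carrier_mat n2 m1" "D \<in> carrier_mat n2 m2"
  shows "mat_adjoint (four_block_mat A B C D) =
    four_block_mat (mat_adjoint A) (mat_adjoint C) (mat_adjoint B) (mat_adjoint D)"
  using assms by (intro eq_matI) auto

lemma mat_adjoint_congruence:
  fixes P H :: "complex mat"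
  assumes "P \<in> carrier_mat n m" "H \<in> carrier_mat n n" "mat_adjoint H = H"
  shows "mat_adjoint (mat_adjoint P * H * P) = mat_adjoint P * H * P"
proof -
  note [simp] = assms(3)
  have PH: "mat_adjoint P * H \<in> carrier_mat m n" using assms by auto
  have "mat_adjoint (mat_adjoint P * H * P) = mat_adjoint P * (mat_adjoint H * mat_adjoint (mat_adjoint P))"
    unfolding mat_adjoint_mult[OF PH assms(1)] mat_adjoint_mult[OF mat_adjoint_carrier[OF assms(1)] assms(2)] ..
  also have "\<dots> = mat_adjoint P * H * P"
    using assms(1,2) by (simp add: assoc_mult_mat[of _ m n _ n _ m])
  finally show ?thesis .
qed

lemma congruence_comp:
  fixes P R H :: "complex mat"
  assumes "P \<in> carrier_mat n n" "R \<in> carrier_mat n k" "H \<in> carrier_mat n n"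
  shows "mat_adjoint (P * R) * H * (P * R) = mat_adjoint R * (mat_adjoint P * H * P) * R"
  using assms
  by (simp add: mat_adjoint_mult[of _ n n _ k] mult_carrier_mat[of _ n n _ n] mult_carrier_mat[of _ n n _ k]
      mult_carrier_mat[of _ k n _ n]
      assoc_mult_mat[of _ n n _ n _ k] assoc_mult_mat[of _ n n _ n _ n] assoc_mult_mat[of _ k n _ n _ n]
      assoc_mult_mat[of _ k n _ n _ k])

lemma congruence_similarity:
  fixes H A P Q :: "complex mat"
  assumes [simp]: "H \<in> carrier_mat n n" "A \<in> carrier_mat n n" "P \<in> carrier_mat n n" "Q \<in> carrier_mat n n"
    and PQ: "P * Q = 1\<^sub>m n"
  shows "mat_adjoint P * H * P * (Q * A * P) = mat_adjoint P * (H * A) * P"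
    "mat_adjoint (Q * A * P) * (mat_adjoint P * H * P) = mat_adjoint P * (mat_adjoint A * H) * P"
proof -
  note [simp] = mult_carrier_mat[of _ n n _ n]
  have "mat_adjoint P * H * P * (Q * A * P) = mat_adjoint P * H * (P * Q) * (A * P)"
    by (simp add: assoc_mult_mat[of _ n n _ n _ n])
  then show "mat_adjoint P * H * P * (Q * A * P) = mat_adjoint P * (H * A) * P"
    by (simp add: PQ left_mult_one_mat[of _ n n] assoc_mult_mat[of _ n n _ n _ n])
  have "mat_adjoint (Q * A * P) = mat_adjoint P * mat_adjoint A * mat_adjoint Q"
    by (simp add: mat_adjoint_mult[of _ n n _ n] assoc_mult_mat[of _ n n _ n _ n])
  then have "mat_adjoint (Q * A * P) * (mat_adjoint P * H * P) =
      mat_adjoint P * mat_adjoint A * (mat_adjoint Q * mat_adjoint P) * (H * P)"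
    by (simp add: assoc_mult_mat[of _ n n _ n _ n])
  also have "mat_adjoint Q * mat_adjoint P = 1\<^sub>m n"
    using arg_cong[OF PQ, of mat_adjoint] by (simp add: mat_adjoint_mult[of _ n n _ n])
  finally show "mat_adjoint (Q * A * P) * (mat_adjoint P * H * P) = mat_adjoint P * (mat_adjoint A * H) * P"
    by (simp add: left_mult_one_mat[of _ n n] assoc_mult_mat[of _ n n _ n _ n])
qed

text \<open>Extends a congruence of the trailing block to the whole form; \<open>K\<close> is the
  entry already split off in the inductions on the dimension.\<close>

lemma block_diag_congruence:
  fixes K H P :: "complex mat"
  assumes K: "K \<in> carrier_mat 1 1" and H: "H \<in> carrier_mat m m" and P: "P \<in> carrier_mat m m"
  defines "R \<equiv> four_block_mat (1\<^sub>m 1) (0\<^sub>m 1 m) (0\<^sub>m m 1) P"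
  shows "R \<in> carrier_mat (1 + m) (1 + m)" "det R = det P"
    "mat_adjoint R * four_block_mat K (0\<^sub>m 1 m) (0\<^sub>m m 1) H * R =
      four_block_mat K (0\<^sub>m 1 m) (0\<^sub>m m 1) (mat_adjoint P * H * P)"
proof -
  show "R \<in> carrier_mat (1 + m) (1 + m)" unfolding R_def using P by (intro four_block_carrier_mat) auto
  show "det R = det P" unfolding R_def
    using P by (subst det_four_block_mat_upper_right_zero[of _ 1 _ m]) auto
  have aR: "mat_adjoint R = four_block_mat (1\<^sub>m 1) (0\<^sub>m 1 m) (0\<^sub>m m 1) (mat_adjoint P)"
    unfolding R_def using P by (subst mat_adjoint_four_block[of _ 1 1 _ m _ m]) auto
  have 1: "mat_adjoint R * four_block_mat K (0\<^sub>m 1 m) (0\<^sub>m m 1) H =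
      four_block_mat K (0\<^sub>m 1 m) (0\<^sub>m m 1) (mat_adjoint P * H)"
    unfolding aR using P H K
    by (subst mult_four_block_mat[of _ 1 1 _ m _ m _ _ 1 _ m]) (auto intro!: cong_four_block_mat)
  show "mat_adjoint R * four_block_mat K (0\<^sub>m 1 m) (0\<^sub>m m 1) H * R =
      four_block_mat K (0\<^sub>m 1 m) (0\<^sub>m m 1) (mat_adjoint P * H * P)"
    unfolding 1 unfolding R_def using P H K
    by (subst mult_four_block_mat[of _ 1 1 _ m _ m _ _ 1 _ m]) (auto intro!: cong_four_block_mat)
qed

text \<open>The Lyapunov equation of the feedback matrix carries a factor 2, which is absorbed into
  the output matrix.\<close>

lemma adjoint_sqrt2_mult:
  fixes C :: "complex mat"
  shows "mat_adjoint (complex_of_real (sqrt 2) \<cdot>\<^sub>m C) * (complex_of_real (sqrt 2) \<cdot>\<^sub>m C) =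
    2 \<cdot>\<^sub>m (mat_adjoint C * C)"
proof -
  define c where "c = complex_of_real (sqrt 2)"
  have c: "cnj c * x * (c * y) = 2 * (x * y)" for x y
  proof -
    have "cnj c * x * (c * y) = (c * c) * (x * y)" by (simp add: c_def mult_ac)
    then show ?thesis by (simp add: c_def of_real_mult[symmetric] del: of_real_mult)
  qed
  show ?thesis unfolding c_def[symmetric]
    by (intro eq_matI) (auto simp: scalar_prod_def sum_distrib_left c)
qed

lemma four_block_matD:
  assumes "four_block_mat A B C D = four_block_mat A' B' C' D'"
    and "A \<in> carrier_mat n1 m1" "B \<in> carrier_mat n1 m2" "C \<in> carrier_mat n2 m1" "D \<in> carrier_mat n2 m2"
    and "A' \<in> carrier_mat n1 m1" "B' \<in> carrier_mat n1 m2" "C' \<in> carrier_mat n2 m1" "D' \<in> carrier_mat n2 m2"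
  shows "A = A'" "B = B'" "C = C'" "D = D'"
proof -
  have eq: "four_block_mat A B C D $$ (i, j) = four_block_mat A' B' C' D' $$ (i, j)" for i j
    using assms(1) by simp
  show "A = A'"
  proof (rule eq_matI)
    fix i j assume "i < dim_row A'" "j < dim_col A'"
    then show "A $$ (i, j) = A' $$ (i, j)" using eq[of i j] assms(2-) by simp
  qed (use assms in auto)
  show "B = B'"
  proof (rule eq_matI)
    fix i j assume "i < dim_row B'" "j < dim_col B'"
    then show "B $$ (i, j) = B' $$ (i, j)" using eq[of i "j + m1"] assms(2-) by simp
  qed (use assms in auto)
  show "C = C'"
  proof (rule eq_matI)
    fix i j assume "i < dim_row C'" "j < dim_col C'"
    then show "C $$ (i, j) = C' $$ (i, j)" using eq[of "i + n1" "j"] assms(2-) by simp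
  qed (use assms in auto)
  show "D = D'"
  proof (rule eq_matI)
    fix i j assume "i < dim_row D'" "j < dim_col D'"
    then show "D $$ (i, j) = D' $$ (i, j)" using eq[of "i + n1" "j + m1"] assms(2-) by simp
  qed (use assms in auto)
qed

lemma mat_four_blockE:
  assumes "A \<in> carrier_mat (n1 + n2) (m1 + m2)"
  obtains A1 A2 A3 A4 where "A = four_block_mat A1 A2 A3 A4"
    "A1 \<in> carrier_mat n1 m1" "A2 \<in> carrier_mat n1 m2" "A3 \<in> carrier_mat n2 m1" "A4 \<in> carrier_mat n2 m2"
proof -
  obtain A1 A2 A3 A4 where s: "split_block A n1 m1 = (A1, A2, A3, A4)"
    by (metis prod_cases4)
  from split_block[OF s, of n2 m2] assms that show thesis by auto
qed

lemma det_nonzero_inverseE: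
  fixes P :: "'a :: field mat"
  assumes "P \<in> carrier_mat n n" "det P \<noteq> 0"
  obtains Q where "Q \<in> carrier_mat n n" "P * Q = 1\<^sub>m n" "Q * P = 1\<^sub>m n"
proof -
  have "P \<in> Units (ring_mat TYPE('a) n ())" by (rule det_non_zero_imp_unit[OF assms])
  then obtain Q where "Q \<in> carrier_mat n n" "Q * P = 1\<^sub>m n" "P * Q = 1\<^sub>m n"
    unfolding Units_def ring_mat_simps by blast
  then show thesis using that by blast
qed

lemma inverse_det_nonzero:
  fixes P :: "'a :: field mat"
  assumes "P \<in> carrier_mat n n" "Q \<in> carrier_mat n n" "P * Q = 1\<^sub>m n"
  shows "det P \<noteq> 0"
  using det_mult[OF assms(1,2)] unfolding assms(3) det_one by (metis mult_zero_left zero_neq_one)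

text \<open>Gram-Schmidt leaves the first vector of a completed basis unchanged, and a matrix with
  orthogonal nonzero columns has an explicit left inverse.\<close>

lemma complete_to_invertible:
  fixes v :: "complex vec"
  assumes v: "v \<in> carrier_vec n" and v0: "v \<noteq> 0\<^sub>v n"
  obtains P where "P \<in> carrier_mat n n" "det P \<noteq> 0" "col P 0 = v"
proof -
  interpret cof_vec_space n "TYPE(complex)" .
  define b where "b = basis_completion v"
  define ws where "ws = gram_schmidt n b"
  define W where "W = mat_of_cols n ws"
  define W' where "W' = corthogonal_inv W"
  from basis_completion[OF v v0, folded b_def]
  have b: "set b \<subseteq> carrier_vec n" "distinct b" "\<not> lin_dep (set b)" "length b = n" "hd b = v"
    by auto
  have "n \<noteq> 0" using v v0 by (cases "n = 0") auto
  then obtain vs where bv: "b = v # vs" using b(4,5) by (cases b) auto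
  from gram_schmidt_result[OF b(1-3) refl, folded ws_def]
  have ws: "set ws \<subseteq> carrier_vec n" "corthogonal ws" "length ws = n" using b(4) by auto
  have hd: "hd ws = v" using gram_schmidt_hd[OF v, of vs, folded bv] by (simp add: ws_def)
  have W: "W \<in> carrier_mat n n" using ws by (simp add: W_def mat_of_cols_def)
  have W': "W' \<in> carrier_mat n n" unfolding W'_def corthogonal_inv_def using W
    by (auto simp: mat_of_rows_def)
  have "corthogonal_mat W" using orthogonal_mat_of_cols ws unfolding W_def by blast
  from corthogonal_inv_result[OF this] have "W' * W = 1\<^sub>m n"
    using W W' by (simp add: W'_def inverts_mat_def corthogonal_inv_def mat_of_rows_def)
  then have "det W \<noteq> 0"
    using det_mult[OF W' W] by (metis det_one mult_zero_right zero_neq_one)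
  moreover have "col W 0 = v" unfolding W_def using ws hd \<open>n \<noteq> 0\<close>
    by (subst col_mat_of_cols) (auto simp: hd_conv_nth)
  ultimately show thesis using that W by blast
qed

lemma append_cols_dim [simp]:
  "dim_row (append_cols A B) = dim_row A"
  "dim_col (append_cols A B) = dim_col A + dim_col B"
  by (simp_all add: append_cols_def)

lemma append_cols_index [simp]:
  "i < dim_row A \<Longrightarrow> j < dim_col A + dim_col B \<Longrightarrow>
    append_cols A B $$ (i, j) = (if j < dim_col A then A $$ (i, j) else B $$ (i, j - dim_col A))"
  by (simp add: append_cols_def)

lemma mat_append_colsE:
  assumes "A \<in> carrier_mat n (m1 + m2)"
  obtains A1 A2 where "A = append_cols A1 A2" "A1 \<in> carrier_mat n m1" "A2 \<in> carrier_mat n m2"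
proof
  show "A = append_cols (mat n m1 (($$) A)) (mat n m2 (\<lambda>(i, j). A $$ (i, j + m1)))"
    using assms by (intro eq_matI) auto
qed auto

lemma row_append_cols:
  assumes "A \<in> carrier_mat n m1" "B \<in> carrier_mat n m2" "i < n"
  shows "row (append_cols A B) i = row A i @\<^sub>v row B i"
  using assms by (intro eq_vecI) auto

lemma append_cols_mult_four_block:
  fixes A1 :: "'a :: semiring_0 mat"
  assumes "A1 \<in> carrier_mat n m1" "A2 \<in> carrier_mat n m2"
    "B1 \<in> carrier_mat m1 k1" "B2 \<in> carrier_mat m1 k2" "B3 \<in> carrier_mat m2 k1" "B4 \<in> carrier_mat m2 k2"
  shows "append_cols A1 A2 * four_block_mat B1 B2 B3 B4 =
    append_cols (A1 * B1 + A2 * B3) (A1 * B2 + A2 * B4)"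
proof (rule eq_matI)
  fix i j
  assume "i < dim_row (append_cols (A1 * B1 + A2 * B3) (A1 * B2 + A2 * B4))"
    "j < dim_col (append_cols (A1 * B1 + A2 * B3) (A1 * B2 + A2 * B4))"
  with assms have ij: "i < n" "j < k1 + k2" by auto
  note c = col_four_block_mat[OF assms(3-6)]
  show "(append_cols A1 A2 * four_block_mat B1 B2 B3 B4) $$ (i, j) =
      append_cols (A1 * B1 + A2 * B3) (A1 * B2 + A2 * B4) $$ (i, j)"
  proof (cases "j < k1")
    case True
    with ij assms show ?thesis
      by (simp add: row_append_cols[OF assms(1,2)] c(1) scalar_prod_append[of _ m1 _ m2])
  next
    case False
    with ij assms show ?thesis
      by (simp add: row_append_cols[OF assms(1,2)] c(2) scalar_prod_append[of _ m1 _ m2] carrier_vecI)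
  qed
qed (use assms in auto)

lemma mult_mat_unit_vec:
  fixes A :: "'a :: semiring_1 mat"
  assumes "A \<in> carrier_mat n m" "j < m"
  shows "A *\<^sub>v unit_vec m j = col A j"
  using assms by (intro eq_vecI) auto

lemma append_cols_mult_vec:
  fixes A1 :: "'a :: semiring_0 mat"
  assumes "A1 \<in> carrier_mat n m1" "A2 \<in> carrier_mat n m2" "v1 \<in> carrier_vec m1" "v2 \<in> carrier_vec m2"
  shows "append_cols A1 A2 *\<^sub>v (v1 @\<^sub>v v2) = A1 *\<^sub>v v1 + A2 *\<^sub>v v2"
  using assms
  by (intro eq_vecI) (auto simp: row_append_cols[OF assms(1,2)] scalar_prod_append[of _ m1 _ m2])

lemma adjoint_append_cols_mult:
  fixes A1 :: "complex mat"
  assumes "A1 \<in> carrier_mat n m1" "A2 \<in> carrier_mat n m2" "B1 \<in> carrier_mat n k1" "B2 \<in> carrier_mat n k2"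
  shows "mat_adjoint (append_cols A1 A2) * append_cols B1 B2 =
    four_block_mat (mat_adjoint A1 * B1) (mat_adjoint A1 * B2) (mat_adjoint A2 * B1) (mat_adjoint A2 * B2)"
  using assms by (intro eq_matI) (auto simp: scalar_prod_def)

section \<open>Lyapunov equations under a change of basis\<close>

text \<open>The last conjunct is the Hautus test for observability of \<open>(C, A)\<close>.\<close>

definition lyapunov :: "nat \<Rightarrow> nat \<Rightarrow> complex mat \<Rightarrow> complex mat \<Rightarrow> complex mat \<Rightarrow> bool" where
  "lyapunov n p H A C \<longleftrightarrow>
     H \<in> carrier_mat n n \<and> A \<in> carrier_mat n n \<and> C \<in> carrier_mat p n \<and>
     mat_adjoint H = H \<and> H * A + mat_adjoint A * H = - (mat_adjoint C * C) \<and>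
     (\<forall>v a. v \<in> carrier_vec n \<longrightarrow> A *\<^sub>v v = a \<cdot>\<^sub>v v \<longrightarrow> C *\<^sub>v v = 0\<^sub>v p \<longrightarrow> v = 0\<^sub>v n)"

lemma lyapunov_equation_transform:
  fixes H A C P Q :: "complex mat"
  assumes H: "H \<in> carrier_mat n n" and A: "A \<in> carrier_mat n n" and C: "C \<in> carrier_mat p n"
    and eq: "H * A + mat_adjoint A * H = - (mat_adjoint C * C)"
    and P: "P \<in> carrier_mat n n" and Q: "Q \<in> carrier_mat n n" and PQ: "P * Q = 1\<^sub>m n"
  shows "(mat_adjoint P * H * P) * (Q * A * P) + mat_adjoint (Q * A * P) * (mat_adjoint P * H * P) =
    - (mat_adjoint (C * P) * (C * P))"
proof -
  note [simp] = H A C P Q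
  have "mat_adjoint P * (H * A) * P + mat_adjoint P * (mat_adjoint A * H) * P =
      mat_adjoint P * (H * A + mat_adjoint A * H) * P"
    by (simp add: mult_add_distrib_mat[of _ n n _ n] add_mult_distrib_mat[of _ n n _ _ n] mult_carrier_mat[of _ n n _ n])
  also have "\<dots> = - (mat_adjoint P * (mat_adjoint C * C) * P)"
    unfolding eq using carrier_matD[OF P] carrier_matD[OF C] by simp
  also have "mat_adjoint P * (mat_adjoint C * C) * P = mat_adjoint (C * P) * (C * P)"
    by (simp add: mat_adjoint_mult[of _ p n _ n] mult_carrier_mat[of _ p n _ n]  mult_carrier_mat[of _ n p _ n]
         assoc_mult_mat[of _ n n _ p _ n] assoc_mult_mat[of _ n n _ n _ n] assoc_mult_mat[of _ n p _ n _ n])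
  finally show ?thesis unfolding congruence_similarity[OF H A P Q PQ] .
qed

text \<open>Under the state change \<open>x = P y\<close> the Hautus test survives because
  \<open>P\<close> carries an unobservable eigenvector of the new pair to one of the old pair with
  the same eigenvalue.\<close>

lemma lyapunov_transform:
  assumes L: "lyapunov n p H A C"
    and P: "P \<in> carrier_mat n n" and Q: "Q \<in> carrier_mat n n" and PQ: "P * Q = 1\<^sub>m n"
  shows "lyapunov n p (mat_adjoint P * H * P) (Q * A * P) (C * P)"
proof -
  have H: "H \<in> carrier_mat n n" and A: "A \<in> carrier_mat n n" and C: "C \<in> carrier_mat p n"
    and h: "mat_adjoint H = H" and eq: "H * A + mat_adjoint A * H = - (mat_adjoint C * C)"
    and obs: "\<And>v a. v \<in> carrier_vec n \<Longrightarrow> A *\<^sub>v v = a \<cdot>\<^sub>v v \<Longrightarrow> C *\<^sub>v v = 0\<^sub>v p \<Longrightarrow> v = 0\<^sub>v n"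
    using L unfolding lyapunov_def by auto
  have QP: "Q * P = 1\<^sub>m n" by (rule mat_mult_left_right_inverse[OF P Q PQ])
  have "v = 0\<^sub>v n" if v: "v \<in> carrier_vec n" and e: "Q * A * P *\<^sub>v v = a \<cdot>\<^sub>v v"
    and c: "C * P *\<^sub>v v = 0\<^sub>v p" for v a
  proof -
    have APv: "A *\<^sub>v (P *\<^sub>v v) \<in> carrier_vec n" using A P v by auto
    have "A *\<^sub>v (P *\<^sub>v v) = (P * Q) *\<^sub>v (A *\<^sub>v (P *\<^sub>v v))"
      unfolding PQ using APv by simp
    also have "\<dots> = P *\<^sub>v (Q *\<^sub>v (A *\<^sub>v (P *\<^sub>v v)))"
      by (rule assoc_mult_mat_vec[OF P Q APv])
    also have "Q *\<^sub>v (A *\<^sub>v (P *\<^sub>v v)) = Q * A * P *\<^sub>v v"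
      using A P Q v by (simp add: assoc_mult_mat_vec[of _ n n _ n] mult_carrier_mat[of _ n n _ n])
    finally have "A *\<^sub>v (P *\<^sub>v v) = a \<cdot>\<^sub>v (P *\<^sub>v v)" unfolding e using P v by (simp add: mult_mat_vec[of _ n n])
    moreover have "C *\<^sub>v (P *\<^sub>v v) = 0\<^sub>v p" using c C P v by (simp add: assoc_mult_mat_vec[of _ p n _ n])
    ultimately have "P *\<^sub>v v = 0\<^sub>v n" using obs[of "P *\<^sub>v v"] P v by simp
    then have "(Q * P) *\<^sub>v v = 0\<^sub>v n" using P Q v by (subst assoc_mult_mat_vec[of _ n n _ n]) auto
    then show ?thesis unfolding QP using v by simp
  qed
  moreover have "mat_adjoint P * H * P \<in> carrier_mat n n" "Q * A * P \<in> carrier_mat n n" "C * P \<in> carrier_mat p n"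
    using P Q H A C by auto
  ultimately show ?thesis unfolding lyapunov_def
    using lyapunov_equation_transform[OF H A C eq P Q PQ] mat_adjoint_congruence[OF P H h] by blast
qed

text \<open>For a form without off-diagonal blocks the equation decouples on the diagonal. The
  corner identity \<open>H1 * A2 = - (mat_adjoint C1 * C2)\<close> is what lets observability
  descend to the trailing block in \<open>lyapunov_deflate\<close>.\<close>

lemma lyapunov_block:
  fixes H1 H2 A1 A2 A4 C1 C2 :: "complex mat"
  assumes h: "mat_adjoint (four_block_mat H1 (0\<^sub>m n1 n2) (0\<^sub>m n2 n1) H2) = four_block_mat H1 (0\<^sub>m n1 n2) (0\<^sub>m n2 n1) H2"
    and L: "four_block_mat H1 (0\<^sub>m n1 n2) (0\<^sub>m n2 n1) H2 * four_block_mat A1 A2 (0\<^sub>m n2 n1) A4 +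
      mat_adjoint (four_block_mat A1 A2 (0\<^sub>m n2 n1) A4) * four_block_mat H1 (0\<^sub>m n1 n2) (0\<^sub>m n2 n1) H2 =
      - (mat_adjoint (append_cols C1 C2) * append_cols C1 C2)"
    and c: "H1 \<in> carrier_mat n1 n1" "H2 \<in> carrier_mat n2 n2" "A1 \<in> carrier_mat n1 n1" "A2 \<in> carrier_mat n1 n2"
    "A4 \<in> carrier_mat n2 n2" "C1 \<in> carrier_mat p n1" "C2 \<in> carrier_mat p n2"
  shows "mat_adjoint H1 = H1" "mat_adjoint H2 = H2"
    "H1 * A1 + mat_adjoint A1 * H1 = - (mat_adjoint C1 * C1)"
    "H1 * A2 = - (mat_adjoint C1 * C2)"
    "H2 * A4 + mat_adjoint A4 * H2 = - (mat_adjoint C2 * C2)"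
proof -
  let ?H = "four_block_mat H1 (0\<^sub>m n1 n2) (0\<^sub>m n2 n1) H2"
  let ?A = "four_block_mat A1 A2 (0\<^sub>m n2 n1) A4"
  have "mat_adjoint ?H = four_block_mat (mat_adjoint H1) (0\<^sub>m n1 n2) (0\<^sub>m n2 n1) (mat_adjoint H2)"
    using c by (subst mat_adjoint_four_block[of _ n1 n1 _ n2 _ n2]) auto
  moreover have "mat_adjoint ?H = ?H" by (rule h)
  ultimately have e: "four_block_mat (mat_adjoint H1) (0\<^sub>m n1 n2) (0\<^sub>m n2 n1) (mat_adjoint H2) = ?H" by simp
  show "mat_adjoint H1 = H1" "mat_adjoint H2 = H2"
    by (rule four_block_matD[OF e, of n1 n1 n2 n2]; use c in simp)+
  have 1: "?H * ?A = four_block_mat (H1 * A1) (H1 * A2) (0\<^sub>m n2 n1) (H2 * A4)"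
    using c by (subst mult_four_block_mat[of _ n1 n1 _ n2 _ n2]) (auto simp: mult_carrier_mat)
  have 2: "mat_adjoint ?A * ?H = four_block_mat (mat_adjoint A1 * H1) (0\<^sub>m n1 n2) (mat_adjoint A2 * H1) (mat_adjoint A4 * H2)"
    using c
    by (subst mat_adjoint_four_block[of _ n1 n1 _ n2 _ n2], simp_all,
        subst mult_four_block_mat[of _ n1 n1 _ n2 _ n2]) (auto simp: mult_carrier_mat)
  have 3: "?H * ?A + mat_adjoint ?A * ?H = four_block_mat (H1 * A1 + mat_adjoint A1 * H1) (H1 * A2)
      (mat_adjoint A2 * H1) (H2 * A4 + mat_adjoint A4 * H2)"
    unfolding 1 2 using c by (subst add_four_block_mat[of _ n1 n1 _ n2 _ n2]) auto
  have 4: "- (mat_adjoint (append_cols C1 C2) * append_cols C1 C2) = four_block_mat (- (mat_adjoint C1 * C1))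
     (- (mat_adjoint C1 * C2)) (- (mat_adjoint C2 * C1)) (- (mat_adjoint C2 * C2))"
    unfolding adjoint_append_cols_mult[OF c(6,7,6,7)] using c by (intro eq_matI) auto
  have "?H * ?A + mat_adjoint ?A * ?H = - (mat_adjoint (append_cols C1 C2) * append_cols C1 C2)"
    by (rule L)
  note e = this[unfolded 3 4]
  show "H1 * A1 + mat_adjoint A1 * H1 = - (mat_adjoint C1 * C1)" "H1 * A2 = - (mat_adjoint C1 * C2)"
    "H2 * A4 + mat_adjoint A4 * H2 = - (mat_adjoint C2 * C2)"
    by (rule four_block_matD[OF e, of n1 n1 n2 n2]; use c in \<open>auto intro!: mult_carrier_mat add_carrier_mat\<close>)+
qed

section \<open>Inertia and the Lyapunov equation\<close>

text \<open>If \<open>A v = a v\<close>, the equation evaluated at \<open>v\<close> reads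
  \<open>2 Re a * \<eta> = - |C v|^2\<close>, with \<open>\<eta>\<close> the value of the form at
  \<open>v\<close>. Observability makes the right side nonzero, so \<open>\<eta>\<close> is nonzero
  with sign opposite to \<open>Re a\<close>, and \<open>v\<close> can be split off orthogonally with
  respect to \<open>H\<close>.\<close>

lemma lyapunov_deflate:
  assumes L: "lyapunov (1 + m) p H A C"
  obtains P a \<eta> H3 A3 C3 where "P \<in> carrier_mat (1 + m) (1 + m)" "det P \<noteq> 0"
    "mat_adjoint P * H * P = four_block_mat (mat 1 1 (\<lambda>_. complex_of_real \<eta>)) (0\<^sub>m 1 m) (0\<^sub>m m 1) H3"
    "Re a * \<eta> < 0" "char_poly A = [:- a, 1:] * char_poly A3" "lyapunov m p H3 A3 C3"
proof -
  define n where "n = 1 + m"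
  note L = L[folded n_def]
  have H: "H \<in> carrier_mat n n" and A: "A \<in> carrier_mat n n" and C: "C \<in> carrier_mat p n"
    using L unfolding lyapunov_def by auto
  obtain as where as: "char_poly A = (\<Prod>a\<leftarrow>as. [:- a, 1:])" "length as = n"
    using char_poly_factorized[OF A] by blast
  then obtain a as' where "as = a # as'" unfolding n_def by (cases as) auto
  then have "poly (char_poly A) a = 0" unfolding as by simp
  then obtain v where "eigenvector A v a"
    using eigenvalue_root_char_poly[OF A] unfolding eigenvalue_def by blast
  then have v: "v \<in> carrier_vec n" "v \<noteq> 0\<^sub>v n" "A *\<^sub>v v = a \<cdot>\<^sub>v v"
    using A unfolding eigenvector_def by auto
  obtain P0 where P0: "P0 \<in> carrier_mat n n" "det P0 \<noteq> 0" "col P0 0 = v"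
    using complete_to_invertible[OF v(1,2)] by blast
  obtain Q0 where Q0: "Q0 \<in> carrier_mat n n" "P0 * Q0 = 1\<^sub>m n" "Q0 * P0 = 1\<^sub>m n"
    using det_nonzero_inverseE[OF P0(1,2)] by blast
  define K where "K = mat_adjoint P0 * H * P0"
  define A0 where "A0 = Q0 * A * P0"
  define C0 where "C0 = C * P0"
  have L0: "lyapunov n p K A0 C0"
    unfolding K_def A0_def C0_def by (rule lyapunov_transform[OF L P0(1) Q0(1,2)])
  then have K: "K \<in> carrier_mat n n" and A0: "A0 \<in> carrier_mat n n" and C0: "C0 \<in> carrier_mat p n"
    and hK: "mat_adjoint K = K" and eq0: "K * A0 + mat_adjoint A0 * K = - (mat_adjoint C0 * C0)"
    and obs0: "\<And>v a. v \<in> carrier_vec n \<Longrightarrow> A0 *\<^sub>v v = a \<cdot>\<^sub>v v \<Longrightarrow> C0 *\<^sub>v v = 0\<^sub>v p \<Longrightarrow> v = 0\<^sub>v n"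
    unfolding lyapunov_def by auto
  have n0: "0 < n" by (simp add: n_def)
  have colA0: "col A0 0 = a \<cdot>\<^sub>v unit_vec n 0"
  proof -
    have "col A0 0 = Q0 *\<^sub>v (A *\<^sub>v col P0 0)"
      unfolding A0_def using P0 Q0 A n0
      by (subst col_mult2[of _ n n _ n]) (auto simp: assoc_mult_mat_vec[of _ n n _ n] mult_carrier_mat)
    also have "\<dots> = a \<cdot>\<^sub>v (Q0 *\<^sub>v col P0 0)" unfolding P0(3) v(3) using Q0 v by (simp add: mult_mat_vec)
    also have "Q0 *\<^sub>v col P0 0 = col (Q0 * P0) 0" using P0 Q0 n0 by (subst col_mult2[of _ n n _ n]) auto
    finally show ?thesis using Q0 n0 by simp
  qed
  have A0i0: "A0 $$ (i, 0) = (if i = 0 then a else 0)" if "i < n" for i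
    using arg_cong[OF colA0, of "\<lambda>w. w $ i"] that A0 by (auto simp: n0)
  have "col C0 0 \<noteq> 0\<^sub>v p"
  proof
    assume z: "col C0 0 = 0\<^sub>v p"
    have u: "A0 *\<^sub>v unit_vec n 0 = a \<cdot>\<^sub>v unit_vec n 0" "C0 *\<^sub>v unit_vec n 0 = 0\<^sub>v p"
      using colA0 z mult_mat_unit_vec[OF A0 n0] mult_mat_unit_vec[OF C0 n0] by simp_all
    have "unit_vec n 0 = (0\<^sub>v n :: complex vec)" by (rule obs0[OF _ u]) simp
    then show False using n0 arg_cong[of "unit_vec n 0" "0\<^sub>v n :: complex vec" "\<lambda>w. w $ 0"] by simp
  qed
  then obtain k where k: "k < p" "C0 $$ (k, 0) \<noteq> 0"
    using C0 n0 by (auto simp: vec_eq_iff)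
  define \<eta> where "\<eta> = Re (K $$ (0, 0))"
  have "cnj (K $$ (0, 0)) = K $$ (0, 0)"
    using arg_cong[OF hK, of "\<lambda>X. X $$ (0, 0)"] K n0 by simp
  then have K00: "K $$ (0, 0) = complex_of_real \<eta>"
    unfolding \<eta>_def by (metis Reals_cnj_iff of_real_Re)
  have "(K * A0 + mat_adjoint A0 * K) $$ (0, 0) = a * K $$ (0, 0) + cnj a * K $$ (0, 0)"
  proof -
    have "(K * A0) $$ (0, 0) = (\<Sum>i<n. K $$ (0, i) * A0 $$ (i, 0))"
      using K A0 n0 by (simp add: scalar_prod_def lessThan_atLeast0)
    also have "\<dots> = (\<Sum>i<n. if i = 0 then K $$ (0, 0) * a else 0)"
      by (intro sum.cong) (auto simp: A0i0)
    finally have 1: "(K * A0) $$ (0, 0) = a * K $$ (0, 0)" using n0 by simp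
    have "(mat_adjoint A0 * K) $$ (0, 0) = (\<Sum>i<n. cnj (A0 $$ (i, 0)) * K $$ (i, 0))"
      using K A0 n0 by (simp add: scalar_prod_def lessThan_atLeast0)
    also have "\<dots> = (\<Sum>i<n. if i = 0 then cnj a * K $$ (0, 0) else 0)"
      by (intro sum.cong) (auto simp: A0i0)
    finally have 2: "(mat_adjoint A0 * K) $$ (0, 0) = cnj a * K $$ (0, 0)" using n0 by simp
    show ?thesis using 1 2 K A0 n0 by simp
  qed
  moreover have "(- (mat_adjoint C0 * C0)) $$ (0, 0) = - complex_of_real (\<Sum>i<p. (cmod (C0 $$ (i, 0)))\<^sup>2)"
    using C0 n0
    by (simp add: scalar_prod_def lessThan_atLeast0 complex_norm_square mult.commute del: of_real_power)
  ultimately have "(a + cnj a) * complex_of_real \<eta> = - complex_of_real (\<Sum>i<p. (cmod (C0 $$ (i, 0)))\<^sup>2)"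
    unfolding eq0 K00 by (simp add: distrib_right)
  then have "Re ((a + cnj a) * complex_of_real \<eta>) = - (\<Sum>i<p. (cmod (C0 $$ (i, 0)))\<^sup>2)"
    by (metis Re_complex_of_real of_real_minus)
  then have "2 * (Re a * \<eta>) = - (\<Sum>i<p. (cmod (C0 $$ (i, 0)))\<^sup>2)" by simp
  moreover have "(\<Sum>i<p. (cmod (C0 $$ (i, 0)))\<^sup>2) > 0"
    using k by (intro sum_pos2[of _ k]) auto
  ultimately have neg: "Re a * \<eta> < 0" by linarith
  then have \<eta>0: "\<eta> \<noteq> 0" by auto
  obtain K1 K2 K3 K4 where Kb: "K = four_block_mat K1 K2 K3 K4" "K1 \<in> carrier_mat 1 1" "K2 \<in> carrier_mat 1 m"
      "K3 \<in> carrier_mat m 1" "K4 \<in> carrier_mat m m"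
    using K unfolding n_def by (elim mat_four_blockE)
  obtain B1 B2 B3 B4 where Ab: "A0 = four_block_mat B1 B2 B3 B4" "B1 \<in> carrier_mat 1 1" "B2 \<in> carrier_mat 1 m"
      "B3 \<in> carrier_mat m 1" "B4 \<in> carrier_mat m m"
    using A0 unfolding n_def by (elim mat_four_blockE)
  obtain C1 C2 where Cb: "C0 = append_cols C1 C2" "C1 \<in> carrier_mat p 1" "C2 \<in> carrier_mat p m"
    using C0 unfolding n_def by (elim mat_append_colsE)
  have K1: "K1 = mat 1 1 (\<lambda>_. complex_of_real \<eta>)"
    using K00 Kb by (intro eq_matI) auto
  have K1m: "K1 * X = complex_of_real \<eta> \<cdot>\<^sub>m X" if "X \<in> carrier_mat 1 k" for X k
    unfolding K1 using that by (intro eq_matI) (auto simp: scalar_prod_def)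
  have mK1: "X * K1 = complex_of_real \<eta> \<cdot>\<^sub>m X" if "X \<in> carrier_mat k 1" for X k
    unfolding K1 using that by (intro eq_matI) (auto simp: scalar_prod_def)
  have B1: "B1 = mat 1 1 (\<lambda>_. a)" using A0i0[of 0] n0 Ab by (intro eq_matI) auto
  have B3: "B3 = 0\<^sub>m m 1"
  proof (rule eq_matI)
    fix i j assume "i < dim_row (0\<^sub>m m 1)" "j < dim_col (0\<^sub>m m 1)"
    then show "B3 $$ (i, j) = 0\<^sub>m m 1 $$ (i, j)"
      using A0i0[of "Suc i"] Ab by (auto simp: n_def)
  qed (use Ab in auto)
  have K3: "K3 = mat_adjoint K2"
  proof -
    have e: "four_block_mat (mat_adjoint K1) (mat_adjoint K3) (mat_adjoint K2) (mat_adjoint K4) = four_block_mat K1 K2 K3 K4"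
      using hK unfolding Kb(1) using Kb by (simp add: mat_adjoint_four_block[of _ 1 1 _ m _ m])
    show ?thesis by (rule four_block_matD(3)[OF e, of 1 1 m m, symmetric]; use Kb in simp)
  qed
  \<comment> \<open>Block elimination with the pivot \<open>\<eta>\<close>: \<open>R\<close> clears
    the first row and column of the form. Since \<open>R\<close> is unit upper triangular, it keeps
    the eigenvector as first basis vector, so \<open>A0\<close> stays block triangular.\<close>
  define Y where "Y = complex_of_real (1 / \<eta>) \<cdot>\<^sub>m K2"
  have Y: "Y \<in> carrier_mat 1 m" using Kb by (simp add: Y_def)
  have aY: "mat_adjoint Y = complex_of_real (1 / \<eta>) \<cdot>\<^sub>m K3"
    by (simp add: Y_def K3 mat_adjoint_smult)
  define R where "R = four_block_mat (1\<^sub>m 1) (- Y) (0\<^sub>m m 1) (1\<^sub>m m)"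
  define R' where "R' = four_block_mat (1\<^sub>m 1) Y (0\<^sub>m m 1) (1\<^sub>m m)"
  have R: "R \<in> carrier_mat n n" "R' \<in> carrier_mat n n" using Y by (auto simp: R_def R'_def n_def)
  have RR': "R * R' = 1\<^sub>m n" unfolding R_def R'_def n_def
    using Y by (subst mult_four_block_mat[of _ 1 1 _ m _ m]) (auto intro!: eq_matI)
  have aR: "mat_adjoint R = four_block_mat (1\<^sub>m 1) (0\<^sub>m 1 m) (- mat_adjoint Y) (1\<^sub>m m)"
    unfolding R_def using Y by (subst mat_adjoint_four_block[of _ 1 1 _ m _ m]) (auto simp: mat_adjoint_uminus)
  obtain X4 where X: "X4 \<in> carrier_mat m m"
    "mat_adjoint R * K * R = four_block_mat K1 (0\<^sub>m 1 m) (0\<^sub>m m 1) X4"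
  proof -
    have KR: "K * R = four_block_mat K1 (0\<^sub>m 1 m) K3 (- (K3 * Y) + K4)"
      unfolding R_def Kb(1) using Kb Y
      by (subst mult_four_block_mat[of _ 1 1 _ m _ m])
        (auto simp: K1m[of _ m] Y_def \<eta>0 intro!: cong_four_block_mat eq_matI)
    have "mat_adjoint R * (K * R) = four_block_mat K1 (0\<^sub>m 1 m) (0\<^sub>m m 1) (- (K3 * Y) + K4)"
      unfolding KR aR using Kb Y
      by (subst mult_four_block_mat[of _ 1 1 _ m _ m])
        (auto simp: mK1[of _ m] aY \<eta>0 intro!: cong_four_block_mat eq_matI)
    then have "mat_adjoint R * K * R = four_block_mat K1 (0\<^sub>m 1 m) (0\<^sub>m m 1) (- (K3 * Y) + K4)"
      using R K by (simp add: assoc_mult_mat[of _ n n _ n _ n])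
    then show thesis using that[of "- (K3 * Y) + K4"] Kb Y by auto
  qed
  obtain Z2 where Z: "Z2 \<in> carrier_mat 1 m" "R' * A0 * R = four_block_mat B1 Z2 (0\<^sub>m m 1) B4"
  proof -
    have "A0 * R = four_block_mat B1 (- (B1 * Y) + B2) (0\<^sub>m m 1) B4"
      unfolding R_def Ab(1) B3 using Ab Y
      by (subst mult_four_block_mat[of _ 1 1 _ m _ m]) (auto intro!: cong_four_block_mat)
    then have "R' * (A0 * R) = four_block_mat B1 (- (B1 * Y) + B2 + Y * B4) (0\<^sub>m m 1) B4"
      unfolding R'_def using Ab Y
      by (simp, subst mult_four_block_mat[of _ 1 1 _ m _ m]) (auto intro!: cong_four_block_mat)
    then have "R' * A0 * R = four_block_mat B1 (- (B1 * Y) + B2 + Y * B4) (0\<^sub>m m 1) B4"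
      using R A0 by (simp add: assoc_mult_mat[of _ n n _ n _ n])
    then show thesis using that[of "- (B1 * Y) + B2 + Y * B4"] Ab Y by auto
  qed
  obtain W2 where W: "W2 \<in> carrier_mat p m" "C0 * R = append_cols C1 W2"
  proof -
    have "C0 * R = append_cols C1 (- (C1 * Y) + C2)"
      unfolding R_def Cb(1) using Cb Y by (subst append_cols_mult_four_block[of _ p 1 _ m _ 1 _ m]) auto
    then show thesis using that[of "- (C1 * Y) + C2"] Cb Y by auto
  qed
  have L1: "lyapunov (1 + m) p (four_block_mat K1 (0\<^sub>m 1 m) (0\<^sub>m m 1) X4)
      (four_block_mat B1 Z2 (0\<^sub>m m 1) B4) (append_cols C1 W2)"
    using lyapunov_transform[OF L0 R RR'] unfolding X(2) Z(2) W(2) by (simp add: n_def)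
  then have L1h: "mat_adjoint (four_block_mat K1 (0\<^sub>m 1 m) (0\<^sub>m m 1) X4) = four_block_mat K1 (0\<^sub>m 1 m) (0\<^sub>m m 1) X4"
    and L1e: "four_block_mat K1 (0\<^sub>m 1 m) (0\<^sub>m m 1) X4 * four_block_mat B1 Z2 (0\<^sub>m m 1) B4 +
      mat_adjoint (four_block_mat B1 Z2 (0\<^sub>m m 1) B4) * four_block_mat K1 (0\<^sub>m 1 m) (0\<^sub>m m 1) X4 =
      - (mat_adjoint (append_cols C1 W2) * append_cols C1 W2)"
    unfolding lyapunov_def by blast+
  note blk = lyapunov_block[OF L1h L1e Kb(2) X(1) Ab(2) Z(1) Ab(5) Cb(2) W(1)]
  \<comment> \<open>To embed \<open>x\<close> as \<open>(0, x)\<close>, the coupling block must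
    annihilate it. The corner identity shows that \<open>\<eta> Z2 x\<close> is a multiple of
    \<open>W2 x = 0\<close>, and \<open>\<eta>\<close> is nonzero.\<close>
  have obs: "x = 0\<^sub>v m" if x: "x \<in> carrier_vec m" and e: "B4 *\<^sub>v x = c \<cdot>\<^sub>v x" and z: "W2 *\<^sub>v x = 0\<^sub>v p" for x c
  proof -
    have "K1 * Z2 *\<^sub>v x = - (mat_adjoint C1 * W2) *\<^sub>v x" using blk(4) by simp
    also have "\<dots> = - (mat_adjoint C1 *\<^sub>v (W2 *\<^sub>v x))"
      using Cb W x by (subst uminus_mult_mat_vec) (auto simp: assoc_mult_mat_vec[of _ 1 p _ m])
    also have "\<dots> = 0\<^sub>v 1" unfolding z using Cb by (intro eq_vecI) (auto simp: scalar_prod_def)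
    finally have *: "K1 * Z2 *\<^sub>v x = 0\<^sub>v 1" .
    have "complex_of_real \<eta> \<cdot>\<^sub>v (Z2 *\<^sub>v x) = 0\<^sub>v 1"
    proof -
      have "(complex_of_real \<eta> \<cdot>\<^sub>m Z2) *\<^sub>v x = complex_of_real \<eta> \<cdot>\<^sub>v (Z2 *\<^sub>v x)"
        using Z x by (intro eq_vecI) auto
      then show ?thesis using * unfolding K1m[OF Z(1)] by simp
    qed
    then have Zx: "Z2 *\<^sub>v x = 0\<^sub>v 1" using \<eta>0 Z by (auto simp: vec_eq_iff)
    have "four_block_mat B1 Z2 (0\<^sub>m m 1) B4 *\<^sub>v (0\<^sub>v 1 @\<^sub>v x) = c \<cdot>\<^sub>v (0\<^sub>v 1 @\<^sub>v x)"
      using Ab Z x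
      by (subst four_block_mat_mult_vec[of _ 1 1 _ m _ m])
        (auto simp: Zx e scalar_prod_def intro!: eq_vecI)
    moreover have "append_cols C1 W2 *\<^sub>v (0\<^sub>v 1 @\<^sub>v x) = 0\<^sub>v p"
      using Cb W x by (subst append_cols_mult_vec[of _ p 1 _ m]) (auto simp: z)
    moreover have "0\<^sub>v 1 @\<^sub>v x \<in> carrier_vec (1 + m)" using x by (intro append_carrier_vec) auto
    ultimately have "0\<^sub>v 1 @\<^sub>v x = 0\<^sub>v (1 + m)" using L1 unfolding lyapunov_def by blast
    also have "\<dots> = 0\<^sub>v 1 @\<^sub>v 0\<^sub>v m" by auto
    finally show ?thesis by (subst (asm) append_vec_eq[of _ 1]) auto
  qed
  have L2: "lyapunov m p X4 B4 W2" unfolding lyapunov_def using X Ab W blk obs by blast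
  define P where "P = P0 * R"
  have P: "P \<in> carrier_mat n n" using P0 R by (simp add: P_def)
  have "det P \<noteq> 0" unfolding P_def det_mult[OF P0(1) R(1)]
    using P0(2) inverse_det_nonzero[OF R RR'] by simp
  moreover have "mat_adjoint P * H * P = four_block_mat (mat 1 1 (\<lambda>_. complex_of_real \<eta>)) (0\<^sub>m 1 m) (0\<^sub>m m 1) X4"
    unfolding P_def congruence_comp[OF P0(1) R(1) H] using X(2) by (simp add: K_def K1)
  moreover have "char_poly A = [:- a, 1:] * char_poly B4"
  proof -
    have "similar_mat A0 A"
      unfolding similar_mat_def similar_mat_wit_def A0_def
      using P0 Q0 A by (intro exI[of _ Q0] exI[of _ P0]) (auto simp: Let_def)
    then have "char_poly A = char_poly A0" by (simp add: char_poly_similar)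
    also have "\<dots> = char_poly B1 * char_poly B4"
      unfolding Ab(1) B3 by (rule char_poly_four_block_zeros_col[OF Ab(2,3,5)])
    also have "char_poly B1 = [:- a, 1:]" by (simp add: B1 char_poly_defs det_def sign_def)
    finally show ?thesis .
  qed
  ultimately show thesis using that[of P \<eta> X4 a B4 W2] P L2 neg by (simp add: n_def)
qed

text \<open>Deflation needs one eigenvector at a time, so \<open>A\<close> need not be
  diagonalizable. Each eigenvalue is stored at the index of the diagonal entry produced together
  with it, which keeps multiplicities aligned.\<close>

lemma inertia_congruence:
  assumes "lyapunov n p H A C"
  shows "\<exists>P d es. P \<in> carrier_mat n n \<and> det P \<noteq> 0 \<and>
    mat_adjoint P * H * P = mat_diag n (\<lambda>i. complex_of_real (d i)) \<and>
    length es = n \<and> char_poly A = (\<Prod>e\<leftarrow>es. [:- e, 1:]) \<and> (\<forall>i<n. Re (es ! i) * d i < 0)"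
  using assms
proof (induction n arbitrary: H A C)
  case 0
  then have "H \<in> carrier_mat 0 0" "A \<in> carrier_mat 0 0" by (auto simp: lyapunov_def)
  then show ?case
    by (intro exI[of _ "1\<^sub>m 0"] exI[of _ "\<lambda>_. 0"] exI[of _ "[]"])
      (auto simp: mat_diag_def char_poly_def char_poly_matrix_def intro!: eq_matI)
next
  case (Suc m)
  then have L: "lyapunov (1 + m) p H A C" by simp
  have H: "H \<in> carrier_mat (1 + m) (1 + m)" using L by (auto simp: lyapunov_def)
  obtain P a \<eta> H3 A3 C3 where P: "P \<in> carrier_mat (1 + m) (1 + m)" "det P \<noteq> 0"
    "mat_adjoint P * H * P = four_block_mat (mat 1 1 (\<lambda>_. complex_of_real \<eta>)) (0\<^sub>m 1 m) (0\<^sub>m m 1) H3"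
    and neg: "Re a * \<eta> < 0" and ch: "char_poly A = [:- a, 1:] * char_poly A3" and L3: "lyapunov m p H3 A3 C3"
    by (rule lyapunov_deflate[OF L])
  obtain P3 d es where P3: "P3 \<in> carrier_mat m m" "det P3 \<noteq> 0"
    "mat_adjoint P3 * H3 * P3 = mat_diag m (\<lambda>i. complex_of_real (d i))"
    and es: "length es = m" "char_poly A3 = (\<Prod>e\<leftarrow>es. [:- e, 1:])" "\<forall>i<m. Re (es ! i) * d i < 0"
    using Suc.IH[OF L3] by blast
  have H3: "H3 \<in> carrier_mat m m" using L3 by (simp add: lyapunov_def)
  define R where "R = four_block_mat (1\<^sub>m 1) (0\<^sub>m 1 m) (0\<^sub>m m 1) P3"
  note R = block_diag_congruence[OF _ H3 P3(1), folded R_def]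
  have M: "mat 1 1 (\<lambda>_. complex_of_real \<eta>) \<in> carrier_mat 1 1" by simp
  have "mat_adjoint (P * R) * H * (P * R) =
      mat_adjoint R * four_block_mat (mat 1 1 (\<lambda>_. complex_of_real \<eta>)) (0\<^sub>m 1 m) (0\<^sub>m m 1) H3 * R"
    unfolding congruence_comp[OF P(1) R(1)[OF M] H] P(3) ..
  also have "\<dots> = four_block_mat (mat 1 1 (\<lambda>_. complex_of_real \<eta>)) (0\<^sub>m 1 m) (0\<^sub>m m 1) (mat_adjoint P3 * H3 * P3)"
    by (rule R(3)[OF M])
  also have "\<dots> = mat_diag (1 + m) (\<lambda>i. complex_of_real (case i of 0 \<Rightarrow> \<eta> | Suc i \<Rightarrow> d i))"
    unfolding P3(3) by (intro eq_matI) (auto simp: mat_diag_def split: nat.splits)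
  finally have "mat_adjoint (P * R) * H * (P * R) = \<dots>" .
  moreover have "P * R \<in> carrier_mat (Suc m) (Suc m)" using P R(1)[OF M] by simp
  moreover have "det (P * R) \<noteq> 0" using det_mult[OF P(1) R(1)[OF M]] P P3 R(2)[OF M] by simp
  moreover have "\<forall>i<Suc m. Re ((a # es) ! i) * (case i of 0 \<Rightarrow> \<eta> | Suc i \<Rightarrow> d i) < 0"
    using neg es(3) by (auto simp: less_Suc_eq_0_disj)
  ultimately show ?case using ch es
    by (intro exI[of _ "P * R"] exI[of _ "\<lambda>i. case i of 0 \<Rightarrow> \<eta> | Suc i \<Rightarrow> d i"] exI[of _ "a # es"]) simp
qed

section \<open>Sylvester's law of inertia\<close>

lemma common_orthogonal_vec:
  fixes vs :: "'a :: field vec list"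
  assumes "length vs < n" "set vs \<subseteq> carrier_vec n"
  obtains u where "u \<in> carrier_vec n" "u \<noteq> 0\<^sub>v n" "\<And>v. v \<in> set vs \<Longrightarrow> v \<bullet> u = 0"
proof -
  \<comment> \<open>Zero rows pad the conditions to a square matrix; at least one is added, so the
    last row is zero and the determinant vanishes.\<close>
  define ws where "ws = vs @ replicate (n - length vs) (0\<^sub>v n)"
  define K where "K = mat_of_rows n ws"
  have len: "length ws = n" using assms by (simp add: ws_def)
  have ws: "set ws \<subseteq> carrier_vec n" using assms by (auto simp: ws_def)
  have K: "K \<in> carrier_mat n n" using len by (simp add: K_def mat_of_rows_def)
  have row: "row K i = ws ! i" if "i < n" for i
    unfolding K_def using that len ws by (intro mat_of_rows_row) auto
  have last: "row K (n - 1) = 0\<^sub>v n"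
  proof -
    have "\<not> n - 1 < length vs" "n - 1 < n" using assms(1) by linarith+
    then show ?thesis using row[of "n - 1"] by (simp add: ws_def nth_append)
  qed
  have "det K = 0"
  proof -
    have "det (transpose_mat K) = 0"
    proof -
      have "transpose_mat K *\<^sub>v unit_vec n (n - 1) = 0\<^sub>v n"
        using K assms last
        by (intro eq_vecI) (auto simp: row_def col_def vec_eq_iff scalar_prod_right_unit)
      moreover have "unit_vec n (n - 1) \<noteq> (0\<^sub>v n :: 'a vec)" using assms by simp
      moreover have "transpose_mat K \<in> carrier_mat n n" using K by simp
      ultimately show ?thesis
        using det_0_iff_vec_prod_zero_field[of "transpose_mat K" n] unit_vec_carrier by blast
    qed
    then show ?thesis using det_transpose[OF K] by simp
  qed
  then obtain u where u: "u \<in> carrier_vec n" "u \<noteq> 0\<^sub>v n" "K *\<^sub>v u = 0\<^sub>v n"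
    using det_0_iff_vec_prod_zero_field[OF K] by blast
  show thesis
  proof (rule that[OF u(1,2)])
    fix v assume "v \<in> set vs"
    then obtain i where i: "i < length vs" "v = vs ! i" by (auto simp: in_set_conv_nth)
    then have "row K i = v" using row[of i] assms by (simp add: ws_def nth_append)
    then show "v \<bullet> u = 0" using arg_cong[OF u(3), of "\<lambda>w. w $ i"] i assms K by simp
  qed
qed

lemma diag_form_value:
  fixes u :: "complex vec"
  assumes "u \<in> carrier_vec n"
  shows "(mat_diag n (\<lambda>i. complex_of_real (d i)) *\<^sub>v u) \<bullet>c u = complex_of_real (\<Sum>i<n. d i * (cmod (u $ i))\<^sup>2)"
proof -
  have "(mat_diag n (\<lambda>i. complex_of_real (d i)) *\<^sub>v u) $ i = d i * u $ i" if "i < n" for i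
  proof -
    have "(mat_diag n (\<lambda>i. complex_of_real (d i)) *\<^sub>v u) $ i =
        (\<Sum>j\<in>{0..<n}. (if i = j then complex_of_real (d j) else 0) * u $ j)"
      using that assms by (simp add: mat_diag_def scalar_prod_def)
    also have "\<dots> = (\<Sum>j\<in>{0..<n}. if i = j then complex_of_real (d j) * u $ j else 0)"
      by (intro sum.cong) auto
    finally show ?thesis using that by simp
  qed
  then show ?thesis using assms
    by (auto simp: scalar_prod_def lessThan_atLeast0 complex_norm_square mult.assoc simp del: of_real_power intro!: sum.cong)
qed

lemma adjoint_form:
  fixes A :: "complex mat"
  assumes "A \<in> carrier_mat n m" "x \<in> carrier_vec n" "y \<in> carrier_vec m"
  shows "x \<bullet>c (A *\<^sub>v y) = (mat_adjoint A *\<^sub>v x) \<bullet>c y"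
proof -
  have "x \<bullet>c (A *\<^sub>v y) = (\<Sum>i<n. \<Sum>j<m. x $ i * cnj (A $$ (i, j)) * cnj (y $ j))"
    using assms by (auto simp: scalar_prod_def lessThan_atLeast0 sum_distrib_left mult.assoc)
  also have "\<dots> = (\<Sum>j<m. \<Sum>i<n. x $ i * cnj (A $$ (i, j)) * cnj (y $ j))" by (rule sum.swap)
  also have "\<dots> = (mat_adjoint A *\<^sub>v x) \<bullet>c y"
    using assms by (auto simp: scalar_prod_def lessThan_atLeast0 sum_distrib_right sum_distrib_left mult_ac intro!: sum.cong)
  finally show ?thesis .
qed

text \<open>If the inequality failed, fewer than \<open>n\<close> linear conditions would force the
  coordinates of \<open>u\<close> to vanish where \<open>d1\<close> is not positive and those of
  \<open>R *\<^sub>v u\<close> where \<open>d2\<close> is positive. A nonzero solution makes one and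
  the same value of the form positive and nonpositive.\<close>

lemma sylvester_le:
  fixes P1 P2 H :: "complex mat"
  assumes H: "H \<in> carrier_mat n n"
    and P1: "P1 \<in> carrier_mat n n" "det P1 \<noteq> 0" "mat_adjoint P1 * H * P1 = mat_diag n (\<lambda>i. complex_of_real (d1 i))"
    and P2: "P2 \<in> carrier_mat n n" "det P2 \<noteq> 0" "mat_adjoint P2 * H * P2 = mat_diag n (\<lambda>i. complex_of_real (d2 i))"
  shows "card {i. i < n \<and> d1 i > 0} \<le> card {i. i < n \<and> d2 i > 0}"
proof (rule ccontr)
  define I where "I = {i. i < n \<and> d2 i > 0}"
  define J where "J = {i. i < n \<and> \<not> d1 i > 0}"
  assume "\<not> ?thesis"
  then have lt: "card I < card {i. i < n \<and> d1 i > 0}" by (simp add: I_def)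
  have fin: "finite I" "finite J" by (simp_all add: I_def J_def)
  have "{..<n} = {i. i < n \<and> d1 i > 0} \<union> J" by (auto simp: J_def)
  then have "n = card {i. i < n \<and> d1 i > 0} + card J"
    using card_Un_disjoint[of "{i. i < n \<and> d1 i > 0}" J] by (simp add: J_def disjoint_iff) (metis card_lessThan)
  with lt have IJ: "card I + card J < n" by linarith
  obtain Q where Q: "Q \<in> carrier_mat n n" "P2 * Q = 1\<^sub>m n" using det_nonzero_inverseE[OF P2(1,2)] by blast
  define R where "R = Q * P1"
  have R: "R \<in> carrier_mat n n" using P1 Q by (simp add: R_def)
  have P1R: "P1 = P2 * R"
    using P1 P2 Q by (simp add: R_def assoc_mult_mat[of P2 n n Q n P1 n, symmetric] left_mult_one_mat[of _ n n])
  define vs where "vs = map (row R) (sorted_list_of_set I) @ map (unit_vec n) (sorted_list_of_set J)"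
  have "length vs < n" "set vs \<subseteq> carrier_vec n" using IJ R by (auto simp: vs_def)
  then obtain u where u: "u \<in> carrier_vec n" "u \<noteq> 0\<^sub>v n" "\<And>v. v \<in> set vs \<Longrightarrow> v \<bullet> u = 0"
    using common_orthogonal_vec by blast
  have uJ: "u $ i = 0" if "i \<in> J" for i
  proof -
    have "unit_vec n i \<bullet> u = 0" using that fin by (intro u(3)) (auto simp: vs_def)
    then show ?thesis using that u by (simp add: J_def)
  qed
  have RI: "(R *\<^sub>v u) $ i = 0" if "i \<in> I" for i
  proof -
    have "row R i \<bullet> u = 0" using that fin by (intro u(3)) (auto simp: vs_def)
    then show ?thesis using that R by (simp add: I_def)
  qed
  have Ru: "R *\<^sub>v u \<in> carrier_vec n" using R u by simp
  let ?D1 = "mat_diag n (\<lambda>i. complex_of_real (d1 i))" and ?D2 = "mat_diag n (\<lambda>i. complex_of_real (d2 i))"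
  have D2: "?D2 \<in> carrier_mat n n" by (simp add: mat_diag_def)
  have "?D1 = mat_adjoint R * ?D2 * R"
    unfolding P1(3)[symmetric] P2(3)[symmetric] P1R by (rule congruence_comp[OF P2(1) R H])
  then have "(?D1 *\<^sub>v u) \<bullet>c u = (mat_adjoint R *\<^sub>v (?D2 *\<^sub>v (R *\<^sub>v u))) \<bullet>c u"
    using R D2 u by (simp add: assoc_mult_mat_vec[of _ n n _ n] mult_carrier_mat[of _ n n _ n])
  also have "\<dots> = (?D2 *\<^sub>v (R *\<^sub>v u)) \<bullet>c (R *\<^sub>v u)"
    using adjoint_form[OF R _ u(1), of "?D2 *\<^sub>v (R *\<^sub>v u)"] mult_mat_vec_carrier[OF D2 Ru] by simp
  finally have eq: "(\<Sum>i<n. d1 i * (cmod (u $ i))\<^sup>2) = (\<Sum>i<n. d2 i * (cmod ((R *\<^sub>v u) $ i))\<^sup>2)"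
    unfolding diag_form_value[OF u(1)] diag_form_value[OF Ru] of_real_eq_iff .
  obtain k where k: "k < n" "u $ k \<noteq> 0" using u(1,2) by (auto simp: vec_eq_iff)
  then have "d1 k > 0" using uJ[of k] by (auto simp: J_def)
  have "0 < (\<Sum>i<n. d1 i * (cmod (u $ i))\<^sup>2)"
  proof (rule sum_pos2[of _ k])
    show "0 \<le> d1 i * (cmod (u $ i))\<^sup>2" if "i \<in> {..<n}" for i
      using that uJ[of i] by (cases "d1 i > 0") (auto simp: J_def)
  qed (use k \<open>d1 k > 0\<close> in auto)
  moreover have "(\<Sum>i<n. d2 i * (cmod ((R *\<^sub>v u) $ i))\<^sup>2) \<le> 0"
  proof (rule sum_nonpos)
    show "d2 i * (cmod ((R *\<^sub>v u) $ i))\<^sup>2 \<le> 0" if "i \<in> {..<n}" for i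
      using that RI[of i] by (cases "d2 i > 0") (auto simp: I_def mult_nonpos_nonneg)
  qed
  ultimately show False using eq by linarith
qed

section \<open>Counting roots in the two half-planes\<close>

lemma proots_prod_linear: "proots (\<Prod>e\<leftarrow>es. [:- e, 1:]) = mset (es :: complex list)"
proof (induction es)
  case (Cons e es)
  have "(\<Prod>e\<leftarrow>es. [:- e, 1:]) \<noteq> (0 :: complex poly)" by (auto simp: prod_list_zero_iff)
  then have "proots ([:- e, 1:] * (\<Prod>e\<leftarrow>es. [:- e, 1:])) = proots [:- e, 1:] + mset es"
    using Cons by (subst proots_mult) auto
  then show ?case by simp
qed simp

definition lhp :: "complex poly \<Rightarrow> nat" where
  "lhp f = size (filter_mset (\<lambda>z. Re z < 0) (proots f))"

definition rhp :: "complex poly \<Rightarrow> nat" where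
  "rhp f = size (filter_mset (\<lambda>z. Re z > 0) (proots f))"

definition iax :: "complex poly \<Rightarrow> nat" where
  "iax f = size (filter_mset (\<lambda>z. Re z = 0) (proots f))"

lemma size_filter_mset_nth:
  "size (filter_mset Q (mset es)) = card {i. i < length es \<and> Q (es ! i)}"
  by (simp add: length_filter_conv_card mset_filter[symmetric] del: mset_filter)

lemma lyapunov_root_count:
  assumes "lyapunov n p H A C"
  obtains P d where "P \<in> carrier_mat n n" "det P \<noteq> 0"
    "mat_adjoint P * H * P = mat_diag n (\<lambda>i. complex_of_real (d i))"
    "lhp (char_poly A) = card {i. i < n \<and> d i > 0}" "rhp (char_poly A) = card {i. i < n \<and> d i < 0}"
    "iax (char_poly A) = 0"
proof -
  obtain P d es where P: "P \<in> carrier_mat n n" "det P \<noteq> 0"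
    "mat_adjoint P * H * P = mat_diag n (\<lambda>i. complex_of_real (d i))"
    and es: "length es = n" "char_poly A = (\<Prod>e\<leftarrow>es. [:- e, 1:])" and neg: "\<And>i. i < n \<Longrightarrow> Re (es ! i) * d i < 0"
    using inertia_congruence[OF assms] by blast
  have sgn: "Re (es ! i) < 0 \<longleftrightarrow> d i > 0" "Re (es ! i) > 0 \<longleftrightarrow> d i < 0" "Re (es ! i) \<noteq> 0" if "i < n" for i
    using neg[OF that] by (auto simp: mult_less_0_iff)
  have m: "proots (char_poly A) = mset es" unfolding es(2) by (rule proots_prod_linear)
  have "lhp (char_poly A) = card {i. i < n \<and> d i > 0}"
    unfolding lhp_def m size_filter_mset_nth es(1) using sgn by (intro arg_cong[of _ _ card]) auto
  moreover have "rhp (char_poly A) = card {i. i < n \<and> d i < 0}"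
    unfolding rhp_def m size_filter_mset_nth es(1) using sgn by (intro arg_cong[of _ _ card]) auto
  moreover have "iax (char_poly A) = 0"
    unfolding iax_def m size_filter_mset_nth es(1) using sgn by auto
  ultimately show thesis using that[OF P] by blast
qed

text \<open>Both counts equal the positive index of \<open>H\<close>, the second through the
  sign-reversed diagonal form. Sylvester's law makes them agree although \<open>A1\<close> and
  \<open>A2\<close> are unrelated.\<close>

lemma lyapunov_opposite_lhp:
  assumes L1: "lyapunov n p1 H A1 C1" and L2: "lyapunov n p2 (- H) A2 C2"
  shows "lhp (char_poly A1) = rhp (char_poly A2)"
proof -
  have H: "H \<in> carrier_mat n n" using L1 by (simp add: lyapunov_def)
  obtain P1 d1 where 1: "P1 \<in> carrier_mat n n" "det P1 \<noteq> 0"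
    "mat_adjoint P1 * H * P1 = mat_diag n (\<lambda>i. complex_of_real (d1 i))"
    "lhp (char_poly A1) = card {i. i < n \<and> d1 i > 0}"
    using lyapunov_root_count[OF L1] by blast
  obtain P2 d2 where 2: "P2 \<in> carrier_mat n n" "det P2 \<noteq> 0"
    "mat_adjoint P2 * - H * P2 = mat_diag n (\<lambda>i. complex_of_real (d2 i))"
    "rhp (char_poly A2) = card {i. i < n \<and> d2 i < 0}"
    using lyapunov_root_count[OF L2] by blast
  have "mat_adjoint P2 * H * P2 = - (mat_adjoint P2 * - H * P2)"
    using carrier_matD[OF H] carrier_matD[OF 2(1)] by simp
  also have "\<dots> = mat_diag n (\<lambda>i. complex_of_real (- d2 i))"
    unfolding 2(3) by (intro eq_matI) (auto simp: mat_diag_def)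
  finally have 3: "mat_adjoint P2 * H * P2 = mat_diag n (\<lambda>i. complex_of_real (- d2 i))" .
  have "card {i. i < n \<and> d1 i > 0} = card {i. i < n \<and> - d2 i > 0}"
    using sylvester_le[OF H 1(1-3) 2(1,2) 3] sylvester_le[OF H 2(1,2) 3 1(1-3)] by simp
  then show ?thesis using 1 2 by simp
qed

lemma lyapunov_iax: "lyapunov n p H A C \<Longrightarrow> iax (char_poly A) = 0"
  by (erule lyapunov_root_count)

lemma char_poly_four_block_lower_left_zero:
  fixes A1 :: "'a :: idom mat"
  assumes "A1 \<in> carrier_mat n n" "A2 \<in> carrier_mat n m" "A4 \<in> carrier_mat m m"
  shows "char_poly (four_block_mat A1 A2 (0\<^sub>m m n) A4) = char_poly A1 * char_poly A4"
proof -
  have "char_poly_matrix (four_block_mat A1 A2 (0\<^sub>m m n) A4) =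
      four_block_mat (char_poly_matrix A1) (map_mat (\<lambda>a. [:- a:]) A2) (0\<^sub>m m n) (char_poly_matrix A4)"
    using assms by (intro eq_matI) (auto simp: char_poly_matrix_def)
  then show ?thesis unfolding char_poly_def using assms
    by (simp add: det_four_block_mat_lower_left_zero[of _ n _ m])
qed

lemma root_count_mult:
  assumes "f \<noteq> 0" "g \<noteq> 0"
  shows "lhp (f * g) = lhp f + lhp g" "rhp (f * g) = rhp f + rhp g" "iax (f * g) = iax f + iax g"
  using assms by (simp_all add: lhp_def rhp_def iax_def proots_mult)

lemma root_count_smult:
  assumes "c \<noteq> 0"
  shows "lhp (smult c f) = lhp f" "rhp (smult c f) = rhp f" "iax (smult c f) = iax f"
  using assms by (simp_all add: lhp_def rhp_def iax_def)

lemma char_poly_nonzero: "A \<in> carrier_mat n n \<Longrightarrow> char_poly A \<noteq> (0 :: 'a :: comm_ring_1 poly)"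
  using degree_monic_char_poly[of A n] by auto

lemma root_count_zero_mat:
  "lhp (char_poly (0\<^sub>m k k)) = 0" "rhp (char_poly (0\<^sub>m k k)) = 0" "iax (char_poly (0\<^sub>m k k)) = k"
proof -
  have "char_poly (0\<^sub>m k k :: complex mat) = (\<Prod>e\<leftarrow>replicate k 0. [:- e, 1:])"
  proof (subst char_poly_upper_triangular[of _ k])
    have "diag_mat (0\<^sub>m k k) = replicate k (0 :: complex)"
      unfolding diag_mat_def by (intro nth_equalityI) auto
    then show "(\<Prod>a\<leftarrow>diag_mat (0\<^sub>m k k). [:- a, 1:]) = (\<Prod>e\<leftarrow>replicate k (0 :: complex). [:- e, 1:])" by simp
  qed (auto simp: upper_triangular_def)
  then have "proots (char_poly (0\<^sub>m k k :: complex mat)) = mset (replicate k 0)"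
    by (simp only: proots_prod_linear)
  then show "lhp (char_poly (0\<^sub>m k k)) = 0" "rhp (char_poly (0\<^sub>m k k)) = 0" "iax (char_poly (0\<^sub>m k k)) = k"
    unfolding lhp_def rhp_def iax_def by (simp_all only: size_filter_mset_nth) (auto cong: conj_cong)
qed

section \<open>Splitting off the kernel of a Hermitian form\<close>

lemma hermitian_split:
  fixes H :: "complex mat"
  assumes "H \<in> carrier_mat n n" "mat_adjoint H = H"
  shows "\<exists>P k r Lam. P \<in> carrier_mat n n \<and> det P \<noteq> 0 \<and> n = k + r \<and> Lam \<in> carrier_mat r r \<and> det Lam \<noteq> 0 \<and>
    mat_adjoint P * H * P = four_block_mat (0\<^sub>m k k) (0\<^sub>m k r) (0\<^sub>m r k) Lam"
  using assms
proof (induction n arbitrary: H)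
  case 0
  then have "H = four_block_mat (0\<^sub>m 0 0) (0\<^sub>m 0 0) (0\<^sub>m 0 0) (1\<^sub>m 0)" by (intro eq_matI) auto
  then show ?case using 0 by (intro exI[of _ "1\<^sub>m 0"] exI[of _ 0] exI[of _ "1\<^sub>m 0"]) auto
next
  case (Suc m)
  define n where "n = 1 + m"
  have H: "H \<in> carrier_mat n n" and h: "mat_adjoint H = H" using Suc.prems by (auto simp: n_def)
  show ?case
  proof (cases "det H = 0")
    case False
    have "H = four_block_mat (0\<^sub>m 0 0) (0\<^sub>m 0 n) (0\<^sub>m n 0) H" using H by (intro eq_matI) auto
    then have "mat_adjoint (1\<^sub>m n) * H * 1\<^sub>m n = four_block_mat (0\<^sub>m 0 0) (0\<^sub>m 0 n) (0\<^sub>m n 0) H"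
      using H by simp
    then show ?thesis using False H
      by (intro exI[of _ "1\<^sub>m n"] exI[of _ 0] exI[of _ n] exI[of _ H]) (auto simp: n_def)
  next
    case True
    then obtain v where v: "v \<in> carrier_vec n" "v \<noteq> 0\<^sub>v n" "H *\<^sub>v v = 0\<^sub>v n"
      using det_0_iff_vec_prod_zero_field[OF H] by blast
    obtain P0 where P0: "P0 \<in> carrier_mat n n" "det P0 \<noteq> 0" "col P0 0 = v"
      using complete_to_invertible[OF v(1,2)] by blast
    define K where "K = mat_adjoint P0 * H * P0"
    have K: "K \<in> carrier_mat n n" using P0 H by (auto simp: K_def)
    have hK: "mat_adjoint K = K" unfolding K_def by (rule mat_adjoint_congruence[OF P0(1) H h])
    obtain K1 K2 K3 K4 where Kb: "K = four_block_mat K1 K2 K3 K4" "K1 \<in> carrier_mat 1 1" "K2 \<in> carrier_mat 1 m"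
        "K3 \<in> carrier_mat m 1" "K4 \<in> carrier_mat m m"
      using K unfolding n_def by (elim mat_four_blockE)
    have n0: "0 < n" by (simp add: n_def)
    have "col K 0 = mat_adjoint P0 *\<^sub>v (H *\<^sub>v col P0 0)"
      unfolding K_def using P0 H n0
      by (subst col_mult2[of _ n n _ n]) (auto simp: assoc_mult_mat_vec[of _ n n _ n] mult_carrier_mat)
    also have "\<dots> = 0\<^sub>v n" unfolding P0(3) v(3) using P0 by (intro eq_vecI) (auto simp: scalar_prod_def)
    finally have col: "col K 0 = 0\<^sub>v n" .
    have Ki0: "K $$ (i, 0) = 0" if "i < n" for i
      using arg_cong[OF col, of "\<lambda>w. w $ i"] that K n0 by simp
    \<comment> \<open>Hermitian symmetry makes the first row vanish together with the first column,
      so the kernel vector splits off without elimination.\<close>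
    have K0i: "K $$ (0, i) = 0" if "i < n" for i
      using arg_cong[OF hK, of "\<lambda>X. X $$ (0, i)"] Ki0[OF that] that K n0 by simp
    have "K1 = 0\<^sub>m 1 1" using Ki0[of 0] Kb n0 by (intro eq_matI) auto
    moreover have "K2 = 0\<^sub>m 1 m"
    proof (rule eq_matI)
      fix i j assume "i < dim_row (0\<^sub>m 1 m)" "j < dim_col (0\<^sub>m 1 m)"
      then show "K2 $$ (i, j) = 0\<^sub>m 1 m $$ (i, j)" using K0i[of "Suc j"] Kb by (auto simp: n_def)
    qed (use Kb in auto)
    moreover have "K3 = 0\<^sub>m m 1"
    proof (rule eq_matI)
      fix i j assume "i < dim_row (0\<^sub>m m 1)" "j < dim_col (0\<^sub>m m 1)"
      then show "K3 $$ (i, j) = 0\<^sub>m m 1 $$ (i, j)" using Ki0[of "Suc i"] Kb by (auto simp: n_def)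
    qed (use Kb in auto)
    ultimately have Kf: "K = four_block_mat (0\<^sub>m 1 1) (0\<^sub>m 1 m) (0\<^sub>m m 1) K4" using Kb by simp
    have h4: "mat_adjoint K4 = K4"
    proof -
      have e: "four_block_mat (0\<^sub>m 1 1) (0\<^sub>m 1 m) (0\<^sub>m m 1) (mat_adjoint K4) = four_block_mat (0\<^sub>m 1 1) (0\<^sub>m 1 m) (0\<^sub>m m 1) K4"
        using hK unfolding Kf using Kb by (subst (asm) mat_adjoint_four_block[of _ 1 1 _ m _ m]) auto
      show ?thesis by (rule four_block_matD(4)[OF e, of 1 1 m m]; use Kb in simp)
    qed
    obtain P3 k r Lam where P3: "P3 \<in> carrier_mat m m" "det P3 \<noteq> 0" and m: "m = k + r"
      and Lam: "Lam \<in> carrier_mat r r" "det Lam \<noteq> 0"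
      and e3: "mat_adjoint P3 * K4 * P3 = four_block_mat (0\<^sub>m k k) (0\<^sub>m k r) (0\<^sub>m r k) Lam"
      using Suc.IH[OF Kb(5) h4] by blast
    define R where "R = four_block_mat (1\<^sub>m 1) (0\<^sub>m 1 m) (0\<^sub>m m 1) P3"
    note bR = block_diag_congruence[OF zero_carrier_mat Kb(5) P3(1), folded R_def, folded n_def]
    note R = bR(1)
    have "mat_adjoint (P0 * R) * H * (P0 * R) = mat_adjoint R * K * R"
      unfolding congruence_comp[OF P0(1) R H] K_def ..
    also have "\<dots> = four_block_mat (0\<^sub>m 1 1) (0\<^sub>m 1 m) (0\<^sub>m m 1) (mat_adjoint P3 * K4 * P3)"
      unfolding Kf by (rule bR(3))
    also have "\<dots> = four_block_mat (0\<^sub>m (Suc k) (Suc k)) (0\<^sub>m (Suc k) r) (0\<^sub>m r (Suc k)) Lam"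
      unfolding e3 using Lam m by (intro eq_matI) auto
    finally have "mat_adjoint (P0 * R) * H * (P0 * R) = \<dots>" .
    moreover have "P0 * R \<in> carrier_mat (Suc m) (Suc m)" using mult_carrier_mat[OF P0(1) R] by (simp add: n_def)
    moreover have "det (P0 * R) \<noteq> 0" using det_mult[OF P0(1) R] P0 P3 bR(2) by simp
    ultimately show ?thesis using Lam m
      by (intro exI[of _ "P0 * R"] exI[of _ "Suc k"] exI[of _ r] exI[of _ Lam]) simp
  qed
qed

text \<open>
  The form \<open>- H\<close> solves the Lyapunov equation whose state matrix is \<open>H\<close> itself. This ties the
  eigenvalues of \<open>H\<close> to the inertia of any matrix congruent to it.
\<close>

lemma hermitian_split_inertia:
  fixes H :: "complex mat"
  assumes H: "H \<in> carrier_mat n n" and n: "n = k + r"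
    and P: "P \<in> carrier_mat n n" and Q: "Q \<in> carrier_mat n n" and PQ: "P * Q = 1\<^sub>m n"
    and Lam: "Lam \<in> carrier_mat r r" "det Lam \<noteq> 0" "mat_adjoint Lam = Lam"
    and split: "mat_adjoint P * H * P = four_block_mat (0\<^sub>m k k) (0\<^sub>m k r) (0\<^sub>m r k) Lam"
  obtains A C where "lyapunov r n (- Lam) A C" "lhp (char_poly H) = lhp (char_poly A)"
    "rhp (char_poly H) = rhp (char_poly A)" "iax (char_poly H) = k"
proof -
  let ?L = "four_block_mat (0\<^sub>m k k) (0\<^sub>m k r) (0\<^sub>m r k) Lam"
  have L: "?L \<in> carrier_mat n n" using Lam n by simp
  have QP: "Q * P = 1\<^sub>m n" by (rule mat_mult_left_right_inverse[OF P Q PQ])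
  have aQP: "mat_adjoint Q * mat_adjoint P = 1\<^sub>m n"
    using arg_cong[OF PQ, of mat_adjoint] P Q by (simp add: mat_adjoint_mult[of _ n n _ n])
  \<comment> \<open>The inverse of \<open>mat_adjoint P\<close> is \<open>mat_adjoint Q\<close>, so
    \<open>H * P\<close> is \<open>mat_adjoint Q\<close> times the split form, and only the last
    \<open>r\<close> columns \<open>Y2\<close> survive.\<close>
  obtain Y1 Y2 where Y: "mat_adjoint Q = append_cols Y1 Y2" "Y1 \<in> carrier_mat n k" "Y2 \<in> carrier_mat n r"
    using Q unfolding n by (metis mat_adjoint_carrier mat_append_colsE)
  have HP: "H * P = mat_adjoint Q * ?L"
  proof -
    have "mat_adjoint Q * ?L = (mat_adjoint Q * mat_adjoint P) * (H * P)"
      unfolding split[symmetric] using P Q H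
      by (simp add: assoc_mult_mat[of _ n n _ n _ n] mult_carrier_mat[of _ n n _ n])
    then show ?thesis unfolding aQP using P H by simp
  qed
  \<comment> \<open>The lower diagonal block of \<open>Q * H * P\<close>; it carries the nonzero
    eigenvalues of \<open>H\<close>.\<close>
  define A where "A = mat_adjoint Y2 * Y2 * Lam"
  have A: "A \<in> carrier_mat r r" using Y Lam by (auto simp: A_def)
  have "Q * H * P = (Q * mat_adjoint Q) * ?L"
    using P Q H L HP by (simp add: assoc_mult_mat[of _ n n _ n _ n])
  also have "Q * mat_adjoint Q = four_block_mat (mat_adjoint Y1 * Y1) (mat_adjoint Y1 * Y2) (mat_adjoint Y2 * Y1) (mat_adjoint Y2 * Y2)"
    using adjoint_append_cols_mult[OF Y(2,3) Y(2,3)] Y(1) by (metis mat_adjoint_adjoint)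
  also have "\<dots> * ?L = four_block_mat (0\<^sub>m k k) (mat_adjoint Y1 * Y2 * Lam) (0\<^sub>m r k) A"
    using Y Lam by (subst mult_four_block_mat[of _ k k _ r _ r _ _ k _ r]) (auto simp: A_def intro!: cong_four_block_mat mult_carrier_mat)
  finally have QHP: "Q * H * P = four_block_mat (0\<^sub>m k k) (mat_adjoint Y1 * Y2 * Lam) (0\<^sub>m r k) A" .
  have "similar_mat (Q * H * P) H"
    unfolding similar_mat_def similar_mat_wit_def
    using P Q H PQ QP by (intro exI[of _ Q] exI[of _ P]) (auto simp: Let_def)
  then have "char_poly H = char_poly (Q * H * P)" by (simp add: char_poly_similar)
  also have "\<dots> = char_poly (0\<^sub>m k k) * char_poly A"
    unfolding QHP using Y Lam A by (intro char_poly_four_block_lower_left_zero) auto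
  finally have ch: "char_poly H = char_poly (0\<^sub>m k k) * char_poly A" .
  note nz = char_poly_nonzero[OF zero_carrier_mat, of k] char_poly_nonzero[OF A]
  \<comment> \<open>Both terms of the Lyapunov equation will equal \<open>- X\<close>, hence the
    factor \<open>sqrt 2\<close>.\<close>
  define c where "c = complex_of_real (sqrt 2)"
  have c: "c \<noteq> 0" by (simp add: c_def)
  define C where "C = c \<cdot>\<^sub>m (Y2 * Lam)"
  have C: "C \<in> carrier_mat n r" using Y Lam by (auto simp: C_def)
  have aA: "mat_adjoint A = Lam * (mat_adjoint Y2 * Y2)"
    unfolding A_def using Y Lam
    by (simp add: mat_adjoint_mult[of _ r r _ r] mat_adjoint_mult[of _ r n _ r] mult_carrier_mat[of _ r n _ r])
  define X where "X = Lam * (mat_adjoint Y2 * Y2) * Lam"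
  have X: "X \<in> carrier_mat r r" using Y Lam by (auto simp: X_def)
  have 1: "- Lam * A = - X" unfolding A_def X_def using Y Lam
    by (simp add: assoc_mult_mat[of _ r r _ r _ r] mult_carrier_mat[of _ r n _ r] mult_carrier_mat[of _ r r _ r]
        carrier_matD[OF Lam(1)] carrier_matD[OF Y(3)])
  have 2: "mat_adjoint A * - Lam = - X" unfolding aA X_def using carrier_matD[OF Lam(1)] carrier_matD[OF Y(3)] by simp
  have 3: "mat_adjoint C * C = 2 \<cdot>\<^sub>m X"
  proof -
    have "mat_adjoint C * C = 2 \<cdot>\<^sub>m (mat_adjoint (Y2 * Lam) * (Y2 * Lam))"
      unfolding C_def c_def by (rule adjoint_sqrt2_mult)
    also have "mat_adjoint (Y2 * Lam) * (Y2 * Lam) = X"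
      unfolding X_def using Y Lam
      by (simp add: mat_adjoint_mult[of _ n r _ r] assoc_mult_mat[of _ r r _ n _ r] assoc_mult_mat[of _ r n _ r _ r]
          assoc_mult_mat[of _ r r _ r _ r] mult_carrier_mat[of _ n r _ r] mult_carrier_mat[of _ r n _ r])
    finally show ?thesis .
  qed
  have "lyapunov r n (- Lam) A C"
    unfolding lyapunov_def
  proof (intro conjI allI impI)
    show "mat_adjoint (- Lam) = - Lam" by (simp add: mat_adjoint_uminus Lam)
    show "- Lam * A + mat_adjoint A * - Lam = - (mat_adjoint C * C)"
      unfolding 1 2 3 using X by (intro eq_matI) auto
    \<comment> \<open>The output is injective even without the eigenvector condition:
      \<open>Y2\<close> consists of columns of an invertible matrix and \<open>Lam\<close> is
      nonsingular.\<close>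
    fix v a assume v: "v \<in> carrier_vec r" and z: "C *\<^sub>v v = 0\<^sub>v n"
    have Lv: "Lam *\<^sub>v v \<in> carrier_vec r" using Lam v by simp
    have "C *\<^sub>v v = c \<cdot>\<^sub>v (Y2 *\<^sub>v (Lam *\<^sub>v v))"
      unfolding C_def assoc_mult_mat_vec[OF Y(3) Lam(1) v, symmetric]
      using Y Lam v by (intro eq_vecI) (auto simp del: assoc_mult_mat_vec)
    with z have "Y2 *\<^sub>v (Lam *\<^sub>v v) = 0\<^sub>v n" using c Y Lv by (auto simp: vec_eq_iff)
    then have "mat_adjoint Q *\<^sub>v (0\<^sub>v k @\<^sub>v (Lam *\<^sub>v v)) = 0\<^sub>v n"
      unfolding Y(1) using Y Lv by (subst append_cols_mult_vec[of _ n k _ r]) (auto simp: scalar_prod_def intro!: eq_vecI)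
    moreover have w: "0\<^sub>v k @\<^sub>v (Lam *\<^sub>v v) \<in> carrier_vec n" using Lv n by auto
    ultimately have "mat_adjoint P *\<^sub>v (mat_adjoint Q *\<^sub>v (0\<^sub>v k @\<^sub>v (Lam *\<^sub>v v))) = 0\<^sub>v n"
      using P by (auto simp: scalar_prod_def intro!: eq_vecI)
    moreover have "mat_adjoint P * mat_adjoint Q = 1\<^sub>m n"
      using arg_cong[OF QP, of mat_adjoint] P Q by (simp add: mat_adjoint_mult[of _ n n _ n])
    ultimately have "0\<^sub>v k @\<^sub>v (Lam *\<^sub>v v) = 0\<^sub>v n"
      using w P Q by (metis assoc_mult_mat_vec mat_adjoint_carrier one_mult_mat_vec)
    also have "\<dots> = 0\<^sub>v k @\<^sub>v 0\<^sub>v r" using n by auto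
    finally have "Lam *\<^sub>v v = 0\<^sub>v r" by (subst (asm) append_vec_eq[of _ k]) auto
    then show "v = 0\<^sub>v r" using det_0_iff_vec_prod_zero_field[OF Lam(1)] Lam(2) v by blast
  qed (use Lam A C in auto)
  moreover from this have "iax (char_poly A) = 0" by (rule lyapunov_iax)
  ultimately show thesis
    using that[of A C] ch root_count_mult[OF nz] root_count_zero_mat[of k] by simp
qed

section \<open>Polynomial fractions of matrices\<close>

definition const_mat :: "complex mat \<Rightarrow> complex poly mat" where
  "const_mat A = map_mat (\<lambda>a. [:a:]) A"

lemma const_mat_dim [simp]: "dim_row (const_mat A) = dim_row A" "dim_col (const_mat A) = dim_col A"
  by (simp_all add: const_mat_def)

lemma const_mat_carrier [simp]: "const_mat A \<in> carrier_mat n m \<longleftrightarrow> A \<in> carrier_mat n m"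
  by (auto simp: const_mat_def)

lemma const_mat_index [simp]: "i < dim_row A \<Longrightarrow> j < dim_col A \<Longrightarrow> const_mat A $$ (i, j) = [:A $$ (i, j):]"
  by (simp add: const_mat_def)

lemma const_poly_hom: "comm_ring_hom (\<lambda>a :: complex. [:a:])"
  by unfold_locales auto

lemma const_mat_mult:
  "A \<in> carrier_mat n m \<Longrightarrow> B \<in> carrier_mat m k \<Longrightarrow> const_mat (A * B) = const_mat A * const_mat B"
proof -
  interpret comm_ring_hom "\<lambda>a :: complex. [:a:]" by (rule const_poly_hom)
  show "A \<in> carrier_mat n m \<Longrightarrow> B \<in> carrier_mat m k \<Longrightarrow> const_mat (A * B) = const_mat A * const_mat B"
    unfolding const_mat_def by (rule mat_hom_mult)
qed

lemma det_const_mat: "det (const_mat A) = [:det A:]"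
proof -
  interpret comm_ring_hom "\<lambda>a :: complex. [:a:]" by (rule const_poly_hom)
  show ?thesis unfolding const_mat_def by (rule hom_det)
qed

lemma const_mat_one [simp]: "const_mat (1\<^sub>m n) = 1\<^sub>m n"
  by (intro eq_matI) auto

lemma const_mat_zero [simp]: "const_mat (0\<^sub>m n m) = 0\<^sub>m n m"
  by (intro eq_matI) auto

abbreviation (input) pencil :: "complex mat \<Rightarrow> complex poly mat" where
  "pencil T \<equiv> char_poly_matrix T"

lemma pencil_alt: "T \<in> carrier_mat n n \<Longrightarrow> pencil T = [:0, 1:] \<cdot>\<^sub>m 1\<^sub>m n - const_mat T"
  by (intro eq_matI) (auto simp: char_poly_matrix_def)

lemma pencil_similar:
  assumes T: "T \<in> carrier_mat n n" and P: "P \<in> carrier_mat n n" and R: "R \<in> carrier_mat n n" and RP: "R * P = 1\<^sub>m n"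
  shows "pencil (R * T * P) = const_mat R * pencil T * const_mat P"
proof -
  have "const_mat R * pencil T * const_mat P =
      const_mat R * ([:0, 1:] \<cdot>\<^sub>m 1\<^sub>m n) * const_mat P - const_mat R * const_mat T * const_mat P"
    unfolding pencil_alt[OF T] using assms(1-3)
    by (simp add: mult_minus_distrib_mat[of _ n n _ n] minus_mult_distrib_mat[of _ n n _ _ n] mult_carrier_mat[of _ n n _ n])
  also have "const_mat R * ([:0, 1:] \<cdot>\<^sub>m 1\<^sub>m n) * const_mat P = [:0, 1:] \<cdot>\<^sub>m (const_mat (R * P))"
    using P R by (simp add: const_mat_mult[OF R P] mult_smult_distrib[of _ n n _ n] mult_smult_assoc_mat[of _ n n _ n]
       right_mult_one_mat[of _ n n])
  also have "const_mat R * const_mat T * const_mat P = const_mat (R * T * P)"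
    using assms by (simp add: const_mat_mult[of _ n n _ n] mult_carrier_mat[of _ n n _ n])
  finally show ?thesis unfolding RP
    using pencil_alt[of "R * T * P" n] P R T by (simp add: mult_carrier_mat[of _ n n _ n])
qed

text \<open>The identities \<open>e1\<close> and \<open>e2\<close> triangularize the bordered
  pencil, so \<open>char_poly T\<close> is \<open>det X\<close> times its determinant. Equal degrees
  then force the latter to be constant. Both \<open>D\<close> and \<open>D + S\<close> take the role
  of \<open>X\<close>.\<close>

lemma det_fraction:
  fixes X E Q Q' :: "complex poly mat" and T B :: "complex mat"
  assumes T: "T \<in> carrier_mat n n" and B: "B \<in> carrier_mat n p" and X: "X \<in> carrier_mat p p"
    and E: "E \<in> carrier_mat p n" and Q: "Q \<in> carrier_mat p n" and Q': "Q' \<in> carrier_mat p p"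
    and e1: "E * pencil T = X * Q" and e2: "E * const_mat B + X * Q' = 1\<^sub>m p"
    and deg: "degree (det X) = n"
  obtains u where "u \<noteq> 0" "det (four_block_mat (pencil T) (const_mat B) (- Q) Q') = [:u:]"
    "char_poly T = smult u (det X)"
proof -
  let ?U = "four_block_mat (pencil T) (const_mat B) (- Q) Q'"
  have pT: "pencil T \<in> carrier_mat n n" using T by simp
  have U: "?U \<in> carrier_mat (n + p) (n + p)" using pT Q' by simp
  let ?W = "four_block_mat (1\<^sub>m n) (0\<^sub>m n p) E X"
  have W: "?W \<in> carrier_mat (n + p) (n + p)" using X by simp
  have z: "E * pencil T + X * - Q = 0\<^sub>m p n"
    unfolding e1 using X Q by (intro eq_matI) (auto simp: carrier_matD)
  have "?W * ?U = four_block_mat (pencil T) (const_mat B) (E * pencil T + X * - Q) (E * const_mat B + X * Q')"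
    using pT B Q Q' X E
    by (subst mult_four_block_mat[of _ n n _ p _ p _ _ n _ p]) (auto intro!: cong_four_block_mat)
  also have "\<dots> = four_block_mat (pencil T) (const_mat B) (0\<^sub>m p n) (1\<^sub>m p)" unfolding z e2 ..
  finally have "det ?W * det ?U = det (four_block_mat (pencil T) (const_mat B) (0\<^sub>m p n) (1\<^sub>m p))"
    by (simp add: det_mult[OF W U, symmetric])
  also have "\<dots> = char_poly T"
    using pT B by (subst det_four_block_mat_lower_left_zero[of _ n _ p]) (auto simp: char_poly_def)
  also have "det ?W = det X"
    using X E by (subst det_four_block_mat_upper_right_zero[of _ n _ p]) auto
  finally have eq: "det X * det ?U = char_poly T" .
  have nz: "char_poly T \<noteq> 0" using T by (rule char_poly_nonzero)
  then have "det X \<noteq> 0" "det ?U \<noteq> 0" using eq by auto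
  then have "degree (char_poly T) = degree (det X) + degree (det ?U)" by (simp add: eq[symmetric] degree_mult_eq)
  then have "degree (det ?U) = 0" using degree_monic_char_poly[OF T] deg by simp
  then obtain u where u: "det ?U = [:u:]" by (rule degree_eq_zeroE)
  then have "u \<noteq> 0" using \<open>det ?U \<noteq> 0\<close> by auto
  then show thesis using that u eq by (simp add: u mult.commute)
qed

section \<open>Realization of a matrix fraction and its feedback matrix\<close>

text \<open>
  The columns of \<open>E\<close> represent a basis of \<open>\<complex>[\<lambda>]\<^sup>p / D \<complex>[\<lambda>]\<^sup>p\<close>. In this basis \<open>T\<close> is multiplication by
  \<open>\<lambda>\<close> (with quotient \<open>Q\<close> modulo \<open>D\<close>) and \<open>B\<close> gives the classes of the constants (with quotient
  \<open>Q'\<close>). \<open>M\<close> and \<open>C\<close> are the polynomial part and the residue at infinity of \<open>S D\<^sup>-\<^sup>1 E\<close>. In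
  \<open>unobservable_kernel\<close>, \<open>W\<close> stands for an arbitrary \<open>T\<close>-invariant set inside the kernel of \<open>C\<close>.
\<close>

locale realization =
  fixes p n :: nat and D S E M Q Q' :: "complex poly mat" and T B C H :: "complex mat"
  assumes carrier [simp]: "D \<in> carrier_mat p p" "S \<in> carrier_mat p p" "E \<in> carrier_mat p n"
      "M \<in> carrier_mat p n" "Q \<in> carrier_mat p n" "Q' \<in> carrier_mat p p"
      "T \<in> carrier_mat n n" "B \<in> carrier_mat n p" "C \<in> carrier_mat p n" "H \<in> carrier_mat n n"
    and E_pencil: "E * pencil T = D * Q"
    and E_B: "E * const_mat B + D * Q' = 1\<^sub>m p"
    and S_Q: "S * Q = M * pencil T + const_mat C"
    and S_Q': "S * Q' + M * const_mat B = 0\<^sub>m p p"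
    and H_hermitian: "mat_adjoint H = H"
    and H_skew: "H * T = - (mat_adjoint T * H)"
    and C_eq: "C = mat_adjoint B * H"
    and observable: "\<exists>X Y. X \<in> carrier_mat n n \<and> Y \<in> carrier_mat n p \<and> const_mat H = Y * const_mat C + X * pencil T"
    and unobservable_kernel: "\<And>W x. (\<And>y. W y \<Longrightarrow> y \<in> carrier_vec n \<and> C *\<^sub>v y = 0\<^sub>v p \<and> W (T *\<^sub>v y)) \<Longrightarrow> W x \<Longrightarrow> H *\<^sub>v x = 0\<^sub>v n"
    and degree_det_D: "degree (det D) = n"
    and degree_det_F: "degree (det (D + S)) = n"
begin

lemma pencil_T [simp]: "pencil T \<in> carrier_mat n n" by simp

text \<open>With \<open>W = S D^-1\<close> one has \<open>F = (1 + W) D\<close>, and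
  \<open>(1 + W)^-1 = 1 - C (\<lambda> - A)^-1 B\<close> is the transfer function after output
  feedback; so the zeros of \<open>det F\<close> should be the eigenvalues of
  \<open>A\<close>.\<close>

definition A :: "complex mat" where "A = T - B * C"

lemma A_carrier [simp]: "A \<in> carrier_mat n n"
  unfolding A_def by (intro minus_carrier_mat mult_carrier_mat[of _ n p]) auto

lemma BC [simp]: "B * C \<in> carrier_mat n n" by (intro mult_carrier_mat[of _ n p]) auto

lemma pencil_A: "pencil A = pencil T + const_mat B * const_mat C"
proof -
  have "pencil T + const_mat (B * C) = pencil A"
    unfolding A_def using carrier_matD[OF carrier(7)] carrier_matD[OF BC]
    by (intro eq_matI) (auto simp: char_poly_matrix_def simp del: index_mult_mat)
  then show ?thesis by (simp add: const_mat_mult[OF carrier(8,9)])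
qed

text \<open>The feedback pair satisfies the same fraction identities with \<open>E + M\<close> for
  \<open>E\<close> and \<open>D + S\<close> for \<open>D\<close>. The terms containing
  \<open>C\<close> match after multiplying \<open>E_B\<close> and \<open>S_Q'\<close> by
  \<open>C\<close> on the right.\<close>

lemma F_pencil: "(E + M) * pencil A = (D + S) * (Q - Q' * const_mat C)"
proof -
  define K where "K = const_mat C"
  have K [simp]: "K \<in> carrier_mat p n" by (simp add: K_def)
  have cB [simp]: "const_mat B \<in> carrier_mat n p" by simp
  note [simp] = mult_carrier_mat[of _ p p _ n] mult_carrier_mat[of _ p n _ n] mult_carrier_mat[of _ n p _ n]
    mult_carrier_mat[of _ p p _ p] mult_carrier_mat[of _ p n _ p]
  have 1: "(E + M) * pencil A = (D * Q + E * const_mat B * K) + (M * pencil T + M * const_mat B * K)"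
    unfolding pencil_A K_def[symmetric]
    by (subst add_mult_distrib_mat[of _ p n _ _ n]) (simp_all add: mult_add_distrib_mat[of _ p n _ n] E_pencil
        assoc_mult_mat[of _ p n _ p _ n])
  have 2: "(D + S) * (Q - Q' * K) = (D * Q - D * Q' * K) + (S * Q - S * Q' * K)"
    by (subst add_mult_distrib_mat[of _ p p _ _ n]) (simp_all add: minus_carrier_mat[of _ p n] mult_minus_distrib_mat[of _ p p _ n]
        assoc_mult_mat[of _ p p _ p _ n])
  have 3: "E * const_mat B * K + D * Q' * K = K"
    using arg_cong[OF E_B, of "\<lambda>Z. Z * K"] by (simp add: add_mult_distrib_mat[of _ p p _ _ n] left_mult_one_mat[of _ p n])
  have 4: "S * Q' * K + M * const_mat B * K = 0\<^sub>m p n"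
    using arg_cong[OF S_Q', of "\<lambda>Z. Z * K"] by (simp add: add_mult_distrib_mat[of _ p p _ _ n] left_mult_zero_mat[of _ p n])
  define a b c d z m where "a = E * const_mat B * K" and "b = D * Q' * K" and "c = S * Q' * K"
    and "d = M * const_mat B * K" and "z = D * Q" and "m = M * pencil T"
  have cc: "a \<in> carrier_mat p n" "b \<in> carrier_mat p n" "c \<in> carrier_mat p n" "d \<in> carrier_mat p n"
    "z \<in> carrier_mat p n" "m \<in> carrier_mat p n"
    by (simp_all add: a_def b_def c_def d_def z_def m_def)
  have "(z + a) + (m + d) = (z - b) + (m + K - c)"
  proof (rule eq_matI)
    fix i j assume "i < dim_row ((z - b) + (m + K - c))" "j < dim_col ((z - b) + (m + K - c))"
    then have ij: "i < p" "j < n" using cc by auto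
    have 3: "a $$ (i, j) + b $$ (i, j) = K $$ (i, j)"
      using arg_cong[OF 3[folded a_def b_def], of "\<lambda>Z. Z $$ (i, j)"] ij cc carrier_matD[OF K] by auto
    have 4: "c $$ (i, j) + d $$ (i, j) = 0"
      using arg_cong[OF 4[folded c_def d_def], of "\<lambda>Z. Z $$ (i, j)"] ij cc by auto
    then have 4: "d $$ (i, j) = - c $$ (i, j)" by (metis add.commute eq_neg_iff_add_eq_0)
    show "((z + a) + (m + d)) $$ (i, j) = ((z - b) + (m + K - c)) $$ (i, j)"
      using ij cc carrier_matD[OF K] by (simp add: 3[symmetric] 4)
  qed (use cc carrier_matD[OF K] in auto)
  then show ?thesis unfolding K_def[symmetric] 1 2 S_Q unfolding a_def b_def c_def d_def z_def m_def .
qed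

lemma F_B: "(E + M) * const_mat B + (D + S) * Q' = 1\<^sub>m p"
proof -
  note [simp] = mult_carrier_mat[of _ p p _ p] mult_carrier_mat[of _ p n _ p]
  define a b c d where "a = E * const_mat B" and "b = D * Q'" and "c = S * Q'" and "d = M * const_mat B"
  have cc: "a \<in> carrier_mat p p" "b \<in> carrier_mat p p" "c \<in> carrier_mat p p" "d \<in> carrier_mat p p"
    by (simp_all add: a_def b_def c_def d_def)
  have "(a + d) + (b + c) = (a + b) + (c + d)" using cc by (intro eq_matI) auto
  also have "\<dots> = 1\<^sub>m p" using E_B S_Q' by (simp add: a_def b_def c_def d_def)
  finally show ?thesis
    by (simp add: a_def b_def c_def d_def add_mult_distrib_mat[of _ p n _ _ p] add_mult_distrib_mat[of _ p p _ _ p])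
qed

lemma det_F: obtains u where "u \<noteq> 0" "char_poly A = smult u (det (D + S))"
proof -
  have "D + S \<in> carrier_mat p p" "E + M \<in> carrier_mat p n" "Q - Q' * const_mat C \<in> carrier_mat p n"
    by (auto intro!: minus_carrier_mat mult_carrier_mat[of _ p p])
  from det_fraction[OF A_carrier carrier(8) this carrier(6) F_pencil F_B degree_det_F] that
  show thesis by metis
qed

text \<open>The bordered pencil has constant nonzero determinant by \<open>det_fraction\<close>. A
  left factor with diagonal blocks \<open>1\<close> and \<open>G\<close> turns its lower block row,
  via the Bezout identity, into \<open>(- X C, Y)\<close>; thus a right factor shared by the pencil
  and \<open>C\<close> becomes visible in \<open>det G\<close>.\<close>

lemma det_G_dvd:
  assumes G: "G \<in> carrier_mat p p" "X \<in> carrier_mat p p" "Y \<in> carrier_mat p p" "G = X * S + Y * D"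
  obtains u where "u \<noteq> 0" "smult u (det G) = det (four_block_mat (pencil T) (const_mat B) (- (X * const_mat C)) Y)"
proof -
  note [simp] = G(1-3)
  let ?U = "four_block_mat (pencil T) (const_mat B) (- Q) Q'"
  define K where "K = const_mat C"
  have K [simp]: "K \<in> carrier_mat p n" by (simp add: K_def)
  have cB [simp]: "const_mat B \<in> carrier_mat n p" by simp
  note [simp] = mult_carrier_mat[of _ p p _ n] mult_carrier_mat[of _ p n _ n] mult_carrier_mat[of _ n p _ n]
    mult_carrier_mat[of _ p p _ p] mult_carrier_mat[of _ p n _ p]
  let ?R = "X * M + Y * E"
  have R: "?R \<in> carrier_mat p n" by simp
  let ?W = "four_block_mat (1\<^sub>m n) (0\<^sub>m n p) ?R G"
  have W: "?W \<in> carrier_mat (n + p) (n + p)" by simp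
  have U: "?U \<in> carrier_mat (n + p) (n + p)" by simp
  obtain u where u: "u \<noteq> 0" "det ?U = [:u:]"
    using det_fraction[OF carrier(7,8,1,3,5,6) E_pencil E_B degree_det_D] by metis
  have 1: "?R * pencil T + G * - Q = - (X * K)"
  proof -
    have "?R * pencil T = X * (M * pencil T) + Y * (D * Q)"
      by (simp add: add_mult_distrib_mat[of _ p n _ _ n] E_pencil[symmetric] assoc_mult_mat[of _ p p _ n _ n])
    moreover have "G * Q = X * (M * pencil T) + X * K + Y * (D * Q)"
    proof -
      have "G * Q = X * (S * Q) + Y * (D * Q)"
        unfolding G(4) by (simp add: add_mult_distrib_mat[of _ p p _ _ n] assoc_mult_mat[of _ p p _ p _ n])
      then show ?thesis unfolding S_Q K_def[symmetric] by (simp add: mult_add_distrib_mat[of _ p p _ n])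
    qed
    moreover have "G * - Q = - (G * Q)" using carrier_matD[OF G(1)] carrier_matD[OF carrier(5)] by simp
    moreover define a b c where "a = X * (M * pencil T)" and "b = Y * (D * Q)" and "c = X * K"
    moreover have "a \<in> carrier_mat p n" "b \<in> carrier_mat p n" "c \<in> carrier_mat p n"
      by (simp_all add: a_def b_def c_def)
    moreover from this have "a + b + - (a + c + b) = - c" by (intro eq_matI) auto
    ultimately show ?thesis by simp
  qed
  have 2: "?R * const_mat B + G * Q' = Y"
  proof -
    have "?R * const_mat B = X * (M * const_mat B) + Y * (E * const_mat B)"
      by (simp add: add_mult_distrib_mat[of _ p n _ _ p] assoc_mult_mat[of _ p p _ n _ p])
    moreover have "G * Q' = X * (S * Q') + Y * (D * Q')"
      unfolding G(4) by (simp add: add_mult_distrib_mat[of _ p p _ _ p] assoc_mult_mat[of _ p p _ p _ p])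
    moreover have "X * (S * Q') + X * (M * const_mat B) = 0\<^sub>m p p"
      using arg_cong[OF S_Q', of "\<lambda>Z. X * Z"] by (simp add: mult_add_distrib_mat[of _ p p _ p] right_mult_zero_mat[of _ p p])
    moreover have "Y * (E * const_mat B) + Y * (D * Q') = Y"
      using arg_cong[OF E_B, of "\<lambda>Z. Y * Z"] by (simp add: mult_add_distrib_mat[of _ p p _ p] right_mult_one_mat[of _ p p])
    moreover define a b c d where "a = X * (M * const_mat B)" and "b = Y * (E * const_mat B)"
      and "c = X * (S * Q')" and "d = Y * (D * Q')"
    moreover have cc: "a \<in> carrier_mat p p" "b \<in> carrier_mat p p" "c \<in> carrier_mat p p" "d \<in> carrier_mat p p"
      by (simp_all add: a_def b_def c_def d_def)
    moreover from cc have "(a + b) + (c + d) = (c + a) + (b + d)" by (intro eq_matI) auto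
    ultimately show ?thesis by simp
  qed
  have "?W * ?U = four_block_mat (pencil T) (const_mat B) (?R * pencil T + G * - Q) (?R * const_mat B + G * Q')"
    by (subst mult_four_block_mat[of _ n n _ p _ p _ _ n _ p])
      (auto intro!: cong_four_block_mat simp: left_mult_zero_mat[of _ p n] left_mult_zero_mat[of _ p p]
        left_mult_one_mat[of _ n n] left_mult_one_mat[of _ n p] right_add_zero_mat[of _ n n] right_add_zero_mat[of _ n p]
        simp del: uminus_mult_right_mat)
  then have "det ?W * det ?U = det (four_block_mat (pencil T) (const_mat B) (- (X * const_mat C)) Y)"
    unfolding 1 2 by (simp add: det_mult[OF W U, symmetric] K_def)
  moreover have "det ?W = det G" by (subst det_four_block_mat_upper_right_zero[of _ n _ p]) auto
  ultimately show thesis using that u by (simp add: mult.commute)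
qed

text \<open>Dual to \<open>det_G_dvd\<close>: the observability identity produces a block triangular
  product with upper left block \<open>H + Z (\<lambda> - T)\<close>. The free matrix
  \<open>Z\<close> can make this block nonsingular where \<open>H\<close> is not. Since
  \<open>det D = det D1 * det G\<close>, the divisibility then bounds the degree of
  \<open>det G\<close> from above.\<close>

lemma det_D1_block:
  assumes G: "G \<in> carrier_mat p p" "D1 \<in> carrier_mat p p" "S1 \<in> carrier_mat p p" "D = D1 * G" "S = S1 * G"
    and Z: "Z \<in> carrier_mat n n"
  obtains f where "f * char_poly T = det (const_mat H + const_mat Z * pencil T) * det D1"
proof -
  obtain X Y where X [simp]: "X \<in> carrier_mat n n" and Y [simp]: "Y \<in> carrier_mat n p"
    and HXY: "const_mat H = Y * const_mat C + X * pencil T" using observable by blast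
  note [simp] = G(1-3) Z
  define K where "K = const_mat C"
  have K [simp]: "K \<in> carrier_mat p n" by (simp add: K_def)
  have cZ [simp]: "const_mat Z \<in> carrier_mat n n" by simp
  note [simp] = mult_carrier_mat[of _ p p _ n] mult_carrier_mat[of _ p n _ n] mult_carrier_mat[of _ n p _ n]
    mult_carrier_mat[of _ p p _ p] mult_carrier_mat[of _ n p _ p] mult_carrier_mat[of _ n n _ n]
  \<comment> \<open>\<open>Y * S1 * (G * Q)\<close> equals \<open>Y * S * Q\<close>, which
    contributes \<open>Y * M\<close> times the pencil besides \<open>Y\<close> times
    \<open>C\<close>; subtracting \<open>Y * M\<close> removes it.\<close>
  let ?X = "X - Y * M + const_mat Z"
  have X' [simp]: "?X \<in> carrier_mat n n" by (intro add_carrier_mat) simp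
  let ?V = "four_block_mat ?X (Y * S1) (- E) D1"
  let ?U = "four_block_mat (pencil T) (0\<^sub>m n p) (G * Q) (1\<^sub>m p)"
  have V: "?V \<in> carrier_mat (n + p) (n + p)" and U: "?U \<in> carrier_mat (n + p) (n + p)"
    by (intro four_block_carrier_mat; simp)+
  have 1: "?X * pencil T + Y * S1 * (G * Q) = const_mat H + const_mat Z * pencil T"
  proof -
    have "?X * pencil T = X * pencil T - Y * (M * pencil T) + const_mat Z * pencil T"
      by (simp add: minus_carrier_mat[of _ n n] add_mult_distrib_mat[of _ n n _ _ n] minus_mult_distrib_mat[of _ n n _ _ n] assoc_mult_mat[of _ n p _ n _ n])
    moreover have "Y * S1 * (G * Q) = Y * (M * pencil T) + Y * K"
    proof -
      have "Y * S1 * (G * Q) = Y * (S * Q)" unfolding G(5)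
        by (simp add: assoc_mult_mat[of _ n p _ p _ n] assoc_mult_mat[of _ p p _ p _ n])
      then show ?thesis unfolding S_Q K_def[symmetric] by (simp add: mult_add_distrib_mat[of _ n p _ n])
    qed
    moreover define a b c d where "a = X * pencil T" and "b = Y * (M * pencil T)" and "c = Y * K"
      and "d = const_mat Z * pencil T"
    moreover have cc: "a \<in> carrier_mat n n" "b \<in> carrier_mat n n" "c \<in> carrier_mat n n" "d \<in> carrier_mat n n"
      by (simp_all add: a_def b_def c_def d_def)
    moreover from cc have "(a - b + d) + (b + c) = c + a + d" by (intro eq_matI) auto
    ultimately show ?thesis unfolding HXY K_def[symmetric] by simp
  qed
  have 2: "- E * pencil T + D1 * (G * Q) = 0\<^sub>m p n"
  proof -
    have "D1 * (G * Q) = D * Q" unfolding G(4) by (simp add: assoc_mult_mat[of _ p p _ p _ n])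
    moreover have "- E * pencil T = - (E * pencil T)" using carrier_matD[OF carrier(3)] carrier_matD[OF pencil_T] by simp
    moreover have DQ: "D * Q \<in> carrier_mat p n" by simp
    ultimately show ?thesis unfolding E_pencil using carrier_matD[OF DQ] by (intro eq_matI) (auto simp del: index_mult_mat(1))
  qed
  have "?V * ?U = four_block_mat (?X * pencil T + Y * S1 * (G * Q)) (Y * S1) (- E * pencil T + D1 * (G * Q)) D1"
    by (subst mult_four_block_mat[of _ n n _ p _ p _ _ n _ p]) (auto intro!: cong_four_block_mat simp: right_mult_zero_mat[of _ n n] right_mult_zero_mat[of _ p n]
       right_mult_one_mat[of _ n p] right_mult_one_mat[of _ p p])
  then have "det ?V * det ?U = det (four_block_mat (const_mat H + const_mat Z * pencil T) (Y * S1) (0\<^sub>m p n) D1)"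
    unfolding 1 2 by (simp add: det_mult[OF V U, symmetric])
  also have "\<dots> = det (const_mat H + const_mat Z * pencil T) * det D1"
    by (subst det_four_block_mat_lower_left_zero[of _ n _ p]) auto
  also have "det ?U = char_poly T"
    by (subst det_four_block_mat_upper_right_zero[of _ n _ p]) (auto simp: char_poly_def)
  finally show thesis by (rule that)
qed

end

lemma const_mat_four_block:
  assumes "A1 \<in> carrier_mat n1 m1" "A2 \<in> carrier_mat n1 m2" "A3 \<in> carrier_mat n2 m1" "A4 \<in> carrier_mat n2 m2"
  shows "const_mat (four_block_mat A1 A2 A3 A4) =
    four_block_mat (const_mat A1) (const_mat A2) (const_mat A3) (const_mat A4)"
  using assms by (intro eq_matI) auto

lemma const_mat_append_cols:
  assumes "A1 \<in> carrier_mat n m1" "A2 \<in> carrier_mat n m2"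
  shows "const_mat (append_cols A1 A2) = append_cols (const_mat A1) (const_mat A2)"
  using assms by (intro eq_matI) auto

lemma pencil_four_block:
  assumes "A1 \<in> carrier_mat n n" "A2 \<in> carrier_mat n m" "A4 \<in> carrier_mat m m"
  shows "pencil (four_block_mat A1 A2 (0\<^sub>m m n) A4) =
    four_block_mat (pencil A1) (- const_mat A2) (0\<^sub>m m n) (pencil A4)"
  using assms by (intro eq_matI) (auto simp: char_poly_matrix_def)

context realization
begin

text \<open>A change of state basis alters only the state-space matrices and their quotients;
  \<open>D\<close>, \<open>S\<close> and \<open>Q'\<close> stay, so the determinants under
  comparison are unchanged.\<close>

lemma transform:
  assumes P: "P \<in> carrier_mat n n" and R: "R \<in> carrier_mat n n" and PR: "P * R = 1\<^sub>m n"
  shows "realization p n D S (E * const_mat P) (M * const_mat P) (Q * const_mat P) Q'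
    (R * T * P) (R * B) (C * P) (mat_adjoint P * H * P)"
proof -
  have RP: "R * P = 1\<^sub>m n" by (rule mat_mult_left_right_inverse[OF P R PR])
  have aRP: "mat_adjoint R * mat_adjoint P = 1\<^sub>m n"
    using arg_cong[OF PR, of mat_adjoint] P R by (simp add: mat_adjoint_mult[of _ n n _ n])
  define cP cR where "cP = const_mat P" and "cR = const_mat R"
  have cc [simp]: "cP \<in> carrier_mat n n" "cR \<in> carrier_mat n n" "P \<in> carrier_mat n n" "R \<in> carrier_mat n n"
    using P R by (simp_all add: cP_def cR_def)
  have cPR: "cP * cR = 1\<^sub>m n" unfolding cP_def cR_def const_mat_mult[OF P R, symmetric] PR by simp
  have cB [simp]: "const_mat B \<in> carrier_mat n p" and cC [simp]: "const_mat C \<in> carrier_mat p n" by simp_all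
  note [simp] = mult_carrier_mat[of _ p p _ n] mult_carrier_mat[of _ p n _ n] mult_carrier_mat[of _ n p _ n]
    mult_carrier_mat[of _ p p _ p] mult_carrier_mat[of _ n p _ p] mult_carrier_mat[of _ n n _ n]
    mult_carrier_mat[of _ n n _ p]
  have cancel: "X * cP * (cR * Z) = X * Z" if [simp]: "X \<in> carrier_mat q n" "Z \<in> carrier_mat n q'" for X Z q q'
  proof -
    have "X * cP * (cR * Z) = X * (cP * cR * Z)"
      by (simp add: assoc_mult_mat[of _ q n _ n _ q'] assoc_mult_mat[of _ n n _ n _ q'] mult_carrier_mat[of _ n n _ q'])
    then show ?thesis unfolding cPR by (simp add: left_mult_one_mat[of _ n q'])
  qed
  have pen: "pencil (R * T * P) = cR * (pencil T * cP)"
    unfolding cR_def cP_def pencil_similar[OF carrier(7) P R RP] using P R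
    by (simp add: assoc_mult_mat[of _ n n _ n _ n])
  have pTP [simp]: "pencil T * cP \<in> carrier_mat n n" by simp
  show ?thesis unfolding cP_def[symmetric]
  proof
    show "E * cP * pencil (R * T * P) = D * (Q * cP)"
      unfolding pen cancel[OF carrier(3) pTP]
      by (simp add: E_pencil assoc_mult_mat[of _ p n _ n _ n, symmetric] assoc_mult_mat[of _ p p _ n _ n, symmetric])
    show "E * cP * const_mat (R * B) + D * Q' = 1\<^sub>m p"
      unfolding const_mat_mult[OF R carrier(8)] cR_def[symmetric] cancel[OF carrier(3) cB] by (rule E_B)
    show "S * (Q * cP) = M * cP * pencil (R * T * P) + const_mat (C * P)"
      unfolding pen cancel[OF carrier(4) pTP] const_mat_mult[OF carrier(9) P] cP_def[symmetric]
      by (simp add: assoc_mult_mat[of _ p n _ n _ n, symmetric] assoc_mult_mat[of _ p p _ n _ n, symmetric] S_Q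
          add_mult_distrib_mat[of _ p n _ _ n])
    show "S * Q' + M * cP * const_mat (R * B) = 0\<^sub>m p p"
      unfolding const_mat_mult[OF R carrier(8)] cR_def[symmetric] cancel[OF carrier(4) cB] by (rule S_Q')
    show "mat_adjoint (mat_adjoint P * H * P) = mat_adjoint P * H * P"
      by (rule mat_adjoint_congruence[OF P carrier(10) H_hermitian])
    show "mat_adjoint P * H * P * (R * T * P) = - (mat_adjoint (R * T * P) * (mat_adjoint P * H * P))"
    proof -
      have aTH: "mat_adjoint T * H \<in> carrier_mat n n" by simp
      show ?thesis unfolding congruence_similarity[OF carrier(10,7) P R PR] H_skew
        using carrier_matD[OF P] carrier_matD[OF aTH] by simp
    qed
    show "C * P = mat_adjoint (R * B) * (mat_adjoint P * H * P)"
    proof -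
      have "mat_adjoint (R * B) * (mat_adjoint P * H * P) = mat_adjoint B * (mat_adjoint R * mat_adjoint P) * (H * P)"
        by (simp add: mat_adjoint_mult[of _ n n _ p] assoc_mult_mat[of _ p n _ n _ n] assoc_mult_mat[of _ n n _ n _ n])
      then show ?thesis unfolding aRP by (simp add: C_eq right_mult_one_mat[of _ p n] assoc_mult_mat[of _ p n _ n _ n])
    qed
    show "\<exists>X Y. X \<in> carrier_mat n n \<and> Y \<in> carrier_mat n p \<and>
        const_mat (mat_adjoint P * H * P) = Y * const_mat (C * P) + X * pencil (R * T * P)"
    proof -
      obtain X Y where X [simp]: "X \<in> carrier_mat n n" and Y [simp]: "Y \<in> carrier_mat n p"
        and HXY: "const_mat H = Y * const_mat C + X * pencil T" using observable by blast
      define aP where "aP = const_mat (mat_adjoint P)"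
      have [simp]: "aP \<in> carrier_mat n n" by (simp add: aP_def)
      have "const_mat (mat_adjoint P * H * P) = aP * (const_mat H * cP)"
        by (simp add: const_mat_mult[of _ n n _ n] aP_def cP_def assoc_mult_mat[of _ n n _ n _ n])
      also have "\<dots> = aP * Y * (const_mat C * cP) + aP * X * (pencil T * cP)"
        unfolding HXY
        by (simp add: add_mult_distrib_mat[of _ n n _ _ n] mult_add_distrib_mat[of _ n n _ n]
           assoc_mult_mat[of _ n n _ n _ n] assoc_mult_mat[of _ n n _ p _ n] assoc_mult_mat[of _ n p _ n _ n])
      also have "aP * X * (pencil T * cP) = aP * X * cP * pencil (R * T * P)"
        unfolding pen by (subst cancel[of _ n _ n]) simp_all
      finally show ?thesis
        by (intro exI[of _ "aP * X * cP"] exI[of _ "aP * Y"]) (simp add: const_mat_mult[OF carrier(9) P] cP_def)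
    qed
    fix W x
    assume W: "\<And>y. W y \<Longrightarrow> y \<in> carrier_vec n \<and> C * P *\<^sub>v y = 0\<^sub>v p \<and> W (R * T * P *\<^sub>v y)" and x: "W x"
    \<comment> \<open>The invariant set is transported by \<open>P\<close>; its invariance under
      \<open>T\<close> uses \<open>P * (R * T * P) = T * P\<close>.\<close>
    have "H *\<^sub>v (P *\<^sub>v x) = 0\<^sub>v n"
    proof (rule unobservable_kernel[of "\<lambda>z. \<exists>y. W y \<and> z = P *\<^sub>v y"])
      fix z assume "\<exists>y. W y \<and> z = P *\<^sub>v y"
      then obtain y where y: "W y" "z = P *\<^sub>v y" by blast
      note y' = W[OF y(1)]
      have yc [simp]: "y \<in> carrier_vec n" using y' by simp
      have [simp]: "P *\<^sub>v y \<in> carrier_vec n" "T *\<^sub>v (P *\<^sub>v y) \<in> carrier_vec n"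
        using mult_mat_vec_carrier[OF P yc] mult_mat_vec_carrier[OF carrier(7) mult_mat_vec_carrier[OF P yc]] by auto
      have "P *\<^sub>v (R * T * P *\<^sub>v y) = (P * R) *\<^sub>v (T *\<^sub>v (P *\<^sub>v y))"
        by (simp add: assoc_mult_mat_vec[of _ n n _ n])
      also have "\<dots> = T *\<^sub>v (P *\<^sub>v y)" unfolding PR using one_mult_mat_vec[of "T *\<^sub>v (P *\<^sub>v y)" n]
        by (simp add: mult_mat_vec_carrier[of _ n n])
      finally have "T *\<^sub>v z = P *\<^sub>v (R * T * P *\<^sub>v y)" by (simp add: y(2))
      then show "z \<in> carrier_vec n \<and> C *\<^sub>v z = 0\<^sub>v p \<and> (\<exists>y. W y \<and> T *\<^sub>v z = P *\<^sub>v y)"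
        using y y' by (auto simp: assoc_mult_mat_vec[of _ p n _ n])
    qed (use x in blast)
    moreover have xc: "x \<in> carrier_vec n" using W[OF x] by simp
    ultimately show "mat_adjoint P * H * P *\<^sub>v x = 0\<^sub>v n"
      by (simp add: assoc_mult_mat_vec[of _ n n _ n] mult_mat_vec_carrier[of _ n n])
        (intro eq_vecI, auto simp: scalar_prod_def carrier_matD[OF P])
  qed (simp_all add: degree_det_D degree_det_F)
qed

text \<open>Skewness cancels the two terms with \<open>T\<close>. As
  \<open>mat_adjoint C = H * B\<close>, each of the two feedback terms contributes
  \<open>- (mat_adjoint C * C)\<close>.\<close>

lemma lyapunov_A: "H * A + mat_adjoint A * H =
    - (mat_adjoint (complex_of_real (sqrt 2) \<cdot>\<^sub>m C) * (complex_of_real (sqrt 2) \<cdot>\<^sub>m C))"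
proof -
  note [simp] = mult_carrier_mat[of _ n n _ n] mult_carrier_mat[of _ n p _ n] mult_carrier_mat[of _ n n _ p]
  have aC: "mat_adjoint C = H * B"
    unfolding C_eq by (simp add: mat_adjoint_mult[of _ p n _ n] H_hermitian)
  define K where "K = mat_adjoint C * C"
  have K: "K \<in> carrier_mat n n" unfolding K_def by simp
  have 1: "H * A = H * T - K"
    unfolding A_def K_def aC by (simp add: mult_minus_distrib_mat[of _ n n _ n] assoc_mult_mat[of _ n n _ p _ n])
  have "mat_adjoint A * H = mat_adjoint T * H - mat_adjoint (B * C) * H"
    unfolding A_def by (simp add: mat_adjoint_minus[of _ n n] minus_mult_distrib_mat[of _ n n _ _ n])
  also have "mat_adjoint (B * C) * H = K"
    unfolding K_def by (simp add: mat_adjoint_mult[of _ n p _ n] assoc_mult_mat[of _ n p _ n _ n] C_eq[symmetric])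
  finally have 2: "mat_adjoint A * H = mat_adjoint T * H - K" .
  have 3: "mat_adjoint (complex_of_real (sqrt 2) \<cdot>\<^sub>m C) * (complex_of_real (sqrt 2) \<cdot>\<^sub>m C) = 2 \<cdot>\<^sub>m K"
    unfolding K_def by (rule adjoint_sqrt2_mult)
  define L where "L = mat_adjoint T * H"
  have L: "L \<in> carrier_mat n n" by (simp add: L_def)
  show ?thesis unfolding 1 2 H_skew 3 L_def[symmetric] using K L by (intro eq_matI) auto
qed

text \<open>
  \<open>det_G_dvd\<close> shows that the characteristic polynomial of \<open>T\<close> on the kernel of \<open>H\<close> divides \<open>det G\<close>, and
  \<open>det_D1_block\<close>, with \<open>Z\<close> the projection onto that kernel, that \<open>det G\<close> has no larger degree.
\<close>

lemma normal_form_main: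
  assumes n: "n = k + r" and Lam: "Lam \<in> carrier_mat r r" "det Lam \<noteq> 0"
    and Hb: "H = four_block_mat (0\<^sub>m k k) (0\<^sub>m k r) (0\<^sub>m r k) Lam"
    and G: "G \<in> carrier_mat p p" "D1 \<in> carrier_mat p p" "S1 \<in> carrier_mat p p" "D = D1 * G" "S = S1 * G"
    and XY: "X \<in> carrier_mat p p" "Y \<in> carrier_mat p p" "G = X * S + Y * D"
  obtains A1 C1 where "lyapunov r p Lam A1 C1" "det G \<noteq> 0" "degree (det G) = k"
    "lhp (det (D + S)) = lhp (char_poly A1) + lhp (det G)"
    "rhp (det (D + S)) = rhp (char_poly A1) + rhp (det G)"
    "iax (det (D + S)) = iax (char_poly A1) + iax (det G)"
proof -
  obtain T2 T12 T21 T1 where Tb: "T = four_block_mat T2 T12 T21 T1" "T2 \<in> carrier_mat k k" "T12 \<in> carrier_mat k r"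
      "T21 \<in> carrier_mat r k" "T1 \<in> carrier_mat r r"
    using carrier(7) unfolding n by (elim mat_four_blockE)
  obtain Li where Li: "Li \<in> carrier_mat r r" "Lam * Li = 1\<^sub>m r" "Li * Lam = 1\<^sub>m r"
    using det_nonzero_inverseE[OF Lam] by blast
  \<comment> \<open>Skewness of \<open>T\<close> makes the kernel of \<open>H\<close> invariant
    under \<open>T\<close>.\<close>
  have T21: "T21 = 0\<^sub>m r k"
  proof -
    have 1: "H * T = four_block_mat (0\<^sub>m k k) (0\<^sub>m k r) (Lam * T21) (Lam * T1)"
      unfolding Hb Tb(1) using Lam Tb
      by (subst mult_four_block_mat[of _ k k _ r _ r _ _ k _ r]) (auto intro!: cong_four_block_mat)
    have 2: "mat_adjoint T * H = four_block_mat (0\<^sub>m k k) (mat_adjoint T21 * Lam) (0\<^sub>m r k) (mat_adjoint T1 * Lam)"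
      unfolding Hb Tb(1) using Lam Tb
      by (subst mat_adjoint_four_block[of _ k k _ r _ r], simp_all,
          subst mult_four_block_mat[of _ k k _ r _ r _ _ k _ r]) (auto intro!: cong_four_block_mat)
    have 3: "- (mat_adjoint T * H) = four_block_mat (0\<^sub>m k k) (- (mat_adjoint T21 * Lam)) (0\<^sub>m r k) (- (mat_adjoint T1 * Lam))"
      unfolding 2 using Lam Tb by (intro eq_matI) auto
    have e: "four_block_mat (0\<^sub>m k k) (0\<^sub>m k r) (Lam * T21) (Lam * T1) =
      four_block_mat (0\<^sub>m k k) (- (mat_adjoint T21 * Lam)) (0\<^sub>m r k) (- (mat_adjoint T1 * Lam))"
      using H_skew unfolding 1 3 .
    have "Lam * T21 = 0\<^sub>m r k"
      by (rule four_block_matD(3)[OF e, of k k r r]; use Lam Tb in \<open>auto intro!: mult_carrier_mat\<close>)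
    then have "Li * (Lam * T21) = 0\<^sub>m r k" using Li by simp
    then have "(Li * Lam) * T21 = 0\<^sub>m r k" using assoc_mult_mat[OF Li(1) Lam(1) Tb(4)] by simp
    then show ?thesis unfolding Li(3) using Tb by simp
  qed
  note Tb1 = Tb(1)[unfolded T21]
  \<comment> \<open>\<open>C = mat_adjoint B * H\<close> vanishes on the kernel of
    \<open>H\<close>.\<close>
  obtain C1 where Cb: "C = append_cols (0\<^sub>m p k) C1" "C1 \<in> carrier_mat p r"
  proof -
    obtain b2 b1 where b: "mat_adjoint B = append_cols b2 b1" "b2 \<in> carrier_mat p k" "b1 \<in> carrier_mat p r"
      using mat_adjoint_carrier[OF carrier(8)] unfolding n by (elim mat_append_colsE)
    have "C = append_cols (0\<^sub>m p k) (b1 * Lam)"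
      unfolding C_eq b(1) Hb using b Lam
      by (subst append_cols_mult_four_block[of _ p k _ r _ k _ r]) auto
    then show thesis using that b Lam by auto
  qed
  have pTb: "pencil T = four_block_mat (pencil T2) (- const_mat T12) (0\<^sub>m r k) (pencil T1)"
    unfolding Tb1 by (rule pencil_four_block[OF Tb(2,3,5)])
  have chT: "char_poly T = char_poly T2 * char_poly T1"
    unfolding Tb1 using Tb by (intro char_poly_four_block_lower_left_zero)
  \<comment> \<open>The projection onto the kernel restores the upper block of the pencil while the
    lower diagonal block is the invertible \<open>Lam\<close>, so the determinant is a constant
    multiple of \<open>char_poly T2\<close>.\<close>
  define Z where "Z = four_block_mat (1\<^sub>m k) (0\<^sub>m k r) (0\<^sub>m r k) (0\<^sub>m r r :: complex mat)"
  have Z: "Z \<in> carrier_mat n n" by (simp add: Z_def n)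
  have HZ: "const_mat H + const_mat Z * pencil T =
      four_block_mat (pencil T2) (- const_mat T12) (0\<^sub>m r k) (const_mat Lam)"
  proof -
    have "const_mat Z * pencil T = four_block_mat (pencil T2) (- const_mat T12) (0\<^sub>m r k) (0\<^sub>m r r)"
      unfolding pTb Z_def using Tb
      by (subst const_mat_four_block[of _ k k _ r _ r], simp_all,
          subst mult_four_block_mat[of _ k k _ r _ r _ _ k _ r])
        (auto intro!: cong_four_block_mat simp: left_mult_zero_mat[of _ r r] left_mult_zero_mat[of _ r k]
          left_mult_zero_mat[of _ k r] left_mult_zero_mat[of _ k k] left_mult_one_mat[of _ k k] left_mult_one_mat[of _ k r]
          right_add_zero_mat[of _ k k] right_add_zero_mat[of _ k r])
    then show ?thesis unfolding Hb using Lam Tb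
      by (subst const_mat_four_block[of _ k k _ r _ r], simp_all,
          subst add_four_block_mat[of _ k k _ r _ r])
       (auto intro!: cong_four_block_mat simp: left_add_zero_mat[of _ k k] left_add_zero_mat[of _ k r])
  qed
  obtain f where f: "f * char_poly T = det (const_mat H + const_mat Z * pencil T) * det D1"
    using det_D1_block[OF G Z] by blast
  have detHZ: "det (const_mat H + const_mat Z * pencil T) = smult (det Lam) (char_poly T2)"
    unfolding HZ using Tb Lam
    by (subst det_four_block_mat_lower_left_zero[of _ k _ r]) (auto simp: det_const_mat char_poly_def)
  have nz: "char_poly T \<noteq> 0" "char_poly T2 \<noteq> 0" using char_poly_nonzero[OF carrier(7)] char_poly_nonzero[OF Tb(2)] by auto
  obtain u where u: "u \<noteq> 0" "char_poly T = smult u (det D)"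
    using det_fraction[OF carrier(7,8,1,3,5,6) E_pencil E_B degree_det_D] by metis
  have dD: "det D \<noteq> 0" using u nz by auto
  have DG: "det D = det D1 * det G" unfolding G(4) by (rule det_mult[OF G(2,1)])
  then have nzG: "det G \<noteq> 0" "det D1 \<noteq> 0" using dD by auto
  have eq: "f * char_poly T = smult (det Lam) (char_poly T2) * det D1" using f unfolding detHZ .
  then have "f \<noteq> 0" using Lam nz nzG by auto
  \<comment> \<open>Dropping \<open>degree f\<close> leaves an inequality: \<open>det D1\<close> has
    degree at least \<open>n - k\<close>, hence \<open>det G\<close> at most
    \<open>k\<close>.\<close>
  then have "degree f + n = k + degree (det D1)"
    using arg_cong[OF eq, of degree] Lam nz nzG degree_monic_char_poly[OF carrier(7)] degree_monic_char_poly[OF Tb(2)]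
    by (simp add: degree_mult_eq)
  moreover have "n = degree (det D1) + degree (det G)"
    using arg_cong[OF DG, of degree] nzG degree_det_D by (simp add: degree_mult_eq)
  ultimately have degG: "degree (det G) \<le> k" by linarith
  have "char_poly T2 dvd det G"
  proof -
    obtain w where w: "w \<noteq> 0" "smult w (det G) = det (four_block_mat (pencil T) (const_mat B) (- (X * const_mat C)) Y)"
      using det_G_dvd[OF G(1) XY] by blast
    \<comment> \<open>The pencil factors as \<open>?L * ?D\<close> with
      \<open>det ?D = char_poly T2\<close>. The first \<open>k\<close> columns of \<open>C\<close>
      are zero, so \<open>?D\<close> can also be pulled out of the block \<open>- X C\<close> of the
      bordered matrix.\<close>
    let ?L = "four_block_mat (1\<^sub>m k) (- const_mat T12) (0\<^sub>m r k) (pencil T1)"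
    let ?D = "four_block_mat (pencil T2) (0\<^sub>m k r) (0\<^sub>m r k) (1\<^sub>m r)"
    have L: "?L \<in> carrier_mat n n" and D: "?D \<in> carrier_mat n n" unfolding n using Tb by (intro four_block_carrier_mat; simp)+
    have nT12: "- const_mat T12 \<in> carrier_mat k r" using Tb by simp
    have LD: "?L * ?D = pencil T"
      unfolding pTb using Tb nT12
      by (subst mult_four_block_mat[of _ k k _ r _ r _ _ k _ r])
       (auto intro!: cong_four_block_mat simp: left_mult_zero_mat[of _ r r] left_mult_zero_mat[of _ r k]
          left_mult_one_mat[of _ k k] right_mult_one_mat[of _ k r] right_mult_one_mat[of _ r r] right_mult_zero_mat[of _ r r]
          right_mult_zero_mat[of _ k r] right_add_zero_mat[of _ k k] left_add_zero_mat[of _ k r] left_add_zero_mat[of _ r r]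
          left_mult_zero_mat[of _ k k]
          simp del: uminus_mult_left_mat)
    have cC: "const_mat C \<in> carrier_mat p n" by simp
    have CD: "const_mat C * ?D = const_mat C"
      unfolding Cb(1) using Cb Tb
      by (subst (1 2) const_mat_append_cols[of _ p k _ r], simp_all,
          subst append_cols_mult_four_block[of _ p k _ r _ k _ r])
        (auto simp: left_mult_zero_mat[of _ k k] right_mult_one_mat[of _ p r] left_add_zero_mat[of _ p r])
    have XC: "- (X * const_mat C) \<in> carrier_mat p n" using mult_carrier_mat[OF XY(1) cC] by simp
    let ?M1 = "four_block_mat ?L (const_mat B) (- (X * const_mat C)) Y"
    let ?M2 = "four_block_mat ?D (0\<^sub>m n p) (0\<^sub>m p n) (1\<^sub>m p)"
    have M1: "?M1 \<in> carrier_mat (n + p) (n + p)" and M2: "?M2 \<in> carrier_mat (n + p) (n + p)"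
      using L D XY by (intro four_block_carrier_mat; simp)+
    have XCD: "- (X * const_mat C) * ?D = - (X * const_mat C)"
      using assoc_mult_mat[OF XY(1) cC D] CD carrier_matD[OF cC] carrier_matD[OF D] by simp
    have cB: "const_mat B \<in> carrier_mat n p" by simp
    have "?M1 * ?M2 = four_block_mat (pencil T) (const_mat B) (- (X * const_mat C)) Y"
      using XY
      by (subst mult_four_block_mat[OF L cB XC XY(2) D zero_carrier_mat zero_carrier_mat one_carrier_mat])
        (auto intro!: cong_four_block_mat simp: LD XCD right_mult_zero_mat[OF L] right_mult_zero_mat[OF cB] right_mult_zero_mat[OF XY(2)]
          right_mult_one_mat[OF cB] right_mult_one_mat[OF XY(2)] right_mult_zero_mat[OF XC]
          right_add_zero_mat[OF pencil_T] left_add_zero_mat[OF cB] right_add_zero_mat[OF XC] left_add_zero_mat[OF XY(2)]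
          simp del: uminus_mult_left_mat)
    then have "det ?M1 * det ?M2 = smult w (det G)" using w by (simp add: det_mult[OF M1 M2, symmetric])
    moreover have "det ?M2 = det ?D" using D by (subst det_four_block_mat_upper_right_zero[of _ n _ p]) auto
    moreover have "det ?D = char_poly T2"
      using Tb by (subst det_four_block_mat_upper_right_zero[of _ k _ r]) (auto simp: char_poly_def)
    ultimately have "char_poly T2 dvd smult w (det G)" by (metis dvd_triv_right)
    then show ?thesis using w(1) by (rule dvd_smult_cancel)
  qed
  then obtain g where g: "det G = char_poly T2 * g" by auto
  have "degree (det G) = k + degree g"
    using g nzG degree_monic_char_poly[OF Tb(2)] by (metis degree_mult_eq mult_zero_left mult_zero_right)
  with degG have degGk: "degree (det G) = k" and "degree g = 0" by auto
  then obtain g0 where g0: "g = [:g0:]" by (metis degree_eq_zeroE)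
  have g00: "g0 \<noteq> 0" using g nzG g0 by auto
  have detG: "det G = smult g0 (char_poly T2)" using g g0 by (simp add: mult.commute)
  obtain A2 A12 A21 A1 where Ab: "A = four_block_mat A2 A12 A21 A1" "A2 \<in> carrier_mat k k" "A12 \<in> carrier_mat k r"
      "A21 \<in> carrier_mat r k" "A1 \<in> carrier_mat r r"
    using A_carrier unfolding n by (elim mat_four_blockE)
  have Aij: "A $$ (i, j) = T $$ (i, j)" if "i < n" "j < k" for i j
  proof -
    have "col C j = 0\<^sub>v p" using Cb that by (intro eq_vecI) (auto simp: col_def)
    moreover have "j < n" using that n by simp
    ultimately have "(B * C) $$ (i, j) = row B i \<bullet> 0\<^sub>v p"
      using that carrier_matD[OF carrier(8)] carrier_matD[OF carrier(9)] by simp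
    also have "\<dots> = 0" using carrier_matD[OF carrier(8)] by (simp add: scalar_prod_def)
    finally show ?thesis unfolding A_def using that \<open>j < n\<close> carrier_matD[OF BC] by simp
  qed
  have A2: "A2 = T2"
  proof (rule eq_matI)
    fix i j assume "i < dim_row T2" "j < dim_col T2"
    then show "A2 $$ (i, j) = T2 $$ (i, j)" using Aij[of i j] Ab Tb by (simp add: n)
  qed (use Ab Tb in auto)
  have A21: "A21 = 0\<^sub>m r k"
  proof (rule eq_matI)
    fix i j assume "i < dim_row (0\<^sub>m r k)" "j < dim_col (0\<^sub>m r k)"
    then show "A21 $$ (i, j) = 0\<^sub>m r k $$ (i, j)" using Aij[of "i + k" j] Ab Tb T21 by (simp add: n)
  qed (use Ab in auto)
  note Ab1 = Ab(1)[unfolded A21]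
  define c where "c = complex_of_real (sqrt 2)"
  define C2 where "C2 = c \<cdot>\<^sub>m C1"
  have C2: "C2 \<in> carrier_mat p r" using Cb by (simp add: C2_def)
  have cC: "c \<cdot>\<^sub>m C = append_cols (0\<^sub>m p k) C2" unfolding Cb(1) C2_def using Cb by (intro eq_matI) auto
  note blk = lyapunov_block[OF H_hermitian[unfolded Hb] lyapunov_A[unfolded Hb Ab1 c_def[symmetric] cC]
      zero_carrier_mat Lam(1) Ab(2,3,5) zero_carrier_mat C2]
  have "lyapunov r p Lam A1 C2"
    unfolding lyapunov_def
  proof (intro conjI allI impI)
    fix v a assume v: "v \<in> carrier_vec r" and e: "A1 *\<^sub>v v = a \<cdot>\<^sub>v v" and z: "C2 *\<^sub>v v = 0\<^sub>v p"
    have "c \<cdot>\<^sub>v (C1 *\<^sub>v v) = 0\<^sub>v p" using z Cb v unfolding C2_def by (simp add: vec_eq_iff)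
    then have C1v: "C1 *\<^sub>v v = 0\<^sub>v p" using Cb by (auto simp: vec_eq_iff c_def)
    have T1v: "T1 *\<^sub>v v = a \<cdot>\<^sub>v v"
    proof -
      have v0: "0\<^sub>v k @\<^sub>v v \<in> carrier_vec n" using v n by auto
      have C0v: "C *\<^sub>v (0\<^sub>v k @\<^sub>v v) = 0\<^sub>v p"
        unfolding Cb(1) using Cb v C1v by (subst append_cols_mult_vec[of _ p k _ r]) (auto simp: scalar_prod_def intro!: eq_vecI)
      have "A *\<^sub>v (0\<^sub>v k @\<^sub>v v) = T *\<^sub>v (0\<^sub>v k @\<^sub>v v) - B *\<^sub>v (C *\<^sub>v (0\<^sub>v k @\<^sub>v v))"
        unfolding A_def using v0
        by (simp add: minus_mult_distrib_mat_vec[of _ n n] assoc_mult_mat_vec[of _ n p _ n])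
      also have "\<dots> = T *\<^sub>v (0\<^sub>v k @\<^sub>v v)"
        unfolding C0v using v0 mult_mat_vec_carrier[OF carrier(7) v0] carrier_matD[OF carrier(8)] carrier_matD[OF carrier(7)]
        by (intro eq_vecI) (auto simp: scalar_prod_def[of _ "0\<^sub>v p"])
      finally have "A *\<^sub>v (0\<^sub>v k @\<^sub>v v) = T *\<^sub>v (0\<^sub>v k @\<^sub>v v)" .
      moreover have "A *\<^sub>v (0\<^sub>v k @\<^sub>v v) = (A2 *\<^sub>v 0\<^sub>v k + A12 *\<^sub>v v) @\<^sub>v (0\<^sub>m r k *\<^sub>v 0\<^sub>v k + A1 *\<^sub>v v)"
        unfolding Ab1 using Ab v by (subst four_block_mat_mult_vec[of _ k k _ r _ r]) auto
      moreover have "T *\<^sub>v (0\<^sub>v k @\<^sub>v v) = (T2 *\<^sub>v 0\<^sub>v k + T12 *\<^sub>v v) @\<^sub>v (0\<^sub>m r k *\<^sub>v 0\<^sub>v k + T1 *\<^sub>v v)"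
        unfolding Tb1 using Tb v by (subst four_block_mat_mult_vec[of _ k k _ r _ r]) auto
      moreover have "A2 *\<^sub>v 0\<^sub>v k + A12 *\<^sub>v v \<in> carrier_vec k" "T2 *\<^sub>v 0\<^sub>v k + T12 *\<^sub>v v \<in> carrier_vec k"
        using Ab Tb v by auto
      ultimately have "0\<^sub>m r k *\<^sub>v 0\<^sub>v k + A1 *\<^sub>v v = 0\<^sub>m r k *\<^sub>v 0\<^sub>v k + T1 *\<^sub>v v"
        using append_vec_eq by metis
      moreover have "0\<^sub>m r k *\<^sub>v 0\<^sub>v k = (0\<^sub>v r :: complex vec)" by (intro eq_vecI) auto
      ultimately show ?thesis using Ab Tb v e by simp
    qed
    \<comment> \<open>Arbitrary kernel vectors must be added to the multiples of \<open>v\<close>: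
      \<open>T\<close> maps \<open>(0, v)\<close> to \<open>a (0, v)\<close> only up to an upper
      part coming from \<open>T12\<close>.\<close>
    define W where "W = (\<lambda>y. \<exists>x b. x \<in> carrier_vec k \<and> y = x @\<^sub>v (b \<cdot>\<^sub>v v))"
    have "H *\<^sub>v (0\<^sub>v k @\<^sub>v v) = 0\<^sub>v n"
    proof (rule unobservable_kernel[of W])
      show "W (0\<^sub>v k @\<^sub>v v)" unfolding W_def by (intro exI[of _ "0\<^sub>v k"] exI[of _ 1]) auto
      fix y assume "W y"
      then obtain x b where y: "x \<in> carrier_vec k" "y = x @\<^sub>v (b \<cdot>\<^sub>v v)" by (auto simp: W_def)
      have "C *\<^sub>v y = 0\<^sub>v p"
        unfolding Cb(1) y(2) using Cb v C1v y
        by (subst append_cols_mult_vec[of _ p k _ r]) (auto simp: mult_mat_vec[of _ p r] intro!: eq_vecI)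
      moreover have "T *\<^sub>v y = (T2 *\<^sub>v x + T12 *\<^sub>v (b \<cdot>\<^sub>v v)) @\<^sub>v (0\<^sub>m r k *\<^sub>v x + T1 *\<^sub>v (b \<cdot>\<^sub>v v))"
        unfolding Tb1 y(2) using Tb v y by (subst four_block_mat_mult_vec[of _ k k _ r _ r]) auto
      moreover have "0\<^sub>m r k *\<^sub>v x + T1 *\<^sub>v (b \<cdot>\<^sub>v v) = (b * a) \<cdot>\<^sub>v v"
        using Tb v y by (auto simp: mult_mat_vec[of _ r r] T1v smult_smult_assoc)
      moreover have "T2 *\<^sub>v x + T12 *\<^sub>v (b \<cdot>\<^sub>v v) \<in> carrier_vec k" using Tb y v by auto
      moreover have "y \<in> carrier_vec n" using y v n by auto
      ultimately show "y \<in> carrier_vec n \<and> C *\<^sub>v y = 0\<^sub>v p \<and> W (T *\<^sub>v y)"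
        unfolding W_def by metis
    qed
    moreover have "H *\<^sub>v (0\<^sub>v k @\<^sub>v v) = 0\<^sub>v k @\<^sub>v (Lam *\<^sub>v v)"
      unfolding Hb using Lam v by (subst four_block_mat_mult_vec[of _ k k _ r _ r]) (auto simp: scalar_prod_def intro!: eq_vecI)
    moreover have "0\<^sub>v n = 0\<^sub>v k @\<^sub>v (0\<^sub>v r :: complex vec)" using n by auto
    ultimately have "0\<^sub>v k @\<^sub>v (Lam *\<^sub>v v) = 0\<^sub>v k @\<^sub>v 0\<^sub>v r" by simp
    then have "Lam *\<^sub>v v = 0\<^sub>v r" by (subst (asm) append_vec_eq[of _ k]) auto
    then show "v = 0\<^sub>v r" using det_0_iff_vec_prod_zero_field[OF Lam(1)] Lam(2) v by blast
  qed (use Lam Ab C2 blk in auto)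
  moreover obtain u' where u': "u' \<noteq> 0" "char_poly A = smult u' (det (D + S))" using det_F by blast
  moreover have "char_poly A = char_poly T2 * char_poly A1"
    unfolding Ab1 A2 by (rule char_poly_four_block_lower_left_zero[OF Tb(2) Ab(3,5)])
  moreover have "det (D + S) = smult (1 / u') (char_poly A)" using u' by simp
  ultimately show thesis
    using that[of A1 C2] nzG degGk detG g00 root_count_mult[OF nz(2) char_poly_nonzero[OF Ab(5)]]
    by (simp add: root_count_smult add.commute)
qed

end

lemma degree_eq_root_count: "degree f = lhp f + rhp f + iax f"
proof -
  have "size P = size (filter_mset (\<lambda>z. Re z < 0) P) + size (filter_mset (\<lambda>z. Re z > 0) P) + size (filter_mset (\<lambda>z. Re z = 0) P)" for P
    by (induction P) auto
  from this[of "proots f"] show ?thesis by (simp add: size_proots_complex lhp_def rhp_def iax_def)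
qed

text \<open>After the kernel is split off, \<open>Lam\<close> solves a Lyapunov equation for the
  feedback matrix on the quotient, and \<open>- Lam\<close> one for a matrix carrying the nonzero
  eigenvalues of \<open>H\<close>. The opposite signs explain why zeros of
  \<open>det (D + S)\<close> in the left half-plane match eigenvalues of \<open>H\<close> in the
  right one; the kernel contributes \<open>det G\<close>.\<close>

theorem (in realization) root_count_main:
  assumes G: "G \<in> carrier_mat p p" "D1 \<in> carrier_mat p p" "S1 \<in> carrier_mat p p" "D = D1 * G" "S = S1 * G"
    and XY: "X \<in> carrier_mat p p" "Y \<in> carrier_mat p p" "G = X * S + Y * D"
  shows "lhp (det (D + S)) = rhp (char_poly H) + lhp (det G)"
    "rhp (det (D + S)) = lhp (char_poly H) + rhp (det G)"
    "iax (det (D + S)) = iax (det G)"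
    "iax (char_poly H) = degree (det G)"
proof -
  obtain P k r Lam where P: "P \<in> carrier_mat n n" "det P \<noteq> 0" and n: "n = k + r" and Lam: "Lam \<in> carrier_mat r r" "det Lam \<noteq> 0"
    and split: "mat_adjoint P * H * P = four_block_mat (0\<^sub>m k k) (0\<^sub>m k r) (0\<^sub>m r k) Lam"
    using hermitian_split[OF carrier(10) H_hermitian] by blast
  obtain R where R: "R \<in> carrier_mat n n" "P * R = 1\<^sub>m n" using det_nonzero_inverseE[OF P] by blast
  interpret t: realization p n D S "E * const_mat P" "M * const_mat P" "Q * const_mat P" Q' "R * T * P" "R * B" "C * P"
    "mat_adjoint P * H * P"
    by (rule transform[OF P(1) R])
  obtain A1 C1 where 1: "lyapunov r p Lam A1 C1" "det G \<noteq> 0" "degree (det G) = k"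
    "lhp (det (D + S)) = lhp (char_poly A1) + lhp (det G)"
    "rhp (det (D + S)) = rhp (char_poly A1) + rhp (det G)"
    "iax (det (D + S)) = iax (char_poly A1) + iax (det G)"
    by (rule t.normal_form_main[OF n Lam split G XY])
  have hLam: "mat_adjoint Lam = Lam" using 1(1) by (simp add: lyapunov_def)
  obtain A2 C2 where 2: "lyapunov r n (- Lam) A2 C2" "lhp (char_poly H) = lhp (char_poly A2)"
    "rhp (char_poly H) = rhp (char_poly A2)" "iax (char_poly H) = k"
    by (rule hermitian_split_inertia[OF carrier(10) n P(1) R Lam hLam split])
  have "lhp (char_poly A1) = rhp (char_poly A2)" by (rule lyapunov_opposite_lhp[OF 1(1) 2(1)])
  moreover have "lhp (char_poly A2) = rhp (char_poly A1)"
    by (rule lyapunov_opposite_lhp[OF 2(1)]) (use 1(1) in simp)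
  moreover have "iax (char_poly A1) = 0" by (rule lyapunov_iax[OF 1(1)])
  ultimately show "lhp (det (D + S)) = rhp (char_poly H) + lhp (det G)"
    "rhp (det (D + S)) = lhp (char_poly H) + rhp (det G)"
    "iax (det (D + S)) = iax (det G)" "iax (char_poly H) = degree (det G)"
    using 1 2 by simp_all
qed

section \<open>Greatest common divisors of matrices and the Bezout identity\<close>

text \<open>
  Column \<open>k\<close> of \<open>L\<close> is an element of the column module of \<open>A\<close> and \<open>B\<close> that vanishes above row \<open>k\<close> and
  has a nonzero entry of least degree in row \<open>k\<close>.
\<close>

lemma column_gcd:
  fixes A B :: "complex poly mat"
  assumes A: "A \<in> carrier_mat p p" and B: "B \<in> carrier_mat p p" and dB: "det B \<noteq> 0"
  obtains L X Y U V where "L \<in> carrier_mat p p" "X \<in> carrier_mat p p" "Y \<in> carrier_mat p p"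
    "U \<in> carrier_mat p p" "V \<in> carrier_mat p p" "L = A * X + B * Y" "A = L * U" "B = L * V"
proof -
  define mem where "mem v \<longleftrightarrow> (\<exists>a\<in>carrier_vec p. \<exists>b\<in>carrier_vec p. v = A *\<^sub>v a + B *\<^sub>v b)" for v
  have mem_carrier: "v \<in> carrier_vec p" if "mem v" for v
    using that A B unfolding mem_def by auto
  have mem_reduce: "mem (v - q \<cdot>\<^sub>v w)" if v: "mem v" and w: "mem w" for v w q
  proof -
    obtain a b where v': "a \<in> carrier_vec p" "b \<in> carrier_vec p" "v = A *\<^sub>v a + B *\<^sub>v b" using v mem_def by auto
    obtain a' b' where w': "a' \<in> carrier_vec p" "b' \<in> carrier_vec p" "w = A *\<^sub>v a' + B *\<^sub>v b'" using w mem_def by auto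
    have "v - q \<cdot>\<^sub>v w = A *\<^sub>v (a - q \<cdot>\<^sub>v a') + B *\<^sub>v (b - q \<cdot>\<^sub>v b')"
    proof (rule eq_vecI)
      fix i assume "i < dim_vec (A *\<^sub>v (a - q \<cdot>\<^sub>v a') + B *\<^sub>v (b - q \<cdot>\<^sub>v b'))"
      then have i: "i < p" using B by simp
      have rows: "row A i \<in> carrier_vec p" "row B i \<in> carrier_vec p" using A B i by auto
      show "(v - q \<cdot>\<^sub>v w) $ i = (A *\<^sub>v (a - q \<cdot>\<^sub>v a') + B *\<^sub>v (b - q \<cdot>\<^sub>v b')) $ i"
        using i A B v' w' rows
        by (simp add: scalar_prod_minus_distrib[of _ p] algebra_simps)
    qed (use v' w' A B in auto)
    then show ?thesis unfolding mem_def using v' w' by (intro bexI[of _ "a - q \<cdot>\<^sub>v a'"] bexI[of _ "b - q \<cdot>\<^sub>v b'"]) auto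
  qed
  \<comment> \<open>The adjugate puts \<open>det B\<close> times each unit vector into the column
    module, so a candidate exists for every row.\<close>
  have mem_det: "mem (det B \<cdot>\<^sub>v unit_vec p k)" if k: "k < p" for k
  proof -
    have "B *\<^sub>v col (adj_mat B) k = col (B * adj_mat B) k"
      using adj_mat(1)[OF B] B k by (subst col_mult2[of _ p p _ p]) auto
    also have "\<dots> = det B \<cdot>\<^sub>v unit_vec p k" unfolding adj_mat(2)[OF B] using k by (intro eq_vecI) auto
    finally have "det B \<cdot>\<^sub>v unit_vec p k = A *\<^sub>v 0\<^sub>v p + B *\<^sub>v col (adj_mat B) k"
      using A B k by (intro eq_vecI) (auto simp: scalar_prod_def)
    then show ?thesis unfolding mem_def using adj_mat(1)[OF B] k
      by (intro bexI[of _ "0\<^sub>v p"] bexI[of _ "col (adj_mat B) k"]) auto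
  qed
  define cand where "cand k v \<longleftrightarrow> mem v \<and> (\<forall>i<k. v $ i = 0) \<and> v $ k \<noteq> 0" for k v
  have "\<exists>v. cand k v \<and> (\<forall>w. cand k w \<longrightarrow> degree (v $ k) \<le> degree (w $ k))" if k: "k < p" for k
  proof -
    have "cand k (det B \<cdot>\<^sub>v unit_vec p k)" using mem_det[OF k] k dB by (simp add: cand_def)
    then show ?thesis
      using exists_least_iff[of "\<lambda>d. \<exists>v. cand k v \<and> degree (v $ k) = d"]
      by (metis linorder_not_less)
  qed
  then obtain l where l: "\<And>k. k < p \<Longrightarrow> cand k (l k)"
    and l_min: "\<And>k w. k < p \<Longrightarrow> cand k w \<Longrightarrow> degree (l k $ k) \<le> degree (w $ k)"
    by metis
  have lc: "l k \<in> carrier_vec p" if "k < p" for k using l[OF that] mem_carrier by (simp add: cand_def)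
  define L where "L = mat_of_cols p (map l [0..<p])"
  have L: "L \<in> carrier_mat p p" by (simp add: L_def mat_of_cols_def)
  have colL: "col L k = l k" if "k < p" for k
    unfolding L_def using that lc by (subst col_mat_of_cols) auto
  \<comment> \<open>Induction on the number \<open>d\<close> of trailing rows that may be nonzero;
    division with remainder in the first of them clears that row.\<close>
  have gen: "\<exists>c\<in>carrier_vec p. v = L *\<^sub>v c" if "mem v" "\<forall>i<p - d. v $ i = 0" "d \<le> p" for d v
    using that
  proof (induction d arbitrary: v)
    case 0
    then have "v = 0\<^sub>v p" using mem_carrier[of v] by (intro eq_vecI) auto
    then have "v = L *\<^sub>v 0\<^sub>v p" using L by (intro eq_vecI) (auto simp: scalar_prod_def)
    then show ?case by (intro bexI[of _ "0\<^sub>v p"]) auto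
  next
    case (Suc d)
    define k where "k = p - Suc d"
    have k: "k < p" "p - d = Suc k" using Suc.prems by (auto simp: k_def)
    note lk = l[OF k(1), unfolded cand_def]
    define q where "q = v $ k div l k $ k"
    define w where "w = v - q \<cdot>\<^sub>v l k"
    have vc: "v \<in> carrier_vec p" using mem_carrier Suc.prems by blast
    have w: "mem w" unfolding w_def using mem_reduce lk Suc.prems by blast
    have wi: "w $ i = v $ i - q * l k $ i" if "i < p" for i using that vc lc[OF k(1)] by (simp add: w_def)
    have wlow: "\<forall>i<k. w $ i = 0" using Suc.prems(2) lk k by (auto simp: wi k_def)
    have wk: "w $ k = v $ k mod l k $ k" unfolding wi[OF k(1)] q_def by (simp add: minus_div_mult_eq_mod)
    \<comment> \<open>A nonzero remainder would be a candidate of smaller degree than the minimal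
      \<open>l k\<close>.\<close>
    have "w $ k = 0"
    proof (rule ccontr)
      assume nz: "w $ k \<noteq> 0"
      then have "cand k w" using w wlow by (simp add: cand_def)
      then have "degree (l k $ k) \<le> degree (w $ k)" by (rule l_min[OF k(1)])
      moreover have "degree (w $ k) < degree (l k $ k)"
        using degree_mod_less[of "l k $ k" "v $ k"] lk nz unfolding wk by auto
      ultimately show False by simp
    qed
    with wlow have "\<forall>i<p - d. w $ i = 0" by (auto simp: k less_Suc_eq)
    then obtain c where c: "c \<in> carrier_vec p" "w = L *\<^sub>v c" using Suc.IH[OF w] Suc.prems by auto
    have "v = L *\<^sub>v (c + q \<cdot>\<^sub>v unit_vec p k)"
    proof -
      have "L *\<^sub>v (c + q \<cdot>\<^sub>v unit_vec p k) = w + L *\<^sub>v (q \<cdot>\<^sub>v unit_vec p k)"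
        using L c by (simp add: mult_add_distrib_mat_vec[of _ p p])
      also have "L *\<^sub>v (q \<cdot>\<^sub>v unit_vec p k) = q \<cdot>\<^sub>v l k"
        unfolding colL[OF k(1), symmetric] using L k by (intro eq_vecI) auto
      also have "w + q \<cdot>\<^sub>v l k = v" unfolding w_def using vc lc[OF k(1)] by (intro eq_vecI) auto
      finally show ?thesis by simp
    qed
    then show ?case using c by (intro bexI[of _ "c + q \<cdot>\<^sub>v unit_vec p k"]) auto
  qed
  have quot: "\<exists>U\<in>carrier_mat p p. K = L * U" if K: "K \<in> carrier_mat p p" and m: "\<And>k. k < p \<Longrightarrow> mem (col K k)" for K
  proof -
    have "\<exists>c\<in>carrier_vec p. col K k = L *\<^sub>v c" if "k < p" for k
      using gen[OF m[OF that], of p] by simp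
    then obtain c where c: "\<And>k. k < p \<Longrightarrow> c k \<in> carrier_vec p" "\<And>k. k < p \<Longrightarrow> col K k = L *\<^sub>v c k" by metis
    define U where "U = mat_of_cols p (map c [0..<p])"
    have U: "U \<in> carrier_mat p p" by (simp add: U_def mat_of_cols_def)
    have "K = L * U"
    proof (rule mat_col_eqI)
      fix k assume "k < dim_col (L * U)"
      then have k: "k < p" using U by simp
      have "col U k = c k" unfolding U_def using k c by (subst col_mat_of_cols) auto
      then show "col K k = col (L * U) k" using c(2)[OF k] col_mult2[OF L U k] by simp
    qed (use K L U in auto)
    then show ?thesis using U by blast
  qed
  have "mem (col A k)" if "k < p" for k
    unfolding mem_def using that A B
    by (intro bexI[of _ "unit_vec p k"] bexI[of _ "0\<^sub>v p"] eq_vecI) (auto simp: scalar_prod_def[of _ "0\<^sub>v p"])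
  then obtain U where U: "U \<in> carrier_mat p p" "A = L * U" using quot[OF A] by blast
  have "mem (col B k)" if "k < p" for k
    unfolding mem_def using that A B
    by (intro bexI[of _ "unit_vec p k"] bexI[of _ "0\<^sub>v p"] eq_vecI) (auto simp: scalar_prod_def[of _ "0\<^sub>v p"])
  then obtain V where V: "V \<in> carrier_mat p p" "B = L * V" using quot[OF B] by blast
  have "\<exists>a b. a \<in> carrier_vec p \<and> b \<in> carrier_vec p \<and> l k = A *\<^sub>v a + B *\<^sub>v b" if "k < p" for k
    using l[OF that] unfolding cand_def mem_def by blast
  then obtain a b where ab: "\<And>k. k < p \<Longrightarrow> a k \<in> carrier_vec p" "\<And>k. k < p \<Longrightarrow> b k \<in> carrier_vec p"
    "\<And>k. k < p \<Longrightarrow> l k = A *\<^sub>v a k + B *\<^sub>v b k" by metis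
  define X Y where "X = mat_of_cols p (map a [0..<p])" and "Y = mat_of_cols p (map b [0..<p])"
  have XY: "X \<in> carrier_mat p p" "Y \<in> carrier_mat p p" by (simp_all add: X_def Y_def mat_of_cols_def)
  have "L = A * X + B * Y"
  proof (rule mat_col_eqI)
    fix k assume "k < dim_col (A * X + B * Y)"
    then have k: "k < p" using XY by simp
    have "col X k = a k" "col Y k = b k"
      unfolding X_def Y_def using k ab by (subst col_mat_of_cols, auto)+
    then show "col L k = col (A * X + B * Y) k"
      using k ab(3)[OF k] col_mult2[OF A XY(1) k] col_mult2[OF B XY(2) k] A B XY
        col_add[of "A * X" p p "B * Y" k]
      by (simp add: colL)
  qed (use L A B XY in auto)
  then show thesis using that L XY U V by blast
qed

text \<open>The definition of a greatest common right divisor speaks only of divisibility. A common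
  right divisor \<open>K\<close> with a Bezout identity must divide \<open>G\<close>, say
  \<open>G = W * K\<close>, and multiplying its identity by \<open>W\<close> gives one for
  \<open>G\<close>. Such a \<open>K\<close> comes by transposition from \<open>column_gcd\<close>,
  which produces left divisors.\<close>

lemma gcrd_bezout:
  assumes G: "is_gcrd p G D S" and D: "D \<in> carrier_mat p p" and S: "S \<in> carrier_mat p p" and dD: "det D \<noteq> 0"
  obtains X Y D1 S1 where "X \<in> carrier_mat p p" "Y \<in> carrier_mat p p" "D1 \<in> carrier_mat p p" "S1 \<in> carrier_mat p p"
    "G \<in> carrier_mat p p" "D = D1 * G" "S = S1 * G" "G = X * S + Y * D"
proof -
  have "det (transpose_mat D) \<noteq> 0" using det_transpose[OF D] dD by simp
  then obtain L X Y U V where c: "L \<in> carrier_mat p p" "X \<in> carrier_mat p p" "Y \<in> carrier_mat p p"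
    "U \<in> carrier_mat p p" "V \<in> carrier_mat p p" and L: "L = transpose_mat S * X + transpose_mat D * Y"
    and SU: "transpose_mat S = L * U" and DV: "transpose_mat D = L * V"
    using column_gcd[of "transpose_mat S" p "transpose_mat D"] S D by (metis transpose_carrier_mat)
  define K where "K = transpose_mat L"
  have K: "K \<in> carrier_mat p p" using c by (simp add: K_def)
  have "S = transpose_mat U * K"
    using arg_cong[OF SU, of transpose_mat] c by (simp add: K_def transpose_mult[of _ p p])
  moreover have "D = transpose_mat V * K"
    using arg_cong[OF DV, of transpose_mat] c by (simp add: K_def transpose_mult[of _ p p])
  ultimately have "right_divisor p K S" "right_divisor p K D"
    unfolding right_divisor_def using K c by (metis transpose_carrier_mat)+
  then have "right_divisor p K G" using G unfolding is_gcrd_def by blast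
  then obtain W where W: "W \<in> carrier_mat p p" "G = W * K" unfolding right_divisor_def by blast
  have KXY: "K = transpose_mat X * S + transpose_mat Y * D"
    unfolding K_def L using c S D
    by (simp add: transpose_add[of _ p p] transpose_mult[of _ p p _ p] mult_carrier_mat[of _ p p _ p])
  obtain D1 S1 where "D1 \<in> carrier_mat p p" "S1 \<in> carrier_mat p p" "G \<in> carrier_mat p p" "D = D1 * G" "S = S1 * G"
    using G unfolding is_gcrd_def right_divisor_def by blast
  moreover have "G = (W * transpose_mat X) * S + (W * transpose_mat Y) * D"
    unfolding W(2) KXY using W(1) c S D
    by (simp add: mult_add_distrib_mat[of _ p p _ p] mult_carrier_mat[of _ p p _ p] assoc_mult_mat[of _ p p _ p _ p])
  moreover have "W * transpose_mat X \<in> carrier_mat p p" "W * transpose_mat Y \<in> carrier_mat p p"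
    using W(1) c by auto
  ultimately show thesis using that by blast
qed

section \<open>Division and the state space of a fraction\<close>

text \<open>
  For \<open>W(\<lambda>) = (\<Sum>n. w n \<lambda>\<^sup>-\<^sup>n\<^sup>-\<^sup>1)\<close>, \<open>residue_sum w x\<close> is the coefficient of \<open>\<lambda>\<^sup>-\<^sup>1\<close> in \<open>W x\<close>, and
  \<open>poly_part w x\<close> is the polynomial part of \<open>W x\<close>.
\<close>

definition residue_sum :: "(nat \<Rightarrow> complex) \<Rightarrow> complex poly \<Rightarrow> complex" where
  "residue_sum w x = (\<Sum>n\<le>degree x. w n * coeff x n)"

definition poly_part :: "(nat \<Rightarrow> complex) \<Rightarrow> complex poly \<Rightarrow> complex poly" where
  "poly_part w x = (\<Sum>n\<le>degree x. monom (\<Sum>j\<le>degree x. w j * coeff x (Suc n + j)) n)"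

lemma residue_sum_bound:
  assumes "degree x \<le> N"
  shows "residue_sum w x = (\<Sum>n\<le>N. w n * coeff x n)"
  unfolding residue_sum_def using assms by (intro sum.mono_neutral_left) (auto simp: coeff_eq_0)

lemma coeff_poly_part:
  assumes "degree x \<le> N"
  shows "coeff (poly_part w x) n = (\<Sum>j\<le>N. w j * coeff x (Suc n + j))"
proof -
  have "coeff (poly_part w x) n = (\<Sum>i\<le>degree x. if i = n then \<Sum>j\<le>degree x. w j * coeff x (Suc n + j) else 0)"
    unfolding poly_part_def coeff_sum by (intro sum.cong) auto
  also have "\<dots> = (\<Sum>j\<le>degree x. w j * coeff x (Suc n + j))"
    by (auto simp: coeff_eq_0)
  also have "\<dots> = (\<Sum>j\<le>N. w j * coeff x (Suc n + j))"
    using assms by (intro sum.mono_neutral_left) (auto simp: coeff_eq_0)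
  finally show ?thesis .
qed

lemma residue_sum_add: "residue_sum w (x + y) = residue_sum w x + residue_sum w y"
proof -
  let ?N = "max (degree x) (degree y)"
  have "degree (x + y) \<le> ?N" by (rule degree_add_le_max)
  then show ?thesis
    by (simp add: residue_sum_bound[of _ ?N] algebra_simps sum.distrib)
qed

lemma poly_part_add: "poly_part w (x + y) = poly_part w x + poly_part w y"
proof (rule poly_eqI)
  fix n
  let ?N = "max (degree x) (degree y)"
  have "degree (x + y) \<le> ?N" by (rule degree_add_le_max)
  then show "coeff (poly_part w (x + y)) n = coeff (poly_part w x + poly_part w y) n"
    by (simp add: coeff_poly_part[of _ ?N] algebra_simps sum.distrib)
qed

lemma residue_sum_smult: "residue_sum w (smult c x) = c * residue_sum w x"
  by (simp add: residue_sum_bound[of "smult c x" "degree x"] degree_smult_le)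
     (simp add: residue_sum_def sum_distrib_left mult_ac)

lemma poly_part_smult: "poly_part w (smult c x) = smult c (poly_part w x)"
  by (intro poly_eqI) (simp add: coeff_poly_part[of _ "degree x"] degree_smult_le sum_distrib_left mult_ac)

lemma residue_sum_0 [simp]: "residue_sum w 0 = 0"
  by (simp add: residue_sum_def)

lemma poly_part_0 [simp]: "poly_part w 0 = 0"
  by (simp add: poly_part_def)

lemma residue_sum_sum: "residue_sum w (\<Sum>i\<in>I. f i) = (\<Sum>i\<in>I. residue_sum w (f i))"
  by (induction I rule: infinite_finite_induct) (auto simp: residue_sum_add)

lemma poly_part_sum: "poly_part w (\<Sum>i\<in>I. f i) = (\<Sum>i\<in>I. poly_part w (f i))"
  by (induction I rule: infinite_finite_induct) (auto simp: poly_part_add)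

lemma residue_sum_monom: "residue_sum w (monom c n) = w n * c"
  by (subst residue_sum_bound[of _ n]) (auto simp: degree_monom_le if_distrib cong: if_cong)

text \<open>Multiplying \<open>W x\<close> by \<open>\<lambda>\<close> moves its coefficient of
  \<open>\<lambda>^-1\<close> into the constant term, while the added constant \<open>a\<close>
  contributes only negative powers. Inductions on polynomials rest on this Horner step.\<close>

lemma poly_part_pCons: "poly_part w (pCons a x) = pCons (residue_sum w x) (poly_part w x)"
proof (rule poly_eqI)
  fix n
  have "coeff (poly_part w (pCons a x)) n = (\<Sum>j\<le>Suc (degree x). w j * coeff x (n + j))"
    by (subst coeff_poly_part[of _ "Suc (degree x)"]) (auto simp: degree_pCons_le)
  also have "\<dots> = coeff (pCons (residue_sum w x) (poly_part w x)) n"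
    by (cases n) (simp_all add: coeff_poly_part[of x "Suc (degree x)"] residue_sum_bound[of x "Suc (degree x)"] del: sum.atMost_Suc)
  finally show "coeff (poly_part w (pCons a x)) n = coeff (pCons (residue_sum w x) (poly_part w x)) n" .
qed

lemma poly_part_const [simp]: "poly_part w [:a:] = 0"
  by (simp add: poly_part_pCons)

definition residue_mat :: "nat \<Rightarrow> (nat \<Rightarrow> nat \<Rightarrow> nat \<Rightarrow> complex) \<Rightarrow> complex poly mat \<Rightarrow> complex mat" where
  "residue_mat p w X = mat p (dim_col X) (\<lambda>(i, k). \<Sum>j<p. residue_sum (w i j) (X $$ (j, k)))"

definition poly_part_mat :: "nat \<Rightarrow> (nat \<Rightarrow> nat \<Rightarrow> nat \<Rightarrow> complex) \<Rightarrow> complex poly mat \<Rightarrow> complex poly mat" where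
  "poly_part_mat p w X = mat p (dim_col X) (\<lambda>(i, k). \<Sum>j<p. poly_part (w i j) (X $$ (j, k)))"

lemma residue_mat_carrier [simp]: "X \<in> carrier_mat p n \<Longrightarrow> residue_mat p w X \<in> carrier_mat p n"
  by (simp add: residue_mat_def)

lemma poly_part_mat_carrier [simp]: "X \<in> carrier_mat p n \<Longrightarrow> poly_part_mat p w X \<in> carrier_mat p n"
  by (simp add: poly_part_mat_def)

lemma residue_mat_add:
  "X \<in> carrier_mat p n \<Longrightarrow> Y \<in> carrier_mat p n \<Longrightarrow> residue_mat p w (X + Y) = residue_mat p w X + residue_mat p w Y"
  by (intro eq_matI) (auto simp: residue_mat_def residue_sum_add sum.distrib)

lemma poly_part_mat_add:
  "X \<in> carrier_mat p n \<Longrightarrow> Y \<in> carrier_mat p n \<Longrightarrow> poly_part_mat p w (X + Y) = poly_part_mat p w X + poly_part_mat p w Y"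
  by (intro eq_matI) (auto simp: poly_part_mat_def poly_part_add sum.distrib)

lemma mult_mat_entry:
  "A \<in> carrier_mat n m \<Longrightarrow> B \<in> carrier_mat m k \<Longrightarrow> i < n \<Longrightarrow> j < k \<Longrightarrow> (A * B) $$ (i, j) = (\<Sum>l<m. A $$ (i, l) * B $$ (l, j))"
  by (simp add: scalar_prod_def lessThan_atLeast0)

lemma residue_mat_const:
  assumes "X \<in> carrier_mat p n" "R \<in> carrier_mat n k"
  shows "residue_mat p w (X * const_mat R) = residue_mat p w X * R"
proof (rule eq_matI)
  fix i j assume "i < dim_row (residue_mat p w X * R)" "j < dim_col (residue_mat p w X * R)"
  then have ij: "i < p" "j < k" using assms by (auto simp: residue_mat_def)
  have "residue_mat p w (X * const_mat R) $$ (i, j) = (\<Sum>l<p. \<Sum>m<n. residue_sum (w i l) (X $$ (l, m)) * R $$ (m, j))"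
    using ij assms
    by (auto simp: residue_mat_def mult_mat_entry[of _ p n _ k] residue_sum_sum residue_sum_smult mult.commute[of _ "[:_:]"]
      mult.commute simp del: index_mult_mat(1) intro!: sum.cong)
  also have "\<dots> = (residue_mat p w X * R) $$ (i, j)"
    using ij assms by (subst sum.swap, subst mult_mat_entry[of _ p n _ k]) (auto simp: residue_mat_def sum_distrib_right)
  finally show "residue_mat p w (X * const_mat R) $$ (i, j) = (residue_mat p w X * R) $$ (i, j)" .
qed (use assms in \<open>auto simp: residue_mat_def\<close>)

lemma poly_part_mat_const:
  assumes "X \<in> carrier_mat p n" "R \<in> carrier_mat n k"
  shows "poly_part_mat p w (X * const_mat R) = poly_part_mat p w X * const_mat R"
proof (rule eq_matI)
  fix i j assume "i < dim_row (poly_part_mat p w X * const_mat R)" "j < dim_col (poly_part_mat p w X * const_mat R)"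
  then have ij: "i < p" "j < k" using assms by (auto simp: poly_part_mat_def)
  have "poly_part_mat p w (X * const_mat R) $$ (i, j) = (\<Sum>l<p. \<Sum>m<n. poly_part (w i l) (X $$ (l, m)) * [:R $$ (m, j):])"
    using ij assms
    by (auto simp: poly_part_mat_def mult_mat_entry[of _ p n _ k] poly_part_sum poly_part_smult mult.commute[of _ "[:_:]"] simp del: index_mult_mat(1) intro!: sum.cong)
  also have "\<dots> = (poly_part_mat p w X * const_mat R) $$ (i, j)"
    using ij assms by (subst sum.swap, subst mult_mat_entry[of _ p n _ k]) (auto simp: poly_part_mat_def sum_distrib_right smult_sum2)
  finally show "poly_part_mat p w (X * const_mat R) $$ (i, j) = (poly_part_mat p w X * const_mat R) $$ (i, j)" .
qed (use assms in \<open>auto simp: poly_part_mat_def\<close>)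

lemma poly_part_mat_shift:
  "X \<in> carrier_mat p n \<Longrightarrow>
    poly_part_mat p w ([:0, 1:] \<cdot>\<^sub>m X) = [:0, 1:] \<cdot>\<^sub>m poly_part_mat p w X + const_mat (residue_mat p w X)"
proof (rule eq_matI)
  assume X: "X \<in> carrier_mat p n"
  have pC: "(\<Sum>j<p. pCons (f j) (g j)) = pCons (\<Sum>j<p. f j) (\<Sum>j<p. g j)" for f :: "nat \<Rightarrow> complex" and g
    by (induction p) auto
  fix i j assume "i < dim_row ([:0, 1:] \<cdot>\<^sub>m poly_part_mat p w X + const_mat (residue_mat p w X))"
    "j < dim_col ([:0, 1:] \<cdot>\<^sub>m poly_part_mat p w X + const_mat (residue_mat p w X))"
  then show "poly_part_mat p w ([:0, 1:] \<cdot>\<^sub>m X) $$ (i, j) =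
      ([:0, 1:] \<cdot>\<^sub>m poly_part_mat p w X + const_mat (residue_mat p w X)) $$ (i, j)"
    using X by (simp add: poly_part_mat_def residue_mat_def poly_part_pCons pC)
qed (auto simp: poly_part_mat_def residue_mat_def)

lemma poly_part_mat_one: "poly_part_mat p w (1\<^sub>m p) = 0\<^sub>m p p"
  by (intro eq_matI) (auto simp: poly_part_mat_def intro!: sum.neutral, metis one_pCons poly_part_const)

text \<open>The coefficientwise form of \<open>W D = S\<close>.\<close>

definition fraction_seq :: "nat \<Rightarrow> (nat \<Rightarrow> nat \<Rightarrow> nat \<Rightarrow> complex) \<Rightarrow> complex poly mat \<Rightarrow> complex poly mat \<Rightarrow> bool" where
  "fraction_seq p w D S \<longleftrightarrow> poly_part_mat p w D = S \<and> (\<forall>m. residue_mat p w (monom 1 m \<cdot>\<^sub>m D) = 0\<^sub>m p p)"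

text \<open>\<open>W D Y = S Y\<close> is a polynomial matrix. Linearity extends vanishing residues
  from monomial multiples of \<open>D\<close> to all multiples, and in the Horner step for the
  polynomial part these residues are exactly the terms that must vanish.\<close>

lemma fraction_seq_mult:
  assumes f: "fraction_seq p w D S" and D: "D \<in> carrier_mat p p" and Y: "Y \<in> carrier_mat p n"
  shows "residue_mat p w (D * Y) = 0\<^sub>m p n" "poly_part_mat p w (D * Y) = S * Y"
proof -
  have r0: "(\<Sum>j<p. residue_sum (w i j) (monom 1 m * D $$ (j, l))) = 0" if "i < p" "l < p" for i l m
  proof -
    have "residue_mat p w (monom 1 m \<cdot>\<^sub>m D) $$ (i, l) = 0" using f that unfolding fraction_seq_def by simp
    then show ?thesis using that D by (simp add: residue_mat_def)
  qed
  have rq: "(\<Sum>j<p. residue_sum (w i j) (D $$ (j, l) * q)) = 0" if "i < p" "l < p" for i l q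
  proof -
    have "(\<Sum>j<p. residue_sum (w i j) (D $$ (j, l) * q)) =
        (\<Sum>j<p. residue_sum (w i j) (\<Sum>m\<le>degree q. smult (coeff q m) (monom 1 m * D $$ (j, l))))"
    proof (intro sum.cong refl arg_cong[of _ _ "residue_sum _"])
      fix j
      have "D $$ (j, l) * q = D $$ (j, l) * (\<Sum>m\<le>degree q. monom (coeff q m) m)" by (simp add: poly_as_sum_of_monoms)
      also have "\<dots> = (\<Sum>m\<le>degree q. smult (coeff q m) (monom 1 m * D $$ (j, l)))"
        unfolding sum_distrib_left by (intro sum.cong) (auto simp: mult_smult_left[symmetric] smult_monom mult.commute)
      finally show "D $$ (j, l) * q = \<dots>" .
    qed
    also have "\<dots> = (\<Sum>m\<le>degree q. coeff q m * (\<Sum>j<p. residue_sum (w i j) (monom 1 m * D $$ (j, l))))"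
      unfolding residue_sum_sum residue_sum_smult sum_distrib_left by (rule sum.swap)
    finally show ?thesis using r0[OF that] by simp
  qed
  have S: "(\<Sum>j<p. poly_part (w i j) (D $$ (j, l))) = S $$ (i, l)" if "i < p" "l < p" for i l
  proof -
    have "poly_part_mat p w D $$ (i, l) = S $$ (i, l)" using f unfolding fraction_seq_def by simp
    then show ?thesis using that D by (simp add: poly_part_mat_def)
  qed
  have Sc: "S \<in> carrier_mat p p" using f D unfolding fraction_seq_def by (metis poly_part_mat_carrier)
  have pq: "(\<Sum>j<p. poly_part (w i j) (D $$ (j, l) * q)) = S $$ (i, l) * q" if "i < p" "l < p" for i l q
  proof (induction q)
    case 0
    then show ?case by simp
  next
    case (pCons a q)
    have "(\<Sum>j<p. poly_part (w i j) (D $$ (j, l) * pCons a q)) =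
        (\<Sum>j<p. smult a (poly_part (w i j) (D $$ (j, l))) + pCons (residue_sum (w i j) (D $$ (j, l) * q)) (poly_part (w i j) (D $$ (j, l) * q)))"
      by (intro sum.cong) (simp_all add: poly_part_add poly_part_smult poly_part_pCons)
    also have "\<dots> = smult a (S $$ (i, l)) + (\<Sum>j<p. pCons (residue_sum (w i j) (D $$ (j, l) * q)) (poly_part (w i j) (D $$ (j, l) * q)))"
      unfolding sum.distrib S[OF that, symmetric] smult_sum2 ..
    also have "(\<Sum>j<p. pCons (residue_sum (w i j) (D $$ (j, l) * q)) (poly_part (w i j) (D $$ (j, l) * q))) =
       pCons (\<Sum>j<p. residue_sum (w i j) (D $$ (j, l) * q)) (\<Sum>j<p. poly_part (w i j) (D $$ (j, l) * q))"
    proof -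
      have pC: "(\<Sum>j<p. pCons (f j) (g j)) = pCons (\<Sum>j<p. f j) (\<Sum>j<p. g j)" for f :: "nat \<Rightarrow> complex" and g
        by (induction p) auto
      show ?thesis by (rule pC)
    qed
    finally show ?case unfolding pCons.IH rq[OF that] by simp
  qed
  show "residue_mat p w (D * Y) = 0\<^sub>m p n"
  proof (rule eq_matI)
    fix i k assume "i < dim_row (0\<^sub>m p n)" "k < dim_col (0\<^sub>m p n)"
    then have ik: "i < p" "k < n" by auto
    have "residue_mat p w (D * Y) $$ (i, k) = (\<Sum>j<p. \<Sum>l<p. residue_sum (w i j) (D $$ (j, l) * Y $$ (l, k)))"
      using ik D Y by (simp add: residue_mat_def mult_mat_entry[of _ p p _ n] residue_sum_sum del: index_mult_mat(1))
    also have "\<dots> = (\<Sum>l<p. \<Sum>j<p. residue_sum (w i j) (D $$ (j, l) * Y $$ (l, k)))" by (rule sum.swap)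
    also have "\<dots> = 0" using rq ik by simp
    finally show "residue_mat p w (D * Y) $$ (i, k) = 0\<^sub>m p n $$ (i, k)" using ik by simp
  qed (use Y in \<open>auto simp: residue_mat_def\<close>)
  show "poly_part_mat p w (D * Y) = S * Y"
  proof (rule eq_matI)
    fix i k assume "i < dim_row (S * Y)" "k < dim_col (S * Y)"
    then have ik: "i < p" "k < n" using Sc Y by auto
    have "poly_part_mat p w (D * Y) $$ (i, k) = (\<Sum>j<p. \<Sum>l<p. poly_part (w i j) (D $$ (j, l) * Y $$ (l, k)))"
      using ik D Y by (simp add: poly_part_mat_def mult_mat_entry[of _ p p _ n] poly_part_sum del: index_mult_mat(1))
    also have "\<dots> = (\<Sum>l<p. \<Sum>j<p. poly_part (w i j) (D $$ (j, l) * Y $$ (l, k)))" by (rule sum.swap)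
    also have "\<dots> = (S * Y) $$ (i, k)" using pq ik Sc Y by (simp add: mult_mat_entry[of _ p p _ n] del: index_mult_mat(1))
    finally show "poly_part_mat p w (D * Y) $$ (i, k) = (S * Y) $$ (i, k)" .
  qed (use Y Sc in \<open>auto simp: poly_part_mat_def\<close>)
qed

text \<open>Monomials \<open>\<lambda>^t e_k\<close> are reduced one at a time, ordered first by
  \<open>t\<close>, then by \<open>k\<close>. If \<open>t\<close> is at least \<open>c k\<close>,
  column \<open>k\<close> of \<open>D\<close> cancels the monomial; upper triangularity of the
  leading coefficients leaves only lower powers, or the same power in earlier rows. \<open>E\<close>
  may carry scaled monomials because the basis used later is signed.\<close>

lemma column_reduced_division:
  fixes D E X :: "complex poly mat"
  assumes D: "D \<in> carrier_mat p p" and E: "E \<in> carrier_mat p n" and X: "X \<in> carrier_mat p m"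
    and deg: "\<And>i k. i < p \<Longrightarrow> k < p \<Longrightarrow> degree (D $$ (i, k)) \<le> c k"
    and upper: "\<And>i k. i < p \<Longrightarrow> k < i \<Longrightarrow> coeff (D $$ (i, k)) (c k) = 0"
    and diag: "\<And>k. k < p \<Longrightarrow> coeff (D $$ (k, k)) (c k) \<noteq> 0"
    and basis: "\<And>j k. k < p \<Longrightarrow> j < c k \<Longrightarrow>
      \<exists>a<n. \<exists>b. b \<noteq> 0 \<and> (\<forall>i<p. E $$ (i, a) = (if i = k then monom b j else 0))"
  obtains R Q where "R \<in> carrier_mat n m" "Q \<in> carrier_mat p m" "X = E * const_mat R + D * Q"
proof -
  define rep where "rep x r q \<longleftrightarrow> (\<forall>i<p. x i = (\<Sum>a<n. E $$ (i, a) * [:r a:]) + (\<Sum>l<p. D $$ (i, l) * q l))"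
    for x :: "nat \<Rightarrow> complex poly" and r q
  define sp where "sp x \<longleftrightarrow> (\<exists>r q. rep x r q)" for x
  have sp_cong: "sp x" if yx: "sp y" "\<And>i. i < p \<Longrightarrow> x i = y i" for x y
  proof -
    obtain r q where "rep y r q" using yx(1) sp_def by blast
    then have "rep x r q" using yx(2) unfolding rep_def by simp
    then show ?thesis using sp_def by blast
  qed
  have sp_0: "sp (\<lambda>i. 0)"
  proof -
    have "rep (\<lambda>i. 0) (\<lambda>_. 0) (\<lambda>_. 0)" by (simp add: rep_def)
    then show ?thesis using sp_def by blast
  qed
  have sp_add: "sp (\<lambda>i. x i + y i)" if xy: "sp x" "sp y" for x y
  proof -
    obtain r q r' q' where 1: "rep x r q" "rep y r' q'" using xy sp_def by blast
    have e: "E $$ (i, a) * [:r a + r' a:] = E $$ (i, a) * [:r a:] + E $$ (i, a) * [:r' a:]" for i a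
      by (simp add: smult_add_left)
    have "rep (\<lambda>i. x i + y i) (\<lambda>a. r a + r' a) (\<lambda>l. q l + q' l)"
      unfolding rep_def e distrib_left sum.distrib
    proof (intro allI impI)
      fix i assume "i < p"
      with 1 have "x i = (\<Sum>a<n. E $$ (i, a) * [:r a:]) + (\<Sum>l<p. D $$ (i, l) * q l)"
        "y i = (\<Sum>a<n. E $$ (i, a) * [:r' a:]) + (\<Sum>l<p. D $$ (i, l) * q' l)"
        unfolding rep_def by blast+
      then show "x i + y i = (\<Sum>a<n. E $$ (i, a) * [:r a:]) + (\<Sum>a<n. E $$ (i, a) * [:r' a:]) +
          ((\<Sum>l<p. D $$ (i, l) * q l) + (\<Sum>l<p. D $$ (i, l) * q' l))"
        by (simp only: add_ac)
    qed
    then show ?thesis using sp_def by blast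
  qed
  have sp_uminus: "sp (\<lambda>i. - x i)" if x: "sp x" for x
  proof -
    obtain r q where "rep x r q" using x sp_def by blast
    then have "rep (\<lambda>i. - x i) (\<lambda>a. - r a) (\<lambda>l. - q l)" unfolding rep_def by (simp add: sum_negf)
    then show ?thesis using sp_def by blast
  qed
  have sp_sum: "sp (\<lambda>i. \<Sum>s\<in>I. x s i)" if "\<And>s. s \<in> I \<Longrightarrow> sp (x s)" for I :: "nat set" and x
    using that by (induction I rule: infinite_finite_induct) (auto intro: sp_0 sp_add)
  have sp_D: "sp (\<lambda>i. D $$ (i, l) * q)" if "l < p" for l q
  proof -
    have "(\<Sum>l'<p. D $$ (i, l') * (if l' = l then q else 0)) = D $$ (i, l) * q" for i
    proof -
      have "(\<Sum>l'<p. D $$ (i, l') * (if l' = l then q else 0)) = (\<Sum>l'<p. if l' = l then D $$ (i, l') * q else 0)"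
        by (intro sum.cong) auto
      then show ?thesis using \<open>l < p\<close> by simp
    qed
    then have "rep (\<lambda>i. D $$ (i, l) * q) (\<lambda>_. 0) (\<lambda>l'. if l' = l then q else 0)" unfolding rep_def by simp
    then show ?thesis using sp_def by blast
  qed
  have sp_poly: "sp x" if x: "\<And>i t. i < p \<Longrightarrow> coeff (x i) t \<noteq> 0 \<Longrightarrow> sp (\<lambda>i'. if i' = i then monom (coeff (x i) t) t else 0)" for x
  proof (rule sp_cong)
    show "sp (\<lambda>i'. \<Sum>i<p. \<Sum>t\<le>degree (x i). if i' = i then monom (coeff (x i) t) t else 0)"
    proof (intro sp_sum)
      fix i t assume "i \<in> {..<p}"
      then show "sp (\<lambda>i'. if i' = i then monom (coeff (x i) t) t else 0)"
        using x[of i t] by (cases "coeff (x i) t = 0") (auto intro: sp_cong[OF sp_0])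
    qed
    fix i' assume "i' < p"
    have "(\<Sum>i<p. \<Sum>t\<le>degree (x i). if i' = i then monom (coeff (x i) t) t else 0) =
        (\<Sum>i<p. if i = i' then x i else 0)"
      by (intro sum.cong) (auto simp: poly_as_sum_of_monoms)
    then show "x i' = (\<Sum>i<p. \<Sum>t\<le>degree (x i). if i' = i then monom (coeff (x i) t) t else 0)"
      using \<open>i' < p\<close> by simp
  qed
  have sp_monom: "sp (\<lambda>i. if i = k then monom b t else 0)" if "k < p" for k b t
    using that
  proof (induction t arbitrary: k b rule: less_induct)
    case (less t)
    from less.prems show ?case
    proof (induction k arbitrary: b rule: less_induct)
      case (less k)
      note IHt = less.IH and IHk = \<open>\<And>y k b. y < t \<Longrightarrow> k < p \<Longrightarrow> sp (\<lambda>i. if i = k then monom b y else 0)\<close>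
      show ?case
      proof (cases "t < c k")
        case True
        then obtain a b' where a: "a < n" "b' \<noteq> 0" "\<forall>i<p. E $$ (i, a) = (if i = k then monom b' t else 0)"
          using basis[OF less.prems] by blast
        have "(\<Sum>a'<n. E $$ (i, a') * [:if a' = a then b / b' else 0:]) = (if i = k then monom b t else 0)" if "i < p" for i
        proof -
          have "(\<Sum>a'<n. E $$ (i, a') * [:if a' = a then b / b' else 0:]) = (\<Sum>a'<n. if a' = a then E $$ (i, a') * [:b / b':] else 0)"
            by (intro sum.cong) auto
          also have "\<dots> = E $$ (i, a) * [:b / b':]" using a by simp
          also have "\<dots> = (if i = k then monom b t else 0)" using a that by (simp add: smult_monom)
          finally show ?thesis .
        qed
        then have "rep (\<lambda>i. if i = k then monom b t else 0) (\<lambda>a'. if a' = a then b / b' else 0) (\<lambda>_. 0)"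
          unfolding rep_def by simp
        then show ?thesis using sp_def by blast
      next
        case False
        define d where "d = b / coeff (D $$ (k, k)) (c k)"
        define x where "x = (\<lambda>i. D $$ (i, k) * monom d (t - c k))"
        define y where "y = (\<lambda>i. x i + - (if i = k then monom b t else 0))"
        have cx: "coeff (x i) t' = (if t' < t - c k then 0 else d * coeff (D $$ (i, k)) (t' - (t - c k)))" for i t'
          unfolding x_def by (simp add: coeff_monom_mult mult.commute[of _ "monom _ _"])
        have cy: "coeff (y i) t' = 0" if "i < p" "t' > t \<or> (t' = t \<and> i \<ge> k)" for i t'
        proof (cases "t' = t")
          case True
          then show ?thesis using that diag[OF less.prems] upper[of i k] False
            by (auto simp: y_def cx d_def)
        next
          case f: False
          then have "degree (D $$ (i, k)) < t' - (t - c k)" using that deg[of i k] less.prems False by auto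
          then show ?thesis using f that by (auto simp: y_def cx coeff_eq_0)
        qed
        have "sp y"
        proof (rule sp_poly)
          fix i t' assume i: "i < p" "coeff (y i) t' \<noteq> 0"
          then have "t' < t \<or> (t' = t \<and> i < k)" using cy[of i t'] by (meson linorder_less_linear linorder_not_less)
          then show "sp (\<lambda>i'. if i' = i then monom (coeff (y i) t') t' else 0)"
            using IHk[of t' i] IHt[of i] i by auto
        qed
        then have "sp (\<lambda>i. x i + - y i)" unfolding x_def by (intro sp_add sp_D sp_uminus less.prems)
        then show ?thesis by (rule sp_cong) (simp add: y_def)
      qed
    qed
  qed
  have "\<exists>r q. rep (\<lambda>i. X $$ (i, k)) r q" for k
    using sp_poly[of "\<lambda>i. X $$ (i, k)"] sp_monom unfolding sp_def[symmetric] by blast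
  then obtain r q where "\<And>k. rep (\<lambda>i. X $$ (i, k)) (r k) (q k)" by metis
  then have rq: "\<And>k i. i < p \<Longrightarrow> X $$ (i, k) = (\<Sum>a<n. E $$ (i, a) * [:r k a:]) + (\<Sum>l<p. D $$ (i, l) * q k l)"
    unfolding rep_def by blast
  define R where "R = mat n m (\<lambda>(a, k). r k a)"
  define Q where "Q = mat p m (\<lambda>(l, k). q k l)"
  have R: "R \<in> carrier_mat n m" and Q: "Q \<in> carrier_mat p m" by (simp_all add: R_def Q_def)
  have "X = E * const_mat R + D * Q"
  proof (rule eq_matI)
    fix i k assume "i < dim_row (E * const_mat R + D * Q)" "k < dim_col (E * const_mat R + D * Q)"
    then have ik: "i < p" "k < m" using D Q by auto
    have "(E * const_mat R) $$ (i, k) = (\<Sum>a<n. E $$ (i, a) * [:r k a:])"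
      using ik R by (subst mult_mat_entry[OF E _ ik]) (auto simp: R_def)
    moreover have "(D * Q) $$ (i, k) = (\<Sum>l<p. D $$ (i, l) * q k l)"
      using ik Q by (subst mult_mat_entry[OF D _ ik]) (auto simp: Q_def)
    ultimately show "X $$ (i, k) = (E * const_mat R + D * Q) $$ (i, k)"
      using rq[OF ik(1), of k] ik D Q E R by (simp del: index_mult_mat(1))
  qed (use X D Q in auto)
  then show thesis using that R Q by blast
qed

section \<open>Construction of the realization and its Gram matrix\<close>

text \<open>
  A pair \<open>(j, k)\<close> in \<open>L\<close> stands for the monomial \<open>\<plusminus> \<lambda>\<^sup>j e\<^sub>k\<close>. The sign \<open>(-1)\<^bsup>j div 2\<^esup>\<close> cancels the
  alternating sign in the expansion of \<open>R\<^sub>F\<close>.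
\<close>

definition monom_basis :: "nat \<Rightarrow> (nat \<times> nat) list \<Rightarrow> complex poly mat" where
  "monom_basis p L = mat p (length L)
     (\<lambda>(i, a). if i = snd (L ! a) then monom ((-1) ^ (fst (L ! a) div 2)) (fst (L ! a)) else 0)"

text \<open>The factor \<open>(-1) ^ fst (L ! a)\<close> is the effect of
  \<open>y(-\<lambda>)\<close> on the monomial of the row; the two factors with \<open>div 2\<close>
  are the signs of the basis vectors.\<close>

definition gram_mat :: "(nat \<Rightarrow> nat \<Rightarrow> nat \<Rightarrow> complex) \<Rightarrow> (nat \<times> nat) list \<Rightarrow> complex mat" where
  "gram_mat w L = mat (length L) (length L) (\<lambda>(a, b).
     (-1) ^ (fst (L ! a) div 2) * (-1) ^ fst (L ! a) * (-1) ^ (fst (L ! b) div 2) *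
     w (snd (L ! a)) (snd (L ! b)) (fst (L ! a) + fst (L ! b)))"

text \<open>\<open>T\<close> and \<open>B\<close> are the remainders of \<open>\<lambda> E\<close>
  and of the constants modulo \<open>D\<close>. Polynomial parts of the two division identities give
  \<open>S_Q\<close> and \<open>S_Q'\<close>; pairing with the basis gives the products
  \<open>H T\<close> and \<open>H B\<close> without computing \<open>T\<close> or
  \<open>B\<close>.\<close>

lemma realization_exists:
  fixes D S :: "complex poly mat"
  assumes D: "D \<in> carrier_mat p p" and S: "S \<in> carrier_mat p p"
    and frac: "fraction_seq p w D S"
    and deg: "\<And>i k. i < p \<Longrightarrow> k < p \<Longrightarrow> degree (D $$ (i, k)) \<le> c k"
    and upper: "\<And>i k. i < p \<Longrightarrow> k < i \<Longrightarrow> coeff (D $$ (i, k)) (c k) = 0"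
    and diag: "\<And>k. k < p \<Longrightarrow> coeff (D $$ (k, k)) (c k) \<noteq> 0"
    and Lset: "set L = {(j, k). k < p \<and> j < c k}"
    and cmax: "\<And>k. k < p \<Longrightarrow> c k \<le> cm"
    and herm: "\<And>i j m. i < p \<Longrightarrow> j < p \<Longrightarrow> m < 2 * cm \<Longrightarrow> cnj (w j i m) = w i j m"
    and odd: "\<And>i j m. i < p \<Longrightarrow> j < p \<Longrightarrow> odd m \<Longrightarrow> w i j m = 0"
    and detD: "degree (det D) = length L" and detF: "degree (det (D + S)) = length L"
  shows "\<exists>E M Q Q' T B C. realization p (length L) D S E M Q Q' T B C (gram_mat w L)"
proof -
  define n where "n = length L"
  define jj kk where "jj a = fst (L ! a)" and "kk a = snd (L ! a)" for a
  define sg :: "nat \<Rightarrow> complex" where "sg a = (-1) ^ (jj a div 2)" for a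
  have La: "kk a < p" "jj a < c (kk a)" "jj a < cm" if "a < n" for a
  proof -
    have "L ! a \<in> set L" using that by (simp add: n_def)
    then show "kk a < p" "jj a < c (kk a)" unfolding Lset by (auto simp: kk_def jj_def)
    then show "jj a < cm" using cmax[of "kk a"] by simp
  qed
  define E where "E = monom_basis p L"
  have E: "E \<in> carrier_mat p n" by (simp add: E_def monom_basis_def n_def)
  have Eia: "E $$ (i, a) = (if i = kk a then monom (sg a) (jj a) else 0)" if "i < p" "a < n" for i a
    using that by (simp add: E_def monom_basis_def n_def kk_def jj_def sg_def)
  have basis: "\<exists>a<n. \<exists>b. b \<noteq> 0 \<and> (\<forall>i<p. E $$ (i, a) = (if i = k then monom b j else 0))" if "k < p" "j < c k" for j k
  proof -
    have "(j, k) \<in> set L" using that Lset by auto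
    then obtain a where a: "a < n" "L ! a = (j, k)" by (auto simp: in_set_conv_nth n_def)
    then show ?thesis using Eia[OF _ a(1)]
      by (intro exI[of _ a] exI[of _ "sg a"] conjI) (auto simp: sg_def kk_def jj_def)
  qed
  note division = column_reduced_division[OF D E _ deg upper diag basis]
  obtain T Q where T: "T \<in> carrier_mat n n" and Q: "Q \<in> carrier_mat p n" and eT: "[:0, 1:] \<cdot>\<^sub>m E = E * const_mat T + D * Q"
    by (rule division[of "[:0, 1:] \<cdot>\<^sub>m E" n]) (use E in auto)
  obtain B Q' where B: "B \<in> carrier_mat n p" and Q': "Q' \<in> carrier_mat p p" and eB: "1\<^sub>m p = E * const_mat B + D * Q'"
    by (rule division[of "1\<^sub>m p" p]) auto
  define C where "C = residue_mat p w E"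
  define M where "M = poly_part_mat p w E"
  define H where "H = gram_mat w L"
  have C: "C \<in> carrier_mat p n" and M: "M \<in> carrier_mat p n" and H: "H \<in> carrier_mat n n"
    using E by (simp_all add: C_def M_def H_def gram_mat_def n_def)
  have cT: "const_mat T \<in> carrier_mat n n" and cB: "const_mat B \<in> carrier_mat n p" and cC: "const_mat C \<in> carrier_mat p n"
    using T B C by simp_all
  note mc = mult_carrier_mat[OF E cT] mult_carrier_mat[OF D Q] mult_carrier_mat[OF E cB] mult_carrier_mat[OF D Q']
  have pen: "K * pencil T = [:0, 1:] \<cdot>\<^sub>m K - K * const_mat T" if K: "K \<in> carrier_mat q n" for K q
    unfolding pencil_alt[OF T] using K cT
    by (simp add: mult_minus_distrib_mat[of _ q n _ n] mult_smult_distrib[of _ q n _ n] right_mult_one_mat[of _ q n])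
  have E_pencil: "E * pencil T = D * Q"
    unfolding pen[OF E] eT using carrier_matD[OF mc(1)] carrier_matD[OF mc(2)]
    by (intro eq_matI) (simp_all del: index_mult_mat)
  have S_Q: "S * Q = M * pencil T + const_mat C"
  proof -
    have "[:0, 1:] \<cdot>\<^sub>m M + const_mat C = poly_part_mat p w ([:0, 1:] \<cdot>\<^sub>m E)"
      unfolding M_def C_def by (rule poly_part_mat_shift[OF E, symmetric])
    also have "\<dots> = M * const_mat T + S * Q"
      unfolding eT poly_part_mat_add[OF mc(1,2)] fraction_seq_mult[OF frac D Q] poly_part_mat_const[OF E T] M_def ..
    finally have e: "[:0, 1:] \<cdot>\<^sub>m M + const_mat C = M * const_mat T + S * Q" .
    have MT: "M * const_mat T \<in> carrier_mat p n" and SQ: "S * Q \<in> carrier_mat p n"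
      using mult_carrier_mat[OF M cT] mult_carrier_mat[OF S Q] by auto
    show ?thesis
    proof (rule eq_matI)
      fix i j assume "i < dim_row (M * pencil T + const_mat C)" "j < dim_col (M * pencil T + const_mat C)"
      then have ij: "i < p" "j < n" using C by auto
      have "([:0, 1:] \<cdot>\<^sub>m M + const_mat C) $$ (i, j) = (M * const_mat T + S * Q) $$ (i, j)" using e by simp
      then show "(S * Q) $$ (i, j) = (M * pencil T + const_mat C) $$ (i, j)"
        unfolding pen[OF M] using ij M C carrier_matD[OF MT] carrier_matD[OF SQ] by (simp del: index_mult_mat(1) add: algebra_simps)
    qed (use C S Q in auto)
  qed
  have S_Q': "S * Q' + M * const_mat B = 0\<^sub>m p p"
  proof -
    have "0\<^sub>m p p = poly_part_mat p w (1\<^sub>m p)" by (simp add: poly_part_mat_one)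
    also have "\<dots> = M * const_mat B + S * Q'"
      unfolding eB poly_part_mat_add[OF mc(3,4)] fraction_seq_mult[OF frac D Q'] poly_part_mat_const[OF E B] M_def ..
    finally show ?thesis using comm_add_mat[OF mult_carrier_mat[OF M cB] mult_carrier_mat[OF S Q']] by simp
  qed
  \<comment> \<open>Row \<open>a\<close> pairs the columns of \<open>X\<close> with the
    \<open>a\<close>-th basis monomial. \<open>Hl\<close> annihilates multiples of \<open>D\<close>,
    so it depends only on classes modulo \<open>D\<close>; hence \<open>Hl E = H\<close>,
    \<open>Hl (\<lambda> E) = H T\<close> and \<open>Hl 1 = H B\<close>.\<close>
  define Hl where "Hl X = mat n (dim_col X) (\<lambda>(a, k). sg a * (-1) ^ jj a * residue_mat p w (monom 1 (jj a) \<cdot>\<^sub>m X) $$ (kk a, k))"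
    for X :: "complex poly mat"
  have Hl_add: "Hl (X + Y) = Hl X + Hl Y" if "X \<in> carrier_mat p m" "Y \<in> carrier_mat p m" for X Y m
  proof (rule eq_matI)
    fix a k assume "a < dim_row (Hl X + Hl Y)" "k < dim_col (Hl X + Hl Y)"
    then have ak: "a < n" "k < m" using that by (auto simp: Hl_def)
    have "monom 1 (jj a) \<cdot>\<^sub>m (X + Y) = monom 1 (jj a) \<cdot>\<^sub>m X + monom 1 (jj a) \<cdot>\<^sub>m Y"
      using that by (intro add_smult_distrib_left_mat[of _ p m]) auto
    moreover have r: "residue_mat p w (monom 1 (jj a) \<cdot>\<^sub>m X) \<in> carrier_mat p m"
      "residue_mat p w (monom 1 (jj a) \<cdot>\<^sub>m Y) \<in> carrier_mat p m"
      using that by auto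
    ultimately show "Hl (X + Y) $$ (a, k) = (Hl X + Hl Y) $$ (a, k)"
      using that ak La[OF ak(1)] by (simp add: Hl_def residue_mat_add[of _ p m] distrib_left carrier_matD[OF r(1)] carrier_matD[OF r(2)])
  qed (use that in \<open>auto simp: Hl_def\<close>)
  have Hl_const: "Hl (X * const_mat R) = Hl X * R" if X: "X \<in> carrier_mat p m" and R: "R \<in> carrier_mat m m'" for X R m m'
  proof (rule eq_matI)
    fix a k assume "a < dim_row (Hl X * R)" "k < dim_col (Hl X * R)"
    then have ak: "a < n" "k < m'" using that by (auto simp: Hl_def)
    have cR: "const_mat R \<in> carrier_mat m m'" using R by simp
    have mX: "monom 1 (jj a) \<cdot>\<^sub>m X \<in> carrier_mat p m" using X by simp
    have Z: "residue_mat p w (monom 1 (jj a) \<cdot>\<^sub>m X) \<in> carrier_mat p m" by (rule residue_mat_carrier[OF mX])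
    have "residue_mat p w (monom 1 (jj a) \<cdot>\<^sub>m (X * const_mat R)) = residue_mat p w (monom 1 (jj a) \<cdot>\<^sub>m X) * R"
      unfolding mult_smult_assoc_mat[OF X cR, symmetric] by (rule residue_mat_const[OF mX R])
    then have "Hl (X * const_mat R) $$ (a, k) =
        sg a * (-1) ^ jj a * (\<Sum>l<m. residue_mat p w (monom 1 (jj a) \<cdot>\<^sub>m X) $$ (kk a, l) * R $$ (l, k))"
      using ak R by (simp add: Hl_def mult_mat_entry[OF Z R La(1)[OF ak(1)] ak(2)] del: index_mult_mat(1))
    also have "\<dots> = (Hl X * R) $$ (a, k)"
      using ak X by (subst mult_mat_entry[OF _ R ak]) (auto simp: Hl_def sum_distrib_left mult.assoc)
    finally show "Hl (X * const_mat R) $$ (a, k) = (Hl X * R) $$ (a, k)" .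
  qed (use that in \<open>auto simp: Hl_def\<close>)
  have Hl_D: "Hl (D * Y) = 0\<^sub>m n m" if Y: "Y \<in> carrier_mat p m" for Y m
  proof (rule eq_matI)
    fix a k assume "a < dim_row (0\<^sub>m n m)" "k < dim_col (0\<^sub>m n m)"
    then have ak: "a < n" "k < m" by auto
    have "residue_mat p w (monom 1 (jj a) \<cdot>\<^sub>m (D * Y)) = 0\<^sub>m p m"
      unfolding mult_smult_distrib[OF D Y, symmetric] by (rule fraction_seq_mult[OF frac D]) (use Y in simp)
    then show "Hl (D * Y) $$ (a, k) = 0\<^sub>m n m $$ (a, k)" using ak Y La[OF ak(1)] by (simp add: Hl_def)
  qed (use Y in \<open>auto simp: Hl_def\<close>)
  have resE: "residue_mat p w (monom 1 m \<cdot>\<^sub>m E) $$ (i, b) = sg b * w i (kk b) (m + jj b)" if "i < p" "b < n" for i b m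
  proof -
    have "residue_mat p w (monom 1 m \<cdot>\<^sub>m E) $$ (i, b) = (\<Sum>j<p. residue_sum (w i j) (monom 1 m * E $$ (j, b)))"
      using that E by (simp add: residue_mat_def)
    also have "\<dots> = (\<Sum>j<p. if j = kk b then sg b * w i (kk b) (m + jj b) else 0)"
      using that by (intro sum.cong) (auto simp: Eia mult_monom residue_sum_monom)
    finally show ?thesis using La[OF that(2)] by simp
  qed
  have HlE: "Hl E = H"
    using E La by (intro eq_matI) (auto simp: Hl_def H_def gram_mat_def n_def resE[unfolded n_def] sg_def jj_def kk_def)
  have HlXE: "Hl ([:0, 1:] \<cdot>\<^sub>m E) $$ (a, b) = sg a * (-1) ^ jj a * sg b * w (kk a) (kk b) (jj a + jj b + 1)" if "a < n" "b < n" for a b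
  proof -
    have "monom 1 (jj a) \<cdot>\<^sub>m ([:0, 1:] \<cdot>\<^sub>m E) = monom 1 (Suc (jj a)) \<cdot>\<^sub>m E"
      by (intro eq_matI) (auto simp: monom_Suc)
    then show ?thesis using that E La[OF that(1)] by (simp add: Hl_def resE)
  qed
  have Hl1: "Hl (1\<^sub>m p) $$ (a, k) = sg a * (-1) ^ jj a * w (kk a) k (jj a)" if "a < n" "k < p" for a k
  proof -
    have "residue_mat p w (monom 1 (jj a) \<cdot>\<^sub>m 1\<^sub>m p) $$ (kk a, k) = (\<Sum>j<p. residue_sum (w (kk a) j) (if j = k then monom 1 (jj a) else 0))"
      using that La[OF that(1)] by (simp add: residue_mat_def if_distrib cong: if_cong)
    also have "\<dots> = (\<Sum>j<p. if j = k then w (kk a) k (jj a) else 0)"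
      by (intro sum.cong) (auto simp: residue_sum_monom)
    finally show ?thesis using that by (simp add: Hl_def)
  qed
  have HT: "H * T = Hl ([:0, 1:] \<cdot>\<^sub>m E)"
    unfolding eT Hl_add[OF mc(1,2)] Hl_D[OF Q] Hl_const[OF E T] HlE
    using right_add_zero_mat[OF mult_carrier_mat[OF H T]] by simp
  have HB: "H * B = Hl (1\<^sub>m p)"
    unfolding eB Hl_add[OF mc(3,4)] Hl_D[OF Q'] Hl_const[OF E B] HlE
    using right_add_zero_mat[OF mult_carrier_mat[OF H B]] by simp
  have sgc: "cnj (sg a) = sg a" for a by (simp add: sg_def)
  \<comment> \<open>\<open>w\<close> vanishes at odd indices, so a nonzero entry has
    \<open>jj a\<close> and \<open>jj b\<close> of equal parity and the sign may be taken from
    either.\<close>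
  have hH: "mat_adjoint H = H"
  proof (rule eq_matI)
    fix a b assume "a < dim_row H" "b < dim_col H"
    then have ab: "a < n" "b < n" using H by auto
    have "mat_adjoint H $$ (a, b) = sg b * (-1) ^ jj b * sg a * w (kk a) (kk b) (jj a + jj b)"
      using ab H herm[of "kk a" "kk b" "jj b + jj a"] La[OF ab(1)] La[OF ab(2)]
      by (simp add: H_def gram_mat_def n_def sg_def jj_def kk_def add.commute)
    also have "\<dots> = sg a * (-1) ^ jj a * sg b * w (kk a) (kk b) (jj a + jj b)"
      using odd[of "kk a" "kk b" "jj a + jj b"] La(1)[OF ab(1)] La(1)[OF ab(2)]
      by (cases "even (jj a)"; cases "even (jj b)") auto
    also have "\<dots> = H $$ (a, b)" using ab by (simp add: H_def gram_mat_def n_def sg_def jj_def kk_def)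
    finally show "mat_adjoint H $$ (a, b) = H $$ (a, b)" .
  qed (use H in auto)
  \<comment> \<open>Now the index is \<open>jj a + jj b + 1\<close>; nonzero entries have
    \<open>jj a\<close> and \<open>jj b\<close> of opposite parity, which supplies the minus sign.
    The index is at most \<open>2 * cm - 1\<close>, still within the range of
    \<open>herm\<close>.\<close>
  have skew: "H * T = - (mat_adjoint T * H)"
  proof -
    have HTc: "H * T \<in> carrier_mat n n" by (rule mult_carrier_mat[OF H T])
    have aT: "mat_adjoint T * H = mat_adjoint (H * T)" unfolding mat_adjoint_mult[OF H T] hH ..
    show ?thesis
    proof (rule eq_matI)
      fix a b assume "a < dim_row (- (mat_adjoint T * H))" "b < dim_col (- (mat_adjoint T * H))"
      then have ab: "a < n" "b < n" using H T by auto
      have "(- (mat_adjoint T * H)) $$ (a, b) = - cnj ((H * T) $$ (b, a))"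
        unfolding aT using ab carrier_matD[OF HTc] by (simp del: index_mult_mat(1))
      also have "\<dots> = - (sg b * (-1) ^ jj b * sg a * w (kk a) (kk b) (jj a + jj b + 1))"
        unfolding HT HlXE[OF ab(2,1)] using herm[of "kk a" "kk b" "jj b + jj a + 1"] La[OF ab(1)] La[OF ab(2)]
        by (simp add: sgc add.commute)
      also have "\<dots> = sg a * (-1) ^ jj a * sg b * w (kk a) (kk b) (jj a + jj b + 1)"
        using odd[of "kk a" "kk b" "jj a + jj b + 1"] La(1)[OF ab(1)] La(1)[OF ab(2)]
        by (cases "even (jj a)"; cases "even (jj b)") auto
      also have "\<dots> = (H * T) $$ (a, b)" unfolding HT HlXE[OF ab] ..
      finally show "(H * T) $$ (a, b) = (- (mat_adjoint T * H)) $$ (a, b)" by simp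
    qed (use H T in auto)
  qed
  have C_eq: "C = mat_adjoint B * H"
  proof -
    have HBc: "H * B \<in> carrier_mat n p" by (rule mult_carrier_mat[OF H B])
    have aB: "mat_adjoint B * H = mat_adjoint (H * B)" unfolding mat_adjoint_mult[OF H B] hH ..
    show ?thesis unfolding aB
    proof (rule eq_matI)
      fix k a assume "k < dim_row (mat_adjoint (H * B))" "a < dim_col (mat_adjoint (H * B))"
      then have ka: "k < p" "a < n" using H B by auto
      have "mat_adjoint (H * B) $$ (k, a) = sg a * (-1) ^ jj a * w k (kk a) (jj a)"
        using ka carrier_matD[OF HBc] herm[of k "kk a" "jj a"] La[OF ka(2)]
        by (simp add: HB Hl1 sgc del: index_mult_mat(1))
      also have "\<dots> = sg a * w k (kk a) (jj a)"
        using odd[of k "kk a" "jj a"] ka La[OF ka(2)] by (cases "even (jj a)") auto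
      also have "\<dots> = C $$ (k, a)"
      proof -
        have "monom 1 0 \<cdot>\<^sub>m E = E" by (intro eq_matI) auto
        then show ?thesis using resE[OF ka, of 0] by (simp add: C_def)
      qed
      finally show "C $$ (k, a) = mat_adjoint (H * B) $$ (k, a)" by simp
    qed (use C H B in auto)
  qed
  \<comment> \<open>\<open>CT m\<close> is \<open>C\<close> times the \<open>m\<close>-th power of
    \<open>T\<close>: the residue of \<open>\<lambda>^m W E\<close> sees only the remainder modulo
    \<open>D\<close>. Up to sign, row \<open>a\<close> of \<open>H\<close> is a row of
    \<open>CT (jj a)\<close>, so \<open>H\<close> consists of rows of observability
    matrices.\<close>
  define CT where "CT m = residue_mat p w (monom 1 m \<cdot>\<^sub>m E)" for m
  have CTc: "CT m \<in> carrier_mat p n" for m unfolding CT_def using E by (intro residue_mat_carrier) auto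
  have CT0: "CT 0 = C"
  proof -
    have "monom 1 0 \<cdot>\<^sub>m E = E" by (intro eq_matI) auto
    then show ?thesis by (simp add: CT_def C_def)
  qed
  have CTS: "CT (Suc m) = CT m * T" for m
  proof -
    have mE: "monom 1 m \<cdot>\<^sub>m E \<in> carrier_mat p n" and mQ: "monom 1 m \<cdot>\<^sub>m Q \<in> carrier_mat p n" using E Q by simp_all
    have "monom 1 (Suc m) \<cdot>\<^sub>m E = monom 1 m \<cdot>\<^sub>m ([:0, 1:] \<cdot>\<^sub>m E)"
      by (intro eq_matI) (auto simp: monom_Suc)
    also have "\<dots> = (monom 1 m \<cdot>\<^sub>m E) * const_mat T + D * (monom 1 m \<cdot>\<^sub>m Q)"
      unfolding eT add_smult_distrib_left_mat[OF mc(1,2)] mult_smult_assoc_mat[OF E cT] mult_smult_distrib[OF D Q] ..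
    finally show ?thesis
      unfolding CT_def using residue_mat_add[OF mult_carrier_mat[OF mE cT] mult_carrier_mat[OF D mQ], of w]
        fraction_seq_mult(1)[OF frac D mQ] residue_mat_const[OF mE T, of w]
        right_add_zero_mat[OF mult_carrier_mat[OF residue_mat_carrier[OF mE] T]] by simp
  qed
  have Hrow: "H $$ (a, b) = sg a * (-1) ^ jj a * CT (jj a) $$ (kk a, b)" if "a < n" "b < n" for a b
    using that E unfolding HlE[symmetric] by (simp add: Hl_def CT_def)
  \<comment> \<open>Remainder theorem for matrices: \<open>C T^m - \<lambda>^m C\<close> is a
    polynomial matrix times \<open>\<lambda> - T\<close>.\<close>
  have "\<exists>X. X \<in> carrier_mat p n \<and> const_mat (CT m) = monom 1 m \<cdot>\<^sub>m const_mat C + X * pencil T" for m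
  proof (induction m)
    case 0
    show ?case using cC T
      by (intro exI[of _ "0\<^sub>m p n"]) (auto simp: CT0 left_mult_zero_mat[of _ n n] intro!: eq_matI)
  next
    case (Suc m)
    then obtain X where X: "X \<in> carrier_mat p n" "const_mat (CT m) = monom 1 m \<cdot>\<^sub>m const_mat C + X * pencil T" by blast
    have pT: "pencil T \<in> carrier_mat n n" using T by simp
    define Z where "Z = const_mat T"
    have Z: "Z \<in> carrier_mat n n" using T by (simp add: Z_def)
    have comm: "pencil T * Z = Z * pencil T"
      unfolding pen[OF Z] Z_def[symmetric] unfolding pencil_alt[OF T] Z_def[symmetric] using Z
      by (simp add: minus_mult_distrib_mat[of _ n n _ _ n] mult_smult_assoc_mat[of _ n n _ n] left_mult_one_mat[of _ n n])
    define m1 where "m1 = (monom 1 m :: complex poly)"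
    have CTm: "const_mat (CT (Suc m)) = (m1 \<cdot>\<^sub>m const_mat C + X * pencil T) * Z"
      unfolding CTS const_mat_mult[OF CTc T] X(2) Z_def m1_def ..
    also have "\<dots> = m1 \<cdot>\<^sub>m (const_mat C * Z) + X * Z * pencil T"
      using X(1) pT Z cC comm
      by (simp add: add_mult_distrib_mat[of _ p n _ _ n] mult_smult_assoc_mat[of _ p n _ n] assoc_mult_mat[of _ p n _ n _ n]
         mult_carrier_mat[of _ p n _ n])
    also have "const_mat C * Z = [:0, 1:] \<cdot>\<^sub>m const_mat C - const_mat C * pencil T"
      unfolding pen[OF cC] Z_def[symmetric] using carrier_matD[OF mult_carrier_mat[OF cC Z]] carrier_matD[OF cC]
      by (intro eq_matI) (simp_all del: index_mult_mat)
    also have "m1 \<cdot>\<^sub>m ([:0, 1:] \<cdot>\<^sub>m const_mat C - const_mat C * pencil T) + X * Z * pencil T =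
       monom 1 (Suc m) \<cdot>\<^sub>m const_mat C + (X * Z - m1 \<cdot>\<^sub>m const_mat C) * pencil T"
    proof -
      have XZ: "X * Z \<in> carrier_mat p n" by (rule mult_carrier_mat[OF X(1) Z])
      have 1: "(X * Z - m1 \<cdot>\<^sub>m const_mat C) * pencil T = X * Z * pencil T - m1 \<cdot>\<^sub>m (const_mat C * pencil T)"
        using XZ cC pT by (simp add: minus_mult_distrib_mat[of _ p n _ _ n] mult_smult_assoc_mat[of _ p n _ n] del: assoc_mult_mat)
      have c1: "X * Z * pencil T \<in> carrier_mat p n" "const_mat C * pencil T \<in> carrier_mat p n"
        using mult_carrier_mat[OF XZ pT] mult_carrier_mat[OF cC pT] by auto
      have m1S: "monom 1 (Suc m) = m1 * [:0, 1:]" by (simp add: m1_def monom_Suc)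
      define K1 K2 where "K1 = X * Z * pencil T" and "K2 = const_mat C * pencil T"
      show ?thesis unfolding 1 m1S K1_def[symmetric] K2_def[symmetric]
        using c1[folded K1_def K2_def] carrier_matD[OF cC]
        by (intro eq_matI) (auto simp: right_diff_distrib mult.assoc)
    qed
    finally show ?case using mult_carrier_mat[OF X(1) Z] cC
      by (intro exI[of _ "X * Z - m1 \<cdot>\<^sub>m const_mat C"]) auto
  qed
  then obtain X where X: "\<And>m. X m \<in> carrier_mat p n" "\<And>m. const_mat (CT m) = monom 1 m \<cdot>\<^sub>m const_mat C + X m * pencil T"
    by metis
  have observable: "\<exists>X Y. X \<in> carrier_mat n n \<and> Y \<in> carrier_mat n p \<and> const_mat H = Y * const_mat C + X * pencil T"
  proof -
    define s where "s a = [:sg a * (-1) ^ jj a:]" for a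
    define Y where "Y = mat n p (\<lambda>(a, i). if i = kk a then s a * monom 1 (jj a) else 0)"
    define Z where "Z = mat n n (\<lambda>(a, b). s a * X (jj a) $$ (kk a, b))"
    have Y: "Y \<in> carrier_mat n p" and Z: "Z \<in> carrier_mat n n" by (simp_all add: Y_def Z_def)
    have pT: "pencil T \<in> carrier_mat n n" using T by simp
    have "const_mat H = Y * const_mat C + Z * pencil T"
    proof (rule eq_matI)
      fix a b assume "a < dim_row (Y * const_mat C + Z * pencil T)" "b < dim_col (Y * const_mat C + Z * pencil T)"
      then have ab: "a < n" "b < n" using Z T by (auto simp: char_poly_matrix_def)
      have ka: "kk a < p" by (rule La(1)[OF ab(1)])
      have "const_mat H $$ (a, b) = s a * const_mat (CT (jj a)) $$ (kk a, b)"
        using ab ka H carrier_matD[OF CTc] by (simp add: Hrow s_def)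
      also have "const_mat (CT (jj a)) $$ (kk a, b) = monom 1 (jj a) * const_mat C $$ (kk a, b) + (X (jj a) * pencil T) $$ (kk a, b)"
        unfolding X(2) using ka ab C T X(1)[of "jj a"] carrier_matD[OF mult_carrier_mat[OF X(1)[of "jj a"] pT]]
        by (simp del: index_mult_mat(1))
      also have "(X (jj a) * pencil T) $$ (kk a, b) = (\<Sum>l<n. X (jj a) $$ (kk a, l) * pencil T $$ (l, b))"
        by (rule mult_mat_entry[OF X(1) pT ka ab(2)])
      finally have 1: "const_mat H $$ (a, b) = s a * monom 1 (jj a) * const_mat C $$ (kk a, b) +
          (\<Sum>l<n. s a * X (jj a) $$ (kk a, l) * pencil T $$ (l, b))"
        by (simp add: distrib_left sum_distrib_left mult.assoc)
      have "(Y * const_mat C) $$ (a, b) = (\<Sum>i<p. Y $$ (a, i) * const_mat C $$ (i, b))"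
        by (rule mult_mat_entry[OF Y cC ab])
      also have "\<dots> = (\<Sum>i<p. if i = kk a then s a * monom 1 (jj a) * const_mat C $$ (i, b) else 0)"
        using ab by (intro sum.cong) (auto simp: Y_def)
      finally have "(Y * const_mat C) $$ (a, b) = (\<Sum>i<p. if i = kk a then s a * monom 1 (jj a) * const_mat C $$ (i, b) else 0)" .
      then have 2: "(Y * const_mat C) $$ (a, b) = s a * monom 1 (jj a) * const_mat C $$ (kk a, b)" using ka by simp
      have 3: "(Z * pencil T) $$ (a, b) = (\<Sum>l<n. s a * X (jj a) $$ (kk a, l) * pencil T $$ (l, b))"
        using ab by (subst mult_mat_entry[OF Z pT ab]) (auto simp: Z_def intro!: sum.cong)
      show "const_mat H $$ (a, b) = (Y * const_mat C + Z * pencil T) $$ (a, b)"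
        unfolding 1 using ab carrier_matD[OF mult_carrier_mat[OF Y cC]] carrier_matD[OF mult_carrier_mat[OF Z pT]]
        by (simp add: 2 3 del: index_mult_mat(1))
    qed (use H Y Z T in \<open>auto simp: char_poly_matrix_def\<close>)
    then show ?thesis using Y Z by blast
  qed
  \<comment> \<open>An invariant set inside the kernel of \<open>C\<close> is annihilated by all
    \<open>CT m\<close>, hence by the rows of \<open>H\<close>.\<close>
  have unobs: "H *\<^sub>v x = 0\<^sub>v n"
    if W: "\<And>y. W y \<Longrightarrow> y \<in> carrier_vec n \<and> C *\<^sub>v y = 0\<^sub>v p \<and> W (T *\<^sub>v y)" and x: "W x" for W x
  proof -
    have CTx: "CT m *\<^sub>v y = 0\<^sub>v p" if "W y" for m y
      using that
    proof (induction m arbitrary: y)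
      case 0
      then show ?case using W by (simp add: CT0)
    next
      case (Suc m)
      have y: "y \<in> carrier_vec n" "W (T *\<^sub>v y)" using W[OF Suc.prems] by auto
      have "CT (Suc m) *\<^sub>v y = CT m *\<^sub>v (T *\<^sub>v y)" unfolding CTS by (rule assoc_mult_mat_vec[OF CTc T y(1)])
      then show ?case using Suc.IH[OF y(2)] by simp
    qed
    have xc: "x \<in> carrier_vec n" using W[OF x] by simp
    show ?thesis
    proof (rule eq_vecI)
      fix a assume "a < dim_vec (0\<^sub>v n)"
      then have a: "a < n" by simp
      have "(H *\<^sub>v x) $ a = (\<Sum>b<n. H $$ (a, b) * x $ b)"
        using a H xc by (simp add: scalar_prod_def lessThan_atLeast0)
      also have "\<dots> = sg a * (-1) ^ jj a * (\<Sum>b<n. CT (jj a) $$ (kk a, b) * x $ b)"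
        using a by (simp add: Hrow sum_distrib_left mult.assoc)
      also have "(\<Sum>b<n. CT (jj a) $$ (kk a, b) * x $ b) = (CT (jj a) *\<^sub>v x) $ kk a"
        using La(1)[OF a] carrier_matD[OF CTc] xc by (simp add: scalar_prod_def lessThan_atLeast0)
      finally show "(H *\<^sub>v x) $ a = 0\<^sub>v n $ a" using CTx[OF x] La(1)[OF a] a by simp
    qed (use H in auto)
  qed
  have "realization p n D S E M Q Q' T B C H"
  proof (rule realization.intro)
    fix W x
    assume a: "\<And>y. W y \<Longrightarrow> y \<in> carrier_vec n \<and> C *\<^sub>v y = 0\<^sub>v p \<and> W (T *\<^sub>v y)" and "W x"
    then show "H *\<^sub>v x = 0\<^sub>v n" by (rule unobs)
  qed (fact E T Q B Q' C M H D S E_pencil eB[symmetric] S_Q S_Q' hH skew C_eq observable detD[folded n_def] detF[folded n_def])+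
  then show ?thesis unfolding n_def H_def by blast
qed

section \<open>Markov parameters and block Hankel matrices\<close>

text \<open>Links the formal operations to analysis: the coefficient of \<open>z^-(n+1)\<close> in
  \<open>W x\<close> is the residue of \<open>\<lambda>^n W x\<close>. In the Horner step the series
  is shifted by one index, and its dropped first term becomes the constant term of the polynomial
  part.\<close>

lemma residue_sum_expansion:
  assumes W: "(\<lambda>n. w n * (1 / z) ^ Suc n) sums W" and z: "z \<noteq> 0"
  shows "(\<lambda>n. residue_sum w (monom 1 n * x) * (1 / z) ^ Suc n) sums (W * poly x z - poly (poly_part w x) z)"
proof (induction x)
  case 0
  then show ?case by simp
next
  case (pCons a x)
  let ?r = "\<lambda>n. residue_sum w (monom 1 n * x)"
  have r: "residue_sum w (monom 1 n * pCons a x) = a * w n + ?r (Suc n)" for n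
  proof -
    have "monom 1 n * pCons a x = smult a (monom 1 n) + monom 1 (Suc n) * x"
      by (simp add: pCons_one[symmetric] monom_Suc)
    then show ?thesis by (simp add: residue_sum_add residue_sum_smult residue_sum_monom)
  qed
  define V where "V = W * poly x z - poly (poly_part w x) z"
  have "(\<lambda>n. ?r (Suc n) * (1 / z) ^ Suc (Suc n)) sums (V - ?r 0 * (1 / z))"
    by (subst sums_Suc_iff[of "\<lambda>n. ?r n * (1 / z) ^ Suc n"]) (use pCons.IH in \<open>simp add: V_def\<close>)
  from sums_mult[OF this, of z]
  have "(\<lambda>n. ?r (Suc n) * (1 / z) ^ Suc n) sums (z * (V - ?r 0 * (1 / z)))"
    using z by (simp add: mult_ac)
  from sums_add[OF sums_mult[OF W, of a] this]
  have "(\<lambda>n. residue_sum w (monom 1 n * pCons a x) * (1 / z) ^ Suc n) sums (a * W + z * (V - ?r 0 * (1 / z)))"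
    unfolding r by (simp only: distrib_right mult.assoc)
  moreover have "a * W + z * (V - ?r 0 * (1 / z)) = W * poly (pCons a x) z - poly (poly_part w (pCons a x)) z"
    using z by (simp add: poly_part_pCons V_def algebra_simps)
  ultimately show ?case by simp
qed

text \<open>The sum is known only for \<open>u \<noteq> 0\<close>, since \<open>u\<close> will be
  \<open>1 / z\<close>; so the constant coefficient is read off as a limit and the others after
  dividing by \<open>u\<close>.\<close>

lemma power_series_eq_0:
  fixes b :: "nat \<Rightarrow> complex"
  assumes s: "0 < s" and b: "\<And>u. u \<noteq> 0 \<Longrightarrow> norm u < s \<Longrightarrow> (\<lambda>n. b n * u ^ n) sums 0"
  shows "b n = 0"
  using b
proof (induction n arbitrary: b)
  case (0 b)
  have "((\<lambda>u. 0) \<longlongrightarrow> b 0) (at (0 :: complex))"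
    by (rule powser_limit_0_strong[OF s]) (use 0 in auto)
  then show ?case by (simp add: tendsto_const_iff)
next
  case (Suc n b)
  have "((\<lambda>u. 0) \<longlongrightarrow> b 0) (at (0 :: complex))"
    by (rule powser_limit_0_strong[OF s]) (use Suc.prems in auto)
  then have b0: "b 0 = 0" by (simp add: tendsto_const_iff)
  have "b (Suc n) = 0"
  proof (rule Suc.IH[of "\<lambda>n. b (Suc n)"])
    fix u :: complex assume u: "u \<noteq> 0" "norm u < s"
    have "(\<lambda>n. b (Suc n) * u ^ Suc n) sums 0"
      using Suc.prems[OF u] b0 by (subst sums_Suc_iff) simp
    from sums_mult[OF this, of "1 / u"] show "(\<lambda>n. b (Suc n) * u ^ n) sums 0" using u by simp
  qed
  then show ?case .
qed

text \<open>With \<open>u = 1 / z\<close> and \<open>d\<close> the degree of \<open>q\<close>,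
  \<open>u^d q(1 / u)\<close> is the reversed polynomial, whose value at \<open>0\<close> is the
  leading coefficient of \<open>q\<close>. The series side has a factor \<open>u\<close> and tends
  to \<open>0\<close>, so that coefficient is zero.\<close>

lemma polynomial_eq_strictly_proper_series:
  fixes q :: "complex poly"
  assumes ev: "\<forall>\<^sub>F z in at_infinity. (\<lambda>n. b n * (1 / z) ^ Suc n) sums poly q z"
  shows "q = 0" "b n = 0"
proof -
  obtain r where r: "\<And>z. norm z \<ge> r \<Longrightarrow> (\<lambda>n. b n * (1 / z) ^ Suc n) sums poly q z"
    using ev unfolding eventually_at_infinity by blast
  define m where "m = max r 1"
  have m: "m \<ge> r" "m > 0" by (simp_all add: m_def)
  define s where "s = 1 / m"
  have s: "0 < s" using m by (simp add: s_def)
  have sm: "(\<lambda>n. b n * u ^ Suc n) sums poly q (1 / u)" if "u \<noteq> 0" "norm u < s" for u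
  proof -
    have "norm u * m < 1" using that(2) m by (simp add: s_def field_simps)
    then have "m < 1 / norm u" using that(1) by (simp add: field_simps)
    then have "norm (1 / u) \<ge> r" using m(1) by (simp add: norm_divide)
    from r[OF this] show ?thesis by simp
  qed
  have sm': "(\<lambda>n. b n * u ^ n) sums (poly q (1 / u) / u)" if "u \<noteq> 0" "norm u < s" for u
    using sums_mult[OF sm[OF that], of "1 / u"] that by (simp add: mult_ac)
  define d where "d = degree q"
  have "((\<lambda>u. poly q (1 / u) / u) \<longlongrightarrow> b 0) (at 0)"
    by (rule powser_limit_0_strong[OF s sm'])
  then have "((\<lambda>u. u ^ Suc d * (poly q (1 / u) / u)) \<longlongrightarrow> 0 ^ Suc d * b 0) (at 0)"
    by (intro tendsto_mult tendsto_power tendsto_ident_at)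
  moreover have "\<forall>\<^sub>F u in at 0. u ^ Suc d * (poly q (1 / u) / u) = poly (reflect_poly q) u"
    by (auto simp: eventually_at_filter poly_reflect_poly_nz d_def inverse_eq_divide)
  ultimately have "((\<lambda>u. poly (reflect_poly q) u) \<longlongrightarrow> 0) (at 0)"
    using Lim_transform_eventually by fastforce
  moreover have "((\<lambda>u. poly (reflect_poly q) u) \<longlongrightarrow> poly (reflect_poly q) 0) (at 0)"
    by (intro tendsto_intros)
  ultimately have "poly (reflect_poly q) 0 = 0" using tendsto_unique at_neq_bot by blast
  then show q: "q = 0" by (simp add: poly_reflect_poly_0)
  show "b n = 0" by (rule power_series_eq_0[OF s]) (use sm' q in simp)
qed

text \<open>Expanding \<open>W D = S\<close> near infinity equates a strictly proper series with a
  polynomial, so both vanish. This converts the analytic quotient into coefficient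
  identities.\<close>

lemma fraction_seqI:
  assumes D: "D \<in> carrier_mat p p" and S: "S \<in> carrier_mat p p"
    and W: "\<And>i j. i < p \<Longrightarrow> j < p \<Longrightarrow> \<forall>\<^sub>F z in at_infinity. (\<lambda>n. w i j n * (1 / z) ^ Suc n) sums W i j z"
    and WDS: "\<And>i k. i < p \<Longrightarrow> k < p \<Longrightarrow>
      \<forall>\<^sub>F z in at_infinity. (\<Sum>j<p. W i j z * poly (D $$ (j, k)) z) = poly (S $$ (i, k)) z"
  shows "fraction_seq p w D S"
proof -
  have main: "S $$ (i, k) - (\<Sum>j<p. poly_part (w i j) (D $$ (j, k))) = 0"
    "(\<Sum>j<p. residue_sum (w i j) (monom 1 n * D $$ (j, k))) = 0" if ik: "i < p" "k < p" for i k n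
  proof -
    have "\<forall>\<^sub>F z in at_infinity. \<forall>j\<in>{..<p}. (\<lambda>n. w i j n * (1 / z) ^ Suc n) sums W i j z"
      by (intro eventually_ball_finite) (use W ik in auto)
    moreover note WDS[OF ik]
    moreover have "\<forall>\<^sub>F z :: complex in at_infinity. z \<noteq> 0" by (rule eventually_not_equal_at_infinity)
    ultimately have ev: "\<forall>\<^sub>F z in at_infinity.
        (\<lambda>n. (\<Sum>j<p. residue_sum (w i j) (monom 1 n * D $$ (j, k))) * (1 / z) ^ Suc n) sums
        poly (S $$ (i, k) - (\<Sum>j<p. poly_part (w i j) (D $$ (j, k)))) z"
    proof eventually_elim
      case (elim z)
      have "(\<lambda>n. \<Sum>j<p. residue_sum (w i j) (monom 1 n * D $$ (j, k)) * (1 / z) ^ Suc n) sums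
          (\<Sum>j<p. W i j z * poly (D $$ (j, k)) z - poly (poly_part (w i j) (D $$ (j, k))) z)"
        by (intro sums_sum residue_sum_expansion) (use elim in auto)
      then show ?case using elim(2) by (simp add: sum_distrib_right sum_divide_distrib sum_subtractf poly_sum)
    qed
    show "S $$ (i, k) - (\<Sum>j<p. poly_part (w i j) (D $$ (j, k))) = 0"
      "(\<Sum>j<p. residue_sum (w i j) (monom 1 n * D $$ (j, k))) = 0"
      using polynomial_eq_strictly_proper_series[OF ev] by simp_all
  qed
  show ?thesis unfolding fraction_seq_def
  proof (intro conjI allI)
    show "poly_part_mat p w D = S"
      using main(1) D S by (intro eq_matI) (auto simp: poly_part_mat_def)
    show "residue_mat p w (monom 1 m \<cdot>\<^sub>m D) = 0\<^sub>m p p" for m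
      using main(2) D by (intro eq_matI) (auto simp: residue_mat_def)
  qed
qed

section \<open>Degrees and determinants of column reduced matrices\<close>

lemma coeff_prod_top:
  fixes f :: "'b \<Rightarrow> 'a :: comm_ring_1 poly"
  assumes "finite I" "\<And>i. i \<in> I \<Longrightarrow> degree (f i) \<le> d i"
  shows "degree (prod f I) \<le> sum d I \<and> coeff (prod f I) (sum d I) = (\<Prod>i\<in>I. coeff (f i) (d i))"
  using assms
proof (induction I rule: finite_induct)
  case empty
  then show ?case by simp
next
  case (insert i I)
  have top: "coeff (g * h) (m + k) = coeff g m * coeff h k" if "degree g \<le> m" "degree h \<le> k" for g h :: "'a poly" and m k
  proof -
    have "coeff (g * h) (m + k) = (\<Sum>t\<le>m + k. coeff g t * coeff h (m + k - t))" by (simp add: coeff_mult)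
    also have "\<dots> = (\<Sum>t\<le>m + k. if t = m then coeff g m * coeff h k else 0)"
    proof (intro sum.cong refl)
      fix t assume "t \<in> {..m + k}"
      consider "t < m" | "t = m" | "t > m" by linarith
      then show "coeff g t * coeff h (m + k - t) = (if t = m then coeff g m * coeff h k else 0)"
      proof cases
        case 1
        then have "degree h < m + k - t" using that by linarith
        then show ?thesis using 1 by (simp add: coeff_eq_0)
      next
        case 3
        then have "degree g < t" using that by linarith
        then show ?thesis using 3 by (simp add: coeff_eq_0)
      qed simp
    qed
    finally show ?thesis by simp
  qed
  have "degree (f i) \<le> d i" "degree (prod f I) \<le> sum d I" using insert by auto
  moreover from this have "degree (f i * prod f I) \<le> d i + sum d I"
    using degree_mult_le[of "f i" "prod f I"] by linarith
  ultimately show ?case using insert top[of "f i" "d i" "prod f I" "sum d I"] by simp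
qed

text \<open>In the Leibniz expansion every product has degree at most the sum of the
  \<open>c k\<close>, and its coefficient there is the corresponding product of leading column
  coefficients; together these form the determinant of the leading coefficient matrix.\<close>

lemma degree_det_columns:
  fixes A :: "complex poly mat"
  assumes A: "A \<in> carrier_mat p p" and deg: "\<And>i k. i < p \<Longrightarrow> k < p \<Longrightarrow> degree (A $$ (i, k)) \<le> c k"
    and nz: "det (mat p p (\<lambda>(i, k). coeff (A $$ (i, k)) (c k))) \<noteq> 0"
  shows "degree (det A) = (\<Sum>k<p. c k)" "det A \<noteq> 0"
proof -
  let ?L = "mat p p (\<lambda>(i, k). coeff (A $$ (i, k)) (c k))"
  let ?c = "\<Sum>k<p. c k"
  have perm: "(\<Sum>i = 0..<p. c (\<pi> i)) = ?c" if "\<pi> permutes {0..<p}" for \<pi>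
    using sum.permute[OF that, of c] by (simp add: o_def lessThan_atLeast0)
  have prod: "degree (\<Prod>i = 0..<p. A $$ (i, \<pi> i)) \<le> ?c"
    "coeff (\<Prod>i = 0..<p. A $$ (i, \<pi> i)) ?c = (\<Prod>i = 0..<p. ?L $$ (i, \<pi> i))" if "\<pi> permutes {0..<p}" for \<pi>
  proof -
    have lt: "\<pi> i < p" if "i < p" for i using permutes_in_image[OF \<open>\<pi> permutes _\<close>, of i] that by simp
    have "\<And>i. i \<in> {0..<p} \<Longrightarrow> degree (A $$ (i, \<pi> i)) \<le> c (\<pi> i)" using deg lt by simp
    from coeff_prod_top[of "{0..<p}" "\<lambda>i. A $$ (i, \<pi> i)" "\<lambda>i. c (\<pi> i)", OF _ this] perm[OF \<open>\<pi> permutes _\<close>]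
    have "degree (\<Prod>i = 0..<p. A $$ (i, \<pi> i)) \<le> ?c" "coeff (\<Prod>i = 0..<p. A $$ (i, \<pi> i)) ?c = (\<Prod>i = 0..<p. coeff (A $$ (i, \<pi> i)) (c (\<pi> i)))"
      by auto
    then show "degree (\<Prod>i = 0..<p. A $$ (i, \<pi> i)) \<le> ?c"
      "coeff (\<Prod>i = 0..<p. A $$ (i, \<pi> i)) ?c = (\<Prod>i = 0..<p. ?L $$ (i, \<pi> i))"
      using lt by (auto intro!: prod.cong)
  qed
  have det: "det A = (\<Sum>\<pi> | \<pi> permutes {0..<p}. signof \<pi> * (\<Prod>i = 0..<p. A $$ (i, \<pi> i)))" by (rule det_def'[OF A])
  have le: "degree (det A) \<le> ?c"
    unfolding det
  proof (rule degree_sum_le)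
    fix \<pi> assume "\<pi> \<in> {\<pi>. \<pi> permutes {0..<p}}"
    then show "degree (signof \<pi> * (\<Prod>i = 0..<p. A $$ (i, \<pi> i))) \<le> ?c"
      using prod(1) by simp
  qed (rule finite_permutations, simp)
  have sg: "coeff (signof \<pi> * f) n = signof \<pi> * coeff f n" for \<pi> :: "nat \<Rightarrow> nat" and f :: "complex poly" and n
    by (cases "evenperm \<pi>") (auto simp: sign_def)
  have "coeff (det A) ?c = (\<Sum>\<pi> | \<pi> permutes {0..<p}. signof \<pi> * (\<Prod>i = 0..<p. ?L $$ (i, \<pi> i)))"
    unfolding det coeff_sum sg using prod(2) by (intro sum.cong) auto
  also have "\<dots> = det ?L" by (rule det_def'[symmetric]) simp
  finally have co: "coeff (det A) ?c \<noteq> 0" using nz by simp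
  then show "degree (det A) = ?c" using le le_degree[of "det A" ?c] by simp
  show "det A \<noteq> 0" using co by auto
qed

lemma dominant_part_carrier [simp]: "F \<in> carrier_mat p q \<Longrightarrow> dominant_part F \<in> carrier_mat p q"
  by (simp add: dominant_part_def)

lemma subordinated_part_carrier [simp]: "F \<in> carrier_mat p q \<Longrightarrow> subordinated_part F \<in> carrier_mat p q"
  by (simp add: subordinated_part_def)

lemma parts_carrier [simp]:
  assumes "F \<in> carrier_mat p q"
  shows "D_part F \<in> carrier_mat p q" "S_part F \<in> carrier_mat p q"
  using assms
  by (auto simp: D_part_def S_part_def subst_square_def dominant_part_def subordinated_part_def alpha_mat_def mat_diag_def)

lemma D_part_index:
  assumes F: "F \<in> carrier_mat p q" and ik: "i < p" "k < q"
  shows "D_part F $$ (i, k) =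
    pcompose (dominant_part F $$ (i, k)) ([:0, 1:] ^ 2) * (if even (cdeg F k) then 1 else [:0, 1:])"
proof -
  have "subst_square (dominant_part F) \<in> carrier_mat p q" using F by (simp add: subst_square_def)
  then show ?thesis
    unfolding D_part_def alpha_mat_def using F ik
    by (subst mat_diag_mult_right[where nr = p]) (auto simp: subst_square_def dominant_part_def)
qed

lemma S_part_index_mult:
  assumes F: "F \<in> carrier_mat p q" and ik: "i < p" "k < q"
  shows "[:0, 1:] * S_part F $$ (i, k) =
    pcompose (subordinated_part F $$ (i, k)) ([:0, 1:] ^ 2) * (if even (cdeg F k) then 1 else [:0, 1:])"
proof -
  have "subst_square (subordinated_part F) \<in> carrier_mat p q" using F by (simp add: subst_square_def)
  then have "(subst_square (subordinated_part F) * alpha_mat F) $$ (i, k) =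
      pcompose (subordinated_part F $$ (i, k)) ([:0, 1:] ^ 2) * (if even (cdeg F k) then 1 else [:0, 1:])"
    unfolding alpha_mat_def using F ik
    by (subst mat_diag_mult_right[where nr = p]) (auto simp: subst_square_def subordinated_part_def)
  then show ?thesis using arg_cong[OF S_part_exact[of F], of "\<lambda>X. X $$ (i, k)"] F ik parts_carrier[OF F] by simp
qed

text \<open>The parity kept in column \<open>k\<close> is that of \<open>cdeg F k\<close>, so
  \<open>D\<close> inherits all leading column coefficients of \<open>F\<close>.\<close>

lemma coeff_D_part:
  assumes F: "F \<in> carrier_mat p q" and ik: "i < p" "k < q"
  shows "coeff (D_part F $$ (i, k)) n = (if even n = even (cdeg F k) then coeff (F $$ (i, k)) n else 0)"
  unfolding D_part_index[OF assms] using F ik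
  by (cases n) (auto simp: dominant_part_def coeff_pcompose_square coeff_even_part coeff_odd_part coeff_pCons
      mult.commute[of _ "[:0, 1:]"] simp del: coeff_pcompose_0 elim!: evenE oddE)

lemma hcdc_index: "F \<in> carrier_mat p p \<Longrightarrow> hcdc F = mat p p (\<lambda>(i, k). coeff (F $$ (i, k)) (cdeg F k))"
  by (auto simp: hcdc_def)

lemma hcdc_diag_nonzero:
  assumes F: "F \<in> carrier_mat p p" "column_reduced F" "upper_triangular (hcdc F)" and k: "k < p"
  shows "coeff (F $$ (k, k)) (cdeg F k) \<noteq> 0"
proof -
  have c: "hcdc F \<in> carrier_mat p p" using F by (simp add: hcdc_def)
  have "0 \<notin> set (diag_mat (hcdc F))"
    using F det_upper_triangular[OF F(3) c] unfolding column_reduced_def by (simp add: prod_list_zero_iff)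
  then have "hcdc F $$ (k, k) \<noteq> 0" using c k by (auto simp: diag_mat_def)
  then show ?thesis using F k by (simp add: hcdc_def)
qed

text \<open>The half degree is attained in row \<open>k\<close>, because triangularity and
  nonsingularity make the leading coefficient on the diagonal nonzero.\<close>

lemma cdeg_dominant_part:
  assumes F: "F \<in> carrier_mat p p" "column_reduced F" "upper_triangular (hcdc F)" and k: "k < p"
  shows "cdeg (dominant_part F) k = cdeg F k div 2"
proof -
  have co: "coeff (dominant_part F $$ (i, k)) n = coeff (F $$ (i, k)) (2 * n + (if even (cdeg F k) then 0 else 1))" if "i < p" for i n
    using that F k by (simp add: dominant_part_def coeff_even_part coeff_odd_part)
  have le: "degree (dominant_part F $$ (i, k)) \<le> cdeg F k div 2" if i: "i < p" for i
  proof (rule degree_le, intro allI impI)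
    fix n assume "cdeg F k div 2 < n"
    then have "degree (F $$ (i, k)) < 2 * n + (if even (cdeg F k) then 0 else 1)"
      using hcdc_decomposition(1)[of i F k] F i k by auto
    then show "coeff (dominant_part F $$ (i, k)) n = 0" unfolding co[OF i] by (simp add: coeff_eq_0)
  qed
  have "2 * (cdeg F k div 2) + (if even (cdeg F k) then 0 else 1) = cdeg F k" by auto
  then have "coeff (dominant_part F $$ (k, k)) (cdeg F k div 2) \<noteq> 0"
    using co[OF k, of "cdeg F k div 2"] hcdc_diag_nonzero[OF F k] by simp
  then have "cdeg F k div 2 \<le> degree (dominant_part F $$ (k, k))" by (rule le_degree)
  with le[OF k] have eq: "degree (dominant_part F $$ (k, k)) = cdeg F k div 2" by simp
  have "dim_row (dominant_part F) = p" using F by (simp add: dominant_part_def)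
  then show ?thesis unfolding cdeg_def[of "dominant_part F"] using le eq k
    by (intro Max_eqI) (auto intro!: image_eqI[of _ _ k])
qed

text \<open>The coefficients of \<open>S D\<^sup>-\<^sup>1 = \<lambda>\<^sup>-\<^sup>1 R\<^sub>F(\<lambda>\<^sup>2)\<close> at infinity.\<close>

definition markov_seq :: "(nat \<Rightarrow> complex mat) \<Rightarrow> nat \<Rightarrow> nat \<Rightarrow> nat \<Rightarrow> complex" where
  "markov_seq s i j m = (if even m then (-1) ^ (m div 2) * s (m div 2) $$ (i, j) else 0)"

lemma eval_det: "poly (det A) z = det (eval_mat A z)"
proof -
  have "comm_ring_hom (\<lambda>f :: complex poly. poly f z)" by unfold_locales auto
  then show ?thesis unfolding eval_mat_def by (rule comm_ring_hom.hom_det[symmetric])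
qed

lemma R_value_mult:
  assumes F: "F \<in> carrier_mat p p" and nz: "poly (det (dominant_part F)) z \<noteq> 0" and ik: "i < p" "k < p"
  shows "(\<Sum>j<p. R_value F z $$ (i, j) * poly (dominant_part F $$ (j, k)) z) = poly (subordinated_part F $$ (i, k)) z"
proof -
  let ?D = "eval_mat (dominant_part F) z" and ?S = "eval_mat (subordinated_part F) z"
  have D: "?D \<in> carrier_mat p p" and S: "?S \<in> carrier_mat p p" using F by (simp_all add: eval_mat_def)
  have "det ?D \<noteq> 0" using nz by (simp add: eval_det)
  then have "?D \<in> Units (ring_mat TYPE(complex) p ())" by (rule det_non_zero_imp_unit[OF D])
  then obtain B where B': "mat_inverse ?D = Some B" using mat_inverse(1)[OF D, of "()"] by (cases "mat_inverse ?D") auto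
  then have B: "B \<in> carrier_mat p p" "B * ?D = 1\<^sub>m p" using mat_inverse(2)[OF D] by auto
  have "R_value F z * ?D = ?S"
    unfolding R_value_def B' option.sel using B S D by (simp add: assoc_mult_mat[of _ p p _ p _ p])
  moreover have R: "R_value F z \<in> carrier_mat p p" unfolding R_value_def B' option.sel by (rule mult_carrier_mat[OF S B(1)])
  ultimately have "(\<Sum>j<p. R_value F z $$ (i, j) * ?D $$ (j, k)) = ?S $$ (i, k)"
    using mult_mat_entry[OF R D ik] by simp
  then show ?thesis using F ik by (simp add: eval_mat_def dominant_part_def subordinated_part_def)
qed

text \<open>\<open>D\<close> and \<open>S\<close> are \<open>F_d(z^2)\<close> and
  \<open>F_s(z^2) / z\<close> times the same diagonal factor, so their quotient is
  \<open>R_F(z^2) / z\<close>. Its expansion contains only the powers \<open>z^-(2k+1)\<close>,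
  which is why \<open>markov_seq\<close> vanishes at odd indices.\<close>

lemma markov_fraction_seq:
  assumes F: "F \<in> carrier_mat p p" and nz: "det (dominant_part F) \<noteq> 0" and m: "markov_expansion F s"
  shows "fraction_seq p (markov_seq s) (D_part F) (S_part F)"
proof (rule fraction_seqI)
  show "D_part F \<in> carrier_mat p p" "S_part F \<in> carrier_mat p p" using F by simp_all
  have lim: "filterlim (\<lambda>z :: complex. z ^ 2) at_infinity at_infinity"
    by (intro filterlim_power_at_infinity filterlim_ident) simp
  fix i j assume ij: "i < p" "j < p"
  have "\<forall>\<^sub>F z in at_infinity. (\<lambda>k. (-1) ^ k * (1 / z ^ k) * s k $$ (i, j)) sums (R_value F z $$ (i, j))"
    using m F ij unfolding markov_expansion_def by auto
  from eventually_compose_filterlim[OF this lim] eventually_not_equal_at_infinity[of 0]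
  show "\<forall>\<^sub>F z in at_infinity. (\<lambda>n. markov_seq s i j n * (1 / z) ^ Suc n) sums (R_value F (z ^ 2) $$ (i, j) / z)"
  proof eventually_elim
    case (elim z)
    have sq: "(z ^ 2) ^ k = z ^ (k * 2)" for k by (simp add: power_mult[symmetric] mult.commute)
    have "(\<lambda>k. markov_seq s i j (2 * k) * (1 / z) ^ Suc (2 * k)) sums (R_value F (z ^ 2) $$ (i, j) / z)"
      using sums_divide[OF elim(1), of z] by (simp add: markov_seq_def sq power_one_over mult_ac)
    then show ?case
      by (subst (asm) sums_mono_reindex[of "\<lambda>k. 2 * k" "\<lambda>n. markov_seq s i j n * (1 / z) ^ Suc n"])
        (auto simp: strict_mono_def markov_seq_def image_iff elim!: evenE)
  qed
next
  fix i k assume ik: "i < p" "k < p"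
  have lim: "filterlim (\<lambda>z :: complex. z ^ 2) at_infinity at_infinity"
    by (intro filterlim_power_at_infinity filterlim_ident) simp
  have "\<forall>\<^sub>F z :: complex in at_infinity. \<forall>a\<in>{z. poly (det (dominant_part F)) z = 0}. z \<noteq> a"
    by (intro eventually_ball_finite) (auto simp: poly_roots_finite[OF nz] eventually_not_equal_at_infinity)
  then have "\<forall>\<^sub>F z :: complex in at_infinity. poly (det (dominant_part F)) z \<noteq> 0"
    by (rule eventually_mono) auto
  from eventually_compose_filterlim[OF this lim] eventually_not_equal_at_infinity[of 0]
  show "\<forall>\<^sub>F z in at_infinity. (\<Sum>j<p. R_value F (z ^ 2) $$ (i, j) / z * poly (D_part F $$ (j, k)) z) = poly (S_part F $$ (i, k)) z"
  proof eventually_elim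
    case (elim z)
    define a where "a = (if even (cdeg F k) then 1 else z)"
    have D: "poly (D_part F $$ (j, k)) z = poly (dominant_part F $$ (j, k)) (z ^ 2) * a" if "j < p" for j
      unfolding D_part_index[OF F that ik(2)] by (simp add: poly_pcompose a_def)
    have S: "z * poly (S_part F $$ (i, k)) z = poly (subordinated_part F $$ (i, k)) (z ^ 2) * a"
      using arg_cong[OF S_part_index_mult[OF F ik], of "\<lambda>f. poly f z"] by (simp add: poly_pcompose a_def)
    have "(\<Sum>j<p. R_value F (z ^ 2) $$ (i, j) / z * poly (D_part F $$ (j, k)) z) =
        (\<Sum>j<p. R_value F (z ^ 2) $$ (i, j) * poly (dominant_part F $$ (j, k)) (z ^ 2)) * a / z"
      by (simp add: D sum_distrib_left sum_divide_distrib mult_ac)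
    also have "\<dots> = poly (S_part F $$ (i, k)) z"
      unfolding R_value_mult[OF F elim(1) ik] S[symmetric] using elim(2) by simp
    finally show ?case .
  qed
qed

section \<open>Block Hankel matrices as Gram matrices\<close>

definition list_mat :: "'b list \<Rightarrow> 'b list \<Rightarrow> ('b \<Rightarrow> 'b \<Rightarrow> 'a) \<Rightarrow> 'a mat" where
  "list_mat xs ys f = mat (length xs) (length ys) (\<lambda>(a, b). f (xs ! a) (ys ! b))"

lemma list_mat_dim [simp]: "dim_row (list_mat xs ys f) = length xs" "dim_col (list_mat xs ys f) = length ys"
  by (simp_all add: list_mat_def)

lemma append_cols_list_mat: "append_cols (list_mat xs ys f) (list_mat xs zs f) = list_mat xs (ys @ zs) f"
  by (intro eq_matI) (auto simp: list_mat_def nth_append)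

lemma append_rows_list_mat: "append_rows (list_mat xs zs f) (list_mat ys zs f) = list_mat (xs @ ys) zs f"
  by (intro eq_matI) (auto simp: list_mat_def nth_append append_rows_def)

lemma block_mat_list:
  assumes "\<And>i j. i < n \<Longrightarrow> j < n \<Longrightarrow> B i j = list_mat (K i) (K j) f"
  shows "block_mat n B = list_mat (concat (map K [0..<n])) (concat (map K [0..<n])) f"
proof (cases "n = 0")
  case True
  then show ?thesis by (auto simp: block_mat_def list_mat_def intro!: eq_matI)
next
  case False
  let ?c = "concat (map K [0..<n])"
  have row: "foldr append_cols (map (B i) js) (0\<^sub>m (dim_row (B i 0)) 0) = list_mat (K i) (concat (map K js)) f"
    if "i < n" "set js \<subseteq> {..<n}" for i js
    using that(2)
  proof (induction js)
    case Nil
    show ?case using assms[OF that(1), of 0] False by (auto intro!: eq_matI)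
  next
    case (Cons j js)
    then show ?case using assms[OF that(1), of j] by (simp add: append_cols_list_mat)
  qed
  have rows: "map (\<lambda>i. foldr append_cols (map (B i) [0..<n]) (0\<^sub>m (dim_row (B i 0)) 0)) [0..<n] =
      map (\<lambda>i. list_mat (K i) ?c f) [0..<n]"
    by (intro map_cong refl row) auto
  \<comment> \<open>The starting value \<open>0\<^sub>m 0 0\<close> has no columns, so the claim
    requires at least one block row.\<close>
  have col: "foldr append_rows (map (\<lambda>i. list_mat (K i) ?c f) is) (0\<^sub>m 0 0) = list_mat (concat (map K is)) ?c f"
    if "is \<noteq> []" for "is"
    using that
  proof (induction "is" rule: list_nonempty_induct)
    case (single i)
    show ?case by (intro eq_matI) (auto simp: append_rows_def list_mat_def)
  next
    case (cons i js)
    then show ?case by (simp add: append_rows_list_mat)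
  qed
  show ?thesis unfolding block_mat_def rows using False by (intro col) simp
qed

definition picks :: "nat set \<Rightarrow> nat list" where
  "picks I = map (pick I) [0..<card I]"

lemma length_picks [simp]: "length (picks I) = card I"
  by (simp add: picks_def)

lemma set_picks:
  assumes "finite I"
  shows "set (picks I) = I"
proof
  show "set (picks I) \<subseteq> I"
    using pick_in_set_le by (auto simp: picks_def)
  show "I \<subseteq> set (picks I)"
  proof
    fix i assume i: "i \<in> I"
    have "card {a \<in> I. a < i} < card I" by (rule psubset_card_mono[OF assms]) (use i in auto)
    then show "i \<in> set (picks I)" using pick_card_in_set[OF i] by (force simp: picks_def)
  qed
qed

lemma submatrix_list_mat:
  assumes A: "A \<in> carrier_mat p p" and I: "I \<subseteq> {..<p}" and J: "J \<subseteq> {..<p}"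
  shows "submatrix A I J = list_mat (picks I) (picks J) (\<lambda>i j. A $$ (i, j))"
proof -
  have e: "{i. i < dim_row A \<and> i \<in> I} = I" "{j. j < dim_col A \<and> j \<in> J} = J" using A I J by auto
  show ?thesis
    by (intro eq_matI) (auto simp: dim_submatrix submatrix_index e list_mat_def picks_def)
qed

text \<open>A pair \<open>(i, k)\<close> records block \<open>i\<close> and original row
  \<open>k\<close>. The shift \<open>d = 0\<close> gives \<open>hankel0\<close> and
  \<open>d = 1\<close> gives \<open>hankel1\<close>.\<close>

lemma block_mat_submatrix:
  assumes s: "\<And>m. s m \<in> carrier_mat p p" and I: "\<And>i. I i \<subseteq> {..<p}"
  shows "block_mat n (\<lambda>i j. submatrix (s (i + j + d)) (I i) (I j)) =
    list_mat (concat (map (\<lambda>i. map (Pair i) (picks (I i))) [0..<n])) (concat (map (\<lambda>i. map (Pair i) (picks (I i))) [0..<n]))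
      (\<lambda>(i, k) (j, l). s (i + j + d) $$ (k, l))"
proof (rule block_mat_list)
  fix i j
  show "submatrix (s (i + j + d)) (I i) (I j) =
     list_mat (map (Pair i) (picks (I i))) (map (Pair j) (picks (I j))) (\<lambda>(i, k) (j, l). s (i + j + d) $$ (k, l))"
    unfolding submatrix_list_mat[OF s I I] by (intro eq_matI) (auto simp: list_mat_def)
qed

text \<open>An even and an odd exponent have odd sum, where \<open>markov_seq\<close> is zero.
  Inside a block the signs of the basis cancel the alternating sign of the Markov expansion; in the
  odd block the factor \<open>(-1) ^ (2 * i + 1)\<close> offsets the extra step in
  \<open>s (i + j + 1)\<close>.\<close>

lemma gram_mat_blocks:
  assumes "\<And>m. s m \<in> carrier_mat p p"
  shows "gram_mat (markov_seq s) (map (\<lambda>(i, k). (2 * i, k)) L0 @ map (\<lambda>(i, k). (2 * i + 1, k)) L1) =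
    four_block_mat (list_mat L0 L0 (\<lambda>(i, k) (j, l). s (i + j) $$ (k, l))) (0\<^sub>m (length L0) (length L1))
      (0\<^sub>m (length L1) (length L0)) (list_mat L1 L1 (\<lambda>(i, k) (j, l). s (i + j + 1) $$ (k, l)))"
    (is "gram_mat ?w ?L = four_block_mat ?H0 _ _ ?H1")
proof (rule eq_matI)
  fix a b
  assume "a < dim_row (four_block_mat ?H0 (0\<^sub>m (length L0) (length L1)) (0\<^sub>m (length L1) (length L0)) ?H1)"
    "b < dim_col (four_block_mat ?H0 (0\<^sub>m (length L0) (length L1)) (0\<^sub>m (length L1) (length L0)) ?H1)"
  then have ab: "a < length L0 + length L1" "b < length L0 + length L1" by simp_all
  have nth: "?L ! t = (if t < length L0 then (2 * fst (L0 ! t), snd (L0 ! t))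
      else (2 * fst (L1 ! (t - length L0)) + 1, snd (L1 ! (t - length L0))))" if "t < length L0 + length L1" for t
    using that by (simp add: nth_append case_prod_unfold)
  have d: "(2 * x + 1 + (2 * y + 1)) div 2 = x + y + 1" "(2 * x + 2 * y) div 2 = x + y" for x y :: nat by auto
  have g: "gram_mat ?w ?L $$ (a, b) = (-1) ^ (fst (?L ! a) div 2) * (-1) ^ fst (?L ! a) * (-1) ^ (fst (?L ! b) div 2) *
      ?w (snd (?L ! a)) (snd (?L ! b)) (fst (?L ! a) + fst (?L ! b))"
    using ab by (simp add: gram_mat_def)
  have pw: "(-1) ^ x * ((-1) ^ y * ((-1) ^ x * (-1) ^ y)) = (1 :: complex)" for x y
    by (cases "even x"; cases "even y"; simp)+
  show "gram_mat ?w ?L $$ (a, b) =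
      four_block_mat ?H0 (0\<^sub>m (length L0) (length L1)) (0\<^sub>m (length L1) (length L0)) ?H1 $$ (a, b)"
    unfolding g nth[OF ab(1)] nth[OF ab(2)] using ab
    by (auto simp: markov_seq_def list_mat_def case_prod_unfold d power_add pw)
qed (auto simp: gram_mat_def)

text \<open>The column degrees of the dominant part are half those of \<open>F\<close>, rounded
  down. So the two families list exactly the columns in which the odd power
  \<open>2 * i + 1\<close>, respectively the even power \<open>2 * i\<close>, lies below the column
  degree; the shifted index for odd columns in \<open>idx_tilde\<close> corrects the
  rounding.\<close>

lemma idx_eq:
  assumes F: "F \<in> carrier_mat p p" "column_reduced F" "upper_triangular (hcdc F)"
  shows "idx F (int i) = {k. k < p \<and> 2 * i + 1 < cdeg F k}"
    "idx_tilde F i = {k. k < p \<and> 2 * i < cdeg F k}"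
proof -
  have F1: "dim_col F = p" using F by simp
  have k: "k < p \<and> int (cdeg (dominant_part F) k) > j \<longleftrightarrow> k < p \<and> int (cdeg F k div 2) > j" for j k
    using cdeg_dominant_part[OF F] by auto
  show "idx F (int i) = {k. k < p \<and> 2 * i + 1 < cdeg F k}"
    unfolding idx_def F1 k by auto
  show "idx_tilde F i = {k. k < p \<and> 2 * i < cdeg F k}"
    unfolding idx_tilde_def idx_even_def idx_odd_def idx_def F1 k by (auto elim!: evenE oddE)
qed

text \<open>Double counting: summed over \<open>i\<close>, column \<open>k\<close> contributes the
  exponents \<open>2 * i + d\<close> below \<open>c k\<close>. The values \<open>d = 0\<close> and
  \<open>d = 1\<close> together account for the full column degree.\<close>

lemma length_index_list:
  assumes "\<And>i. i < n \<Longrightarrow> I i = {k. k < p \<and> 2 * i + d < c k}" "\<And>k. k < p \<Longrightarrow> (c k + 1 - d) div 2 \<le> n" "d \<le> 1"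
  shows "length (concat (map (\<lambda>i. map (Pair i) (picks (I i))) [0..<n])) = (\<Sum>k<p. (c k + 1 - d) div 2)"
proof -
  have "length (concat (map (\<lambda>i. map (Pair i) (picks (I i))) [0..<n])) = (\<Sum>i<n. card (I i))"
    by (simp add: length_concat comp_def interv_sum_list_conv_sum_set_nat lessThan_atLeast0)
  also have "\<dots> = (\<Sum>i<n. \<Sum>k<p. if 2 * i + d < c k then 1 else 0)"
  proof (intro sum.cong refl)
    fix i assume "i \<in> {..<n}"
    then have "I i = {k \<in> {..<p}. 2 * i + d < c k}" using assms(1) by auto
    then show "card (I i) = (\<Sum>k<p. if 2 * i + d < c k then 1 else 0)" by (simp add: sum.If_cases Int_def)
  qed
  also have "\<dots> = (\<Sum>k<p. \<Sum>i<n. if 2 * i + d < c k then 1 else 0)" by (rule sum.swap)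
  also have "\<dots> = (\<Sum>k<p. (c k + 1 - d) div 2)"
  proof (intro sum.cong refl)
    fix k assume "k \<in> {..<p}"
    then have "{i \<in> {..<n}. 2 * i + d < c k} = {..<(c k + 1 - d) div 2}" using assms(2)[of k] assms(3) by auto
    then show "(\<Sum>i<n. if 2 * i + d < c k then 1 else 0) = (c k + 1 - d) div 2"
      by (simp add: sum.If_cases Int_def)
  qed
  finally show ?thesis .
qed

lemma hcdc_coefficients:
  assumes F: "F \<in> carrier_mat p p" "column_reduced F"
  shows "det (mat p p (\<lambda>(i, k). coeff (F $$ (i, k)) (cdeg F k))) \<noteq> 0"
  using F unfolding column_reduced_def by (simp add: hcdc_index)

lemma cdeg_le_mat_deg: "k < dim_col F \<Longrightarrow> cdeg F k \<le> mat_deg F"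
  unfolding mat_deg_def by (intro Max_ge) auto

lemma mat_deg_attained:
  assumes "0 < dim_col F"
  shows "\<exists>k<dim_col F. cdeg F k = mat_deg F"
proof -
  have "mat_deg F \<in> cdeg F ` {..<dim_col F}" unfolding mat_deg_def using assms by (intro Max_in) auto
  then show ?thesis by (metis imageE lessThan_iff)
qed

text \<open>\<open>dominant_part F\<close> has the leading column coefficient matrix of
  \<open>F\<close>, at half the degrees.\<close>

lemma det_dominant_part_nonzero:
  assumes F: "F \<in> carrier_mat p p" "column_reduced F" "upper_triangular (hcdc F)"
  shows "det (dominant_part F) \<noteq> 0"
proof (rule degree_det_columns(2)[where c = "\<lambda>k. cdeg F k div 2"])
  show D: "dominant_part F \<in> carrier_mat p p" using F by simp
  show "degree (dominant_part F $$ (i, k)) \<le> cdeg F k div 2" if "i < p" "k < p" for i k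
    using hcdc_decomposition(1)[of i "dominant_part F" k] that D cdeg_dominant_part[OF F that(2)] by simp
  have "mat p p (\<lambda>(i, k). coeff (dominant_part F $$ (i, k)) (cdeg F k div 2)) =
      mat p p (\<lambda>(i, k). coeff (F $$ (i, k)) (cdeg F k))"
    using F by (intro eq_matI) (auto simp: dominant_part_def coeff_even_part coeff_odd_part odd_two_times_div_two_succ)
  then show "det (mat p p (\<lambda>(i, k). coeff (dominant_part F $$ (i, k)) (cdeg F k div 2))) \<noteq> 0"
    using hcdc_coefficients[OF F(1,2)] by simp
qed

theorem theorem4p7:
  fixes p :: nat and F G :: "complex poly mat" and s :: "nat \<Rightarrow> complex mat"
  assumes "0 < p" and "F \<in> carrier_mat p p"
    and "mat_deg F \<noteq> 0"
    and "column_reduced F" and "upper_triangular (hcdc F)"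
    and "markov_expansion F s"
    and "\<forall>k\<le>markov_last F. mat_adjoint (s k) = s k"
    and "is_gcrd p G (D_part F) (S_part F)"
  shows "gamma_neg F =
        inertia_pos (hankel0 F s) + inertia_pos (hankel1 F s) + gamma_neg G \<and>
      gamma_pos F =
        inertia_neg (hankel0 F s) + inertia_neg (hankel1 F s) + gamma_pos G \<and>
      int (gamma_zero F) =
        int (inertia_zero (hankel0 F s)) + int (inertia_zero (hankel1 F s))
        - int (gamma_pos G) - int (gamma_neg G)"
proof -
  note F = assms(2,4,5)
  have dims: "dim_row F = p" "dim_col F = p" using F(1) by auto
  have s: "s m \<in> carrier_mat p p" for m using assms(6) dims unfolding markov_expansion_def by simp
  define c where "c = cdeg F"
  define w where "w = markov_seq s"
  define D S where "D = D_part F" and "S = S_part F"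
  have D: "D \<in> carrier_mat p p" and S: "S \<in> carrier_mat p p" using F by (simp_all add: D_def S_def)
  have DS: "D + S = F" unfolding D_def S_def by (rule D_plus_S[symmetric])
  have co: "coeff (D $$ (i, k)) n = (if even n = even (c k) then coeff (F $$ (i, k)) n else 0)" if "i < p" "k < p" for i k n
    unfolding D_def c_def by (rule coeff_D_part[OF F(1) that])
  have degF: "degree (F $$ (i, k)) \<le> c k" if "i < p" "k < p" for i k
    using hcdc_decomposition(1)[of i F k] that dims by (simp add: c_def)
  have degD: "degree (D $$ (i, k)) \<le> c k" if ik: "i < p" "k < p" for i k
  proof (rule degree_le, intro allI impI)
    fix n assume "c k < n"
    then show "coeff (D $$ (i, k)) n = 0" unfolding co[OF ik] using degF[OF ik] by (simp add: coeff_eq_0)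
  qed
  have upper: "coeff (D $$ (i, k)) (c k) = 0" if "i < p" "k < i" for i k
    using that F(3) dims unfolding upper_triangular_def by (auto simp: co hcdc_def c_def)
  have diag: "coeff (D $$ (k, k)) (c k) \<noteq> 0" if "k < p" for k
    using hcdc_diag_nonzero[OF F that] that by (simp add: co c_def)
  have frac: "fraction_seq p w D S"
    unfolding w_def D_def S_def by (rule markov_fraction_seq[OF F(1) det_dominant_part_nonzero[OF F] assms(6)])
  let ?allev = "\<forall>k<dim_col F. even (cdeg F k)"
  define h where "h = half_deg F"
  \<comment> \<open>If all column degrees are even, they are at most \<open>2 * h\<close> and the
    even exponents stop at \<open>2 * h - 2\<close>; otherwise \<open>2 * h\<close> may occur and
    one more block row is needed.\<close>
  define n0 where "n0 = (if ?allev then h else h + 1)"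
  have cle: "c k \<le> mat_deg F" if "k < p" for k using cdeg_le_mat_deg[of k F] that dims by (simp add: c_def)
  have n0: "(c k + 1) div 2 \<le> n0" if "k < p" for k
  proof (cases ?allev)
    case True
    then have "even (c k)" using that dims by (simp add: c_def)
    then show ?thesis using cle[OF that] True by (auto simp: n0_def h_def elim!: evenE)
  next
    case False
    then show ?thesis using cle[OF that] by (auto simp: n0_def h_def)
  qed
  have h: "c k div 2 \<le> h" if "k < p" for k using cle[OF that] by (simp add: h_def div_le_mono)
  define L0 where "L0 = concat (map (\<lambda>i. map (Pair i) (picks (idx_tilde F i))) [0..<n0])"
  define L1 where "L1 = concat (map (\<lambda>i. map (Pair i) (picks (idx F (int i)))) [0..<h])"
  have H0: "hankel0 F s = list_mat L0 L0 (\<lambda>(i, k) (j, l). s (i + j) $$ (k, l))"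
  proof -
    have I: "idx_tilde F i \<subseteq> {..<p}" for i by (auto simp: idx_eq(2)[OF F])
    show ?thesis unfolding hankel0_def L0_def h_def[symmetric] n0_def[symmetric]
      using block_mat_submatrix[OF s I, where n = n0 and d = 0] by simp
  qed
  have H1: "hankel1 F s = list_mat L1 L1 (\<lambda>(i, k) (j, l). s (i + j + 1) $$ (k, l))"
  proof -
    have I: "idx F (int i) \<subseteq> {..<p}" for i by (auto simp: idx_eq(1)[OF F])
    show ?thesis unfolding hankel1_def L1_def h_def[symmetric] by (rule block_mat_submatrix[OF s I])
  qed
  define L where "L = map (\<lambda>(i, k). (2 * i, k)) L0 @ map (\<lambda>(i, k). (2 * i + 1, k)) L1"
  have gram: "gram_mat w L = four_block_mat (hankel0 F s) (0\<^sub>m (length L0) (length L1)) (0\<^sub>m (length L1) (length L0)) (hankel1 F s)"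
    unfolding w_def L_def H0 H1 by (rule gram_mat_blocks[OF s])
  have setL0: "set L0 = {(i, k). k < p \<and> 2 * i < c k}"
  proof -
    have "i < n0" if "k < p" "2 * i < c k" for i k using n0[OF that(1)] that(2) by linarith
    then show ?thesis by (auto simp: L0_def set_picks idx_eq(2)[OF F] c_def intro!: bexI imageI)
  qed
  have setL1: "set L1 = {(i, k). k < p \<and> 2 * i + 1 < c k}"
  proof -
    have "i < h" if "k < p" "2 * i + 1 < c k" for i k using h[OF that(1)] that(2) by linarith
    then show ?thesis by (auto simp: L1_def set_picks idx_eq(1)[OF F] c_def intro!: bexI imageI)
  qed
  have setL: "set L = {(j, k). k < p \<and> j < c k}"
  proof -
    have "(j, k) \<in> set L \<longleftrightarrow> k < p \<and> j < c k" for j k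
    proof (cases "even j")
      case True
      then obtain i where "j = 2 * i" by (elim evenE)
      then show ?thesis unfolding L_def set_append set_map setL0 setL1 by (auto simp: image_iff)
    next
      case False
      then obtain i where "j = 2 * i + 1" by (elim oddE)
      then show ?thesis unfolding L_def set_append set_map setL0 setL1 by (auto simp: image_iff)
    qed
    then show ?thesis by auto
  qed
  have lenL: "length L = (\<Sum>k<p. c k)"
  proof -
    have "length L0 = (\<Sum>k<p. (c k + 1) div 2)"
      unfolding L0_def using length_index_list[of n0 "idx_tilde F" p 0 c] n0 idx_eq(2)[OF F] by (simp add: c_def)
    moreover have "length L1 = (\<Sum>k<p. c k div 2)"
      unfolding L1_def using length_index_list[of h "\<lambda>i. idx F (int i)" p 1 c] h idx_eq(1)[OF F] by (simp add: c_def)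
    moreover have "(c k + 1) div 2 + c k div 2 = c k" for k by presburger
    ultimately show ?thesis by (simp add: L_def sum.distrib[symmetric])
  qed
  \<comment> \<open>An index \<open>m < 2 * mat_deg F\<close> involves only \<open>s t\<close> with
    \<open>t < mat_deg F\<close>. Since \<open>mat_deg F\<close> is at most
    \<open>2 * h + 1\<close>, and equals \<open>2 * h\<close> if all column degrees are even, such
    \<open>t\<close> do not exceed \<open>markov_last F\<close>.\<close>
  have herm: "cnj (w j i m) = w i j m" if "i < p" "j < p" "m < 2 * mat_deg F" for i j m
  proof (cases "even m")
    case True
    define t where "t = m div 2"
    have "t < mat_deg F" using that(3) by (simp add: t_def)
    have "t \<le> markov_last F"
    proof (cases ?allev)
      case True
      then have "even (mat_deg F)" using mat_deg_attained[of F] dims assms(1) by auto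
      then show ?thesis using True \<open>t < mat_deg F\<close> by (auto simp: markov_last_def elim!: evenE)
    next
      case False
      then show ?thesis using \<open>t < mat_deg F\<close> by (auto simp: markov_last_def)
    qed
    then have "mat_adjoint (s t) = s t" using assms(7) by blast
    then have "cnj (s t $$ (j, i)) = s t $$ (i, j)"
      using mat_adjoint_index[of i "s t" j] that s[of t] by simp
    then show ?thesis using True by (simp add: w_def markov_seq_def t_def)
  qed (simp add: w_def markov_seq_def)
  have detF: "degree (det (D + S)) = length L"
    unfolding DS lenL c_def by (rule degree_det_columns(1)[OF F(1) degF[unfolded c_def] hcdc_coefficients[OF F(1,2)]])
  have "mat p p (\<lambda>(i, k). coeff (D $$ (i, k)) (c k)) = mat p p (\<lambda>(i, k). coeff (F $$ (i, k)) (cdeg F k))"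
    by (intro eq_matI) (auto simp: co c_def)
  then have hD: "det (mat p p (\<lambda>(i, k). coeff (D $$ (i, k)) (c k))) \<noteq> 0"
    using hcdc_coefficients[OF F(1,2)] by simp
  have detD: "degree (det D) = length L" "det D \<noteq> 0"
    unfolding lenL by (rule degree_det_columns[OF D degD hD]; simp)+
  have odd: "w i j m = 0" if "odd m" for i j m using that by (simp add: w_def markov_seq_def)
  obtain E M Q Q' T B C where "realization p (length L) D S E M Q Q' T B C (gram_mat w L)"
    using realization_exists[OF D S frac degD upper diag setL cle herm odd detD(1) detF] by blast
  then interpret realization p "length L" D S E M Q Q' T B C "gram_mat w L" .
  obtain X Y D1 S1 where G: "X \<in> carrier_mat p p" "Y \<in> carrier_mat p p" "D1 \<in> carrier_mat p p" "S1 \<in> carrier_mat p p"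
    "G \<in> carrier_mat p p" "D = D1 * G" "S = S1 * G" "G = X * S + Y * D"
    using gcrd_bezout[OF assms(8)[folded D_def S_def] D S detD(2)] by blast
  note main = root_count_main[OF G(5,3,4,6,7) G(1,2,8), unfolded DS]
  have Hc: "hankel0 F s \<in> carrier_mat (length L0) (length L0)" "hankel1 F s \<in> carrier_mat (length L1) (length L1)"
    unfolding H0 H1 by (simp_all add: list_mat_def)
  have ch: "char_poly (gram_mat w L) = char_poly (hankel0 F s) * char_poly (hankel1 F s)"
    unfolding gram by (rule char_poly_four_block_lower_left_zero[OF Hc(1) zero_carrier_mat Hc(2)])
  note cnt = root_count_mult[OF char_poly_nonzero[OF Hc(1)] char_poly_nonzero[OF Hc(2)], folded ch]
  have defs: "gamma_neg K = lhp (det K)" "gamma_pos K = rhp (det K)" "gamma_zero K = iax (det K)" for K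
    by (simp_all add: gamma_neg_def gamma_pos_def gamma_zero_def lhp_def rhp_def iax_def)
  have idefs: "inertia_neg K = lhp (char_poly K)" "inertia_pos K = rhp (char_poly K)" "inertia_zero K = iax (char_poly K)" for K
    by (simp_all add: inertia_neg_def inertia_pos_def inertia_zero_def lhp_def rhp_def iax_def)
  \<comment> \<open>In the third identity the zero eigenvalues of the two Hankel matrices add up to
    the degree of \<open>det G\<close>, from which the off-axis zeros of \<open>G\<close> are
    removed.\<close>
  show ?thesis
    unfolding defs idefs using main cnt degree_eq_root_count[of "det G"] by simp
qed

end
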